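(* Let $F \in \mathrm{Bin}(4, \mathbb{Q})$ be such that $$F(\mathbb{Z}^2) = \{m : m = t^4 + u^4 \text{ for some } (t, u) \in \mathbb{Z}^2\}.$$ Then there exists $(a, b, c, d) \in \mathbb{Z}^4$ with $ad - bc = \pm 1$ such that $$F(X, Y) = (aX + cY)^4 + (bX + dY)^4.$$
   Context: $\mathrm{Bin}(4, \mathbb{Q})$ is the set of binary forms (homogeneous polynomials in $X, Y$) of degree $4$ with rational coefficients and non-zero discriminant. $F(\mathbb{Z}^2)$ denotes the set of values $F(x,y)$ with $(x,y) \in \mathbb{Z}^2$. *)

theory Defs
  imports Complex_Main "HOL-Computational_Algebra.Polynomial"
begin

text \<open>
  A polynomial in two variables \<open>X\<close>, \<open>Y\<close> is rendered as a polynomial in \<open>Y\<close> whose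
  coefficients are polynomials in \<open>X\<close>.  Thus the coefficient of \<open>X\<^sup>i Y\<^sup>j\<close> in \<open>F\<close> is
  \<open>coeff (coeff F j) i\<close>.
\<close>

definition varX :: "'a::comm_ring_1 poly poly" where
  "varX = [:[:0, 1:]:]"

definition varY :: "'a::comm_ring_1 poly poly" where
  "varY = [:0, 1:]"

definition eval2 :: "'a::comm_ring_1 poly poly \<Rightarrow> 'a \<Rightarrow> 'a \<Rightarrow> 'a" where
  "eval2 F x y = poly (poly F [:y:]) x"

definition binary_form :: "nat \<Rightarrow> 'a::comm_ring_1 poly poly \<Rightarrow> bool" where
  "binary_form n F \<longleftrightarrow> (\<forall>i j. coeff (coeff F j) i \<noteq> 0 \<longrightarrow> i + j = n)"

text \<open>
  The classical discriminant of
  \<open>a X\<^sup>4 + b X\<^sup>3 Y + c X\<^sup>2 Y\<^sup>2 + d X Y\<^sup>3 + e Y\<^sup>4\<close>, written out in the coefficients;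
  \<open>a = 0\<close> is allowed.  Lemma \<open>disc4_prod_linear\<close> below identifies it with the product of the
  \<open>(\<alpha>\<^sub>i \<beta>\<^sub>j - \<alpha>\<^sub>j \<beta>\<^sub>i)\<^sup>2\<close>, \<open>i < j\<close>, for a form that is the product of the linear forms
  \<open>\<alpha>\<^sub>i X + \<beta>\<^sub>i Y\<close>.
\<close>

definition disc4 :: "'a::comm_ring_1 poly poly \<Rightarrow> 'a" where
  "disc4 F =
    (let a = coeff (coeff F 0) 4; b = coeff (coeff F 1) 3; c = coeff (coeff F 2) 2;
         d = coeff (coeff F 3) 1; e = coeff (coeff F 4) 0
     in 256 * a^3 * e^3 - 192 * a^2 * b * d * e^2 - 128 * a^2 * c^2 * e^2
        + 144 * a^2 * c * d^2 * e - 27 * a^2 * d^4 + 144 * a * b^2 * c * e^2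
        - 6 * a * b^2 * d^2 * e - 80 * a * b * c^2 * d * e + 18 * a * b * c * d^3
        + 16 * a * c^4 * e - 4 * a * c^3 * d^2 - 27 * b^4 * e^2 + 18 * b^3 * c * d * e
        - 4 * b^3 * d^3 - 4 * b^2 * c^3 * e + b^2 * c^2 * d^2)"

definition Bin4 :: "'a::comm_ring_1 poly poly set" where
  "Bin4 = {F. binary_form 4 F \<and> disc4 F \<noteq> 0}"

lemma eval2_simps [simp]:
  "eval2 varX x y = x" "eval2 varY x y = y" "eval2 (of_int k) x y = of_int k"
  "eval2 (F + G) x y = eval2 F x y + eval2 G x y"
  "eval2 (F * G) x y = eval2 F x y * eval2 G x y"
  "eval2 (F ^ n) x y = eval2 F x y ^ n"
  by (simp_all add: eval2_def varX_def varY_def of_int_poly poly_power)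

lemma disc4_prod_linear:
  fixes \<alpha> \<beta> :: "nat \<Rightarrow> 'a::field_char_0"
  shows "disc4 (\<Prod>i<4. [:[:\<alpha> i:]:] * varX + [:[:\<beta> i:]:] * varY) =
         (\<Prod>j<4. \<Prod>i<j. (\<alpha> i * \<beta> j - \<alpha> j * \<beta> i)^2)"
proof -
  define p q r s where "p = \<alpha> 0" and "q = \<alpha> 1" and "r = \<alpha> 2" and "s = \<alpha> 3"
  define P Q R S where "P = \<beta> 0" and "Q = \<beta> 1" and "R = \<beta> 2" and "S = \<beta> 3"
  note ab = p_def q_def r_def s_def P_def Q_def R_def S_def
  define F where "F = (\<Prod>i<4. [:[:\<alpha> i:]:] * varX + [:[:\<beta> i:]:] * varY)"
  have lin: "[:[:x:]:] * varX + [:[:y:]:] * varY = [:[:0, x:], [:y:]:]" for x y :: 'a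
    by (simp add: varX_def varY_def)
  have F: "F = [:[:0, p:], [:P:]:] * [:[:0, q:], [:Q:]:] * [:[:0, r:], [:R:]:] * [:[:0, s:], [:S:]:]"
    unfolding F_def lin ab
    by (simp add: eval_nat_numeral prod.lessThan_Suc del: mult_pCons_left mult_pCons_right)
  define a b c d e where "a = p*q*r*s" and "b = P*q*r*s + p*Q*r*s + p*q*R*s + p*q*r*S"
    and "c = P*Q*r*s + P*q*R*s + P*q*r*S + p*Q*R*s + p*Q*r*S + p*q*R*S"
    and "d = P*Q*R*s + P*Q*r*S + P*q*R*S + p*Q*R*S" and "e = P*Q*R*S"
  have co: "coeff (coeff F 0) 4 = a" "coeff (coeff F 1) 3 = b" "coeff (coeff F 2) 2 = c"
    "coeff (coeff F 3) 1 = d" "coeff (coeff F 4) 0 = e"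
    unfolding F a_def b_def c_def d_def e_def
    by (simp_all add: eval_nat_numeral algebra_simps)
  define U V W where "U = (p*Q - q*P) * (r*S - s*R)" and "V = (p*R - r*P) * (q*S - s*Q)"
    and "W = (p*S - s*P) * (q*R - r*Q)"
  define I J where "I = 12*a*e - 3*b*d + c^2"
    and "J = 72*a*c*e + 9*b*c*d - 27*a*d^2 - 27*e*b^2 - 2*c^3"
  have VW: "V = U + W" by (simp add: U_def V_def W_def algebra_simps)
  have I: "I = U^2 + U*W + W^2"
    unfolding I_def U_def W_def a_def b_def c_def d_def e_def by algebra
  have J: "J = (U - W) * (2*U + W) * (U + 2*W)"
    unfolding J_def U_def W_def a_def b_def c_def d_def e_def by algebra
  have "27 * disc4 F = 4 * I^3 - J^2"
    unfolding disc4_def Let_def co I_def J_def by algebra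
  also have "\<dots> = 27 * (U * V * W)^2"
    unfolding I J VW by algebra
  finally have "disc4 F = (U * V * W)^2" by simp
  also have "\<dots> = (\<Prod>j<4. \<Prod>i<j. (\<alpha> i * \<beta> j - \<alpha> j * \<beta> i)^2)"
    by (simp add: U_def V_def W_def ab eval_nat_numeral lessThan_Suc power_mult_distrib mult_ac)
  finally show ?thesis unfolding F_def .
qed

end

theory Submission
  imports "HOL-Number_Theory.Number_Theory" Defs
begin

text \<open>
  Write \<open>G(t,u) = t\<^sup>4 + u\<^sup>4\<close>.  Suppose a prime \<open>p\<close> divides \<open>G(v')\<close> for some nonzero \<open>v'\<close> with
  \<open>p\<close> much larger than \<open>|v'|\<^sup>2\<close>, and take \<open>v\<close> with \<open>F(v) = G(v')\<close>.  On the lattice of all \<open>w\<close> with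
  \<open>det(v,w) \<equiv> 0\<close> modulo \<open>p\<close> the values of \<open>F\<close> are divisible by \<open>p\<close>.  If \<open>p\<close> divides \<open>G(t,u)\<close>, then, up to
  signs and order, \<open>(t,u)\<close> lies in the lattice \<open>det(v',w) \<equiv> 0\<close>.  Both lattices are so skew that for
  \<open>w = a v + v\<^sub>1\<close>, with \<open>a\<close> of size \<open>p / |v|\<^sup>2\<close>, one gets \<open>(t,u) = a' v' + b' v'\<^sub>1\<close> with \<open>b'\<close> bounded.  Hence
  \<open>(a,a')\<close> lies on one of boundedly many curves \<open>\<phi>(a) = \<gamma>\<^bsub>b'\<^esub>(a')\<close> of small curvature.  Among boundedly many
  consecutive \<open>a\<close> five points of one curve are collinear, and the quartic equation becomes an
  identity: \<open>F = G \<circ> M\<close> for a rational matrix \<open>M\<close> with denominator \<open>p\<close>.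

  Two different primes give the same \<open>M\<close> up to the signed permutations, the only
  automorphisms of \<open>G\<close>, so \<open>M\<close> is integral.  The values 1 and 2 of \<open>G\<close> have essentially one
  representation each, so the image of \<open>M\<close> is the whole of the integral plane.

  Such primes exist by an argument of Chebyshev: if all prime factors of the values of \<open>G\<close> on
  \<open>[1,R]\<^sup>2\<close> were \<open>O(R\<^sup>2)\<close>, the lattices attached to the roots of \<open>z\<^sup>4 + 1\<close> would be balanced, and
  counting their points bounds the sum of \<open>ln G\<close> by \<open>3 R\<^sup>2 ln R + O(R\<^sup>2)\<close>, whereas it is at least
  \<open>4 R\<^sup>2 ln R - O(R\<^sup>2)\<close>.
\<close>

subsection \<open>Chebyshev and Mertens estimates\<close>

text \<open>Equality of value sets pairs each v with some v' but says nothing on how the pairs fit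
  together; a prime p far above |v'|^2 turns divisibility into lattice conditions on both sides. The
  obstacle in the curve step is that \<gamma> may be flat, and there a bounded step of a allows a
  long step of a'. Convexity of \<gamma> confines the flat points of one curve to a short interval
  of a, so one of several widely spaced windows avoids them all. Collinearity is then an integrality
  argument: the integral determinant of three points is below 1 in absolute value.

  The 3 in the Chebyshev count is 1 + 2. Counting by rows gives about R^2/d points per root for d up
  to R; for d between R and a multiple of R^2 a covering by parallel lines loses a factor 2. Only
  primes 1 modulo 8 and the prime 2 have roots, the odd ones at most four each, so the weights 4
  \<Lambda>(d)/d over that class must sum to ln R and not to 4 ln R; this calls for the estimate in
  the residue class. Positive definiteness of F, which bounds the curves, follows from non-negative
  values and non-zero discriminant.\<close>

lemma sum_divisors_swap:
  fixes f :: "nat \<Rightarrow> nat \<Rightarrow> 'a::comm_monoid_add"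
  shows "(\<Sum>n=1..x. \<Sum>d | d dvd n. f d (n div d)) = (\<Sum>d=1..x. \<Sum>m=1..x div d. f d m)"
proof -
  have "(\<Sum>n=1..x. \<Sum>d | d dvd n. f d (n div d))
      = (\<Sum>(n,d)\<in>(SIGMA n:{1..x}. {d. d dvd n}). f d (n div d))"
    by (subst sum.Sigma) auto
  also have "\<dots> = (\<Sum>(d,m)\<in>(SIGMA d:{1..x}. {1..x div d}). f d m)"
    by (rule sum.reindex_bij_witness[of _ "\<lambda>(d,m). (d*m,d)" "\<lambda>(n,d). (d, n div d)"])
       (auto simp: Suc_le_eq less_eq_div_iff_mult_less_eq mult.commute
             intro: order.trans[OF dvd_imp_le] elim!: dvdE, (meson dvd_imp_le dvd_triv_left mult_pos_pos order.trans)+)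
  also have "\<dots> = (\<Sum>d=1..x. \<Sum>m=1..x div d. f d m)"
    by (subst sum.Sigma) auto
  finally show ?thesis .
qed

abbreviation vM :: "nat \<Rightarrow> real" where "vM \<equiv> mangoldt"

definition psi :: "nat \<Rightarrow> real" where "psi n = (\<Sum>d=1..n. vM d)"

lemma psi_mono: "m \<le> n \<Longrightarrow> psi m \<le> psi n"
  unfolding psi_def by (rule sum_mono2) (auto simp: mangoldt_nonneg)

lemma ln_fact_mangoldt: "ln (fact x) = (\<Sum>d=1..x. vM d * real (x div d))"
proof -
  have "ln (fact x :: real) = (\<Sum>n=1..x. ln (real n))"
    by (subst fact_prod, subst of_nat_prod, subst ln_prod) auto
  also have "\<dots> = (\<Sum>n=1..x. \<Sum>d | d dvd n. vM d)"
    by (intro sum.cong refl) (simp add: mangoldt_sum)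
  also have "\<dots> = (\<Sum>d=1..x. vM d * real (x div d))"
    using sum_divisors_swap[of "\<lambda>d m. vM d" x] by (simp add: mult.commute)
  finally show ?thesis .
qed

text \<open>In the logarithm of the central binomial coefficient, which is at most
  \<open>2 ^ (2*n)\<close>, the weight of \<open>vM d\<close> is \<open>2*n div d\<close> minus
  twice \<open>n div d\<close>: it is never negative, and it is 1 for
  \<open>n < d \<le> 2*n\<close>.\<close>

lemma psi_double: "psi (2 * n) \<le> psi n + 2 * real n * ln 2"
proof -
  have "psi (2*n) - psi n = (\<Sum>d=n+1..2*n. vM d)"
  proof -
    have "{1..2*n} = {1..n} \<union> {n+1..2*n}" by auto
    hence "psi (2*n) = psi n + (\<Sum>d=n+1..2*n. vM d)"
      unfolding psi_def by (simp add: sum.union_disjoint)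
    thus ?thesis by simp
  qed
  also have "\<dots> \<le> (\<Sum>d=1..2*n. vM d * (real (2*n div d) - 2 * real (n div d)))"
  proof -
    have "(\<Sum>d=n+1..2*n. vM d) = (\<Sum>d=n+1..2*n. vM d * (real (2*n div d) - 2 * real (n div d)))"
    proof (rule sum.cong[OF refl])
      fix d assume d: "d \<in> {n+1..2*n}"
      have "2*n div d = 1" using d by (intro div_nat_eqI) auto
      thus "vM d = vM d * (real (2*n div d) - 2 * real (n div d))" using d by simp
    qed
    also have "\<dots> \<le> (\<Sum>d=1..2*n. vM d * (real (2*n div d) - 2 * real (n div d)))"
    proof (rule sum_mono2)
      fix d assume d: "d \<in> {1..2*n} - {n+1..2*n}"
      have "2 * (n div d) \<le> 2*n div d" using d
        by (metis div_times_less_eq_dividend less_eq_div_iff_mult_less_eq mult.assoc mult_le_mono2 Diff_iff atLeastAtMost_iff less_eq_Suc_le One_nat_def)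
      hence "real (2*n div d) - 2 * real (n div d) \<ge> 0" by linarith
      thus "0 \<le> vM d * (real (2*n div d) - 2 * real (n div d))" by (simp add: mangoldt_nonneg)
    qed auto
    finally show ?thesis .
  qed
  also have "\<dots> = ln (fact (2*n)) - 2 * (\<Sum>d=1..2*n. vM d * real (n div d))"
    by (simp add: ln_fact_mangoldt algebra_simps sum_subtractf sum_distrib_left)
  also have "(\<Sum>d=1..2*n. vM d * real (n div d)) = (\<Sum>d=1..n. vM d * real (n div d))"
    by (rule sum.mono_neutral_right) auto
  also have "\<dots> = ln (fact n)" by (simp add: ln_fact_mangoldt)
  also have "ln (fact (2*n)) - 2 * ln (fact n) = ln (real (2*n choose n))"
  proof -
    have "real (2*n choose n) = fact (2*n) / (fact n * fact n)"
      by (subst binomial_fact) auto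
    thus ?thesis by (simp add: ln_div ln_mult)
  qed
  also have "\<dots> \<le> ln (2 ^ (2*n))"
  proof -
    have "2*n choose n \<le> (\<Sum>k\<le>2*n. 2*n choose k)" by (rule member_le_sum) auto
    also have "\<dots> = 2 ^ (2*n)" by (rule choose_row_sum)
    finally have "real (2*n choose n) \<le> 2^(2*n)" using of_nat_le_iff by fastforce
    thus ?thesis by (subst ln_le_cancel_iff) (auto simp: zero_less_binomial)
  qed
  also have "\<dots> = 2 * real n * ln 2" by (subst ln_realpow) auto
  finally show ?thesis by simp
qed

text \<open>Iterated halving. The doubling step alone suggests the constant 2 ln 2; the slack up to
  4 pays for rounding an odd \<open>n = 2*m+1\<close> up to \<open>2*(m+1)\<close>.\<close>

lemma psi_le: "psi n \<le> 4 * real n"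
proof (induction n rule: less_induct)
  case (less n)
  have ln2: "ln 2 \<le> (1::real)" using ln_2_less_1 by simp
  consider "n = 0" | "n = 1" | m where "n = 2*m" "m > 0" | m where "n = 2*m+1" "m > 0"
    by (metis One_nat_def add_eq_if mult_0_right not_gr_zero oddE Suc_eq_plus1 even_iff_mod_2_eq_zero evenE mult_is_0)
  thus ?case
  proof cases
    case (3 m)
    have "psi n \<le> 4 * real m + 2 * real m * ln 2"
      using psi_double[of m] less.IH[of m] 3 by auto
    also have "2 * real m * ln 2 \<le> 2 * real m * 1" using ln2 by (intro mult_left_mono) auto
    finally show ?thesis using 3 by simp
  next
    case (4 m)
    have "psi n \<le> psi (2*(m+1))" using 4 by (intro psi_mono) auto
    also have "\<dots> \<le> 4 * real (m+1) + 2 * real (m+1) * ln 2"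
      using psi_double[of "m+1"] less.IH[of "m+1"] 4 by auto
    also have "2 * real (m+1) * ln 2 \<le> 2 * real (m+1) * 1" using ln2 by (intro mult_left_mono) auto
    finally show ?thesis using 4 by simp
  qed (auto simp: psi_def)
qed

lemma ln_fact_ge: "ln (fact n :: real) \<ge> real n * ln (real n) - real n"
proof (induction n)
  case (Suc n)
  show ?case
  proof (cases "n = 0")
    case False
    have "ln (1 + 1 / real n) \<le> 1 / real n" by (rule ln_add_one_self_le_self) auto
    moreover have "ln (1 + 1 / real n) = ln (real n + 1) - ln (real n)"
      using False by (subst ln_divide_pos[symmetric]) (auto simp: field_simps)
    ultimately have "real n * (ln (real n + 1) - ln (real n)) \<le> real n * (1 / real n)"
      by (intro mult_left_mono) auto
    hence "real n * ln (real n + 1) \<le> real n * ln (real n) + 1" using False by (simp add: algebra_simps)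
    moreover have "ln (fact (Suc n) :: real) = ln (real n + 1) + ln (fact n)"
      by (simp add: ln_mult add.commute)
    ultimately show ?thesis using Suc by (simp add: algebra_simps)
  qed auto
qed auto

lemma ln_fact_le: "ln (fact n :: real) \<le> real n * ln (real n)"
proof (cases "n = 0")
  case False
  have "(fact n :: real) \<le> real n ^ n" using fact_le_power[where 'a=real, of n] by simp
  hence "ln (fact n :: real) \<le> ln (real n ^ n)" using False by (subst ln_le_cancel_iff) auto
  thus ?thesis using False by (simp add: ln_realpow)
qed auto

text \<open>\<open>ln (fact n)\<close> is the sum of \<open>vM d * real (n div d)\<close>. Removing
  the floor changes it by at most \<open>psi n\<close>, hence by at most 4 n, and with the two
  factorial bounds division by \<open>n\<close> leaves an error between -1 and 4.\<close>

lemma mertens: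
  assumes "n > 0"
  shows "\<bar>(\<Sum>d=1..n. vM d / real d) - ln (real n)\<bar> \<le> 4"
proof -
  define T where "T = (\<Sum>d=1..n. vM d / real d)"
  have nT: "real n * T = (\<Sum>d=1..n. vM d * (real n / real d))"
    unfolding T_def by (simp add: sum_distrib_left mult_ac)
  have "ln (fact n) \<le> real n * T"
    unfolding nT ln_fact_mangoldt
    by (intro sum_mono mult_left_mono mangoldt_nonneg of_nat_div_le_of_nat)
  hence "real n * (ln (real n) - 1) \<le> real n * T" using ln_fact_ge[of n] by (simp add: algebra_simps)
  hence 1: "ln (real n) - 1 \<le> T" using assms by simp
  have "real n * T - psi n = (\<Sum>d=1..n. vM d * (real n / real d - 1))"
    unfolding nT psi_def by (simp add: sum_subtractf algebra_simps)
  also have "\<dots> \<le> ln (fact n)" unfolding ln_fact_mangoldt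
  proof (intro sum_mono mult_left_mono mangoldt_nonneg)
    fix d assume d: "d \<in> {1..n}"
    hence "n < d * (n div d + 1)" using dividend_less_times_div[of d n] by simp
    hence "real n \<le> real d * (real (n div d) + 1)"
      by (metis of_nat_1 of_nat_add of_nat_less_iff of_nat_mult less_imp_le)
    thus "real n / real d - 1 \<le> real (n div d)" using d by (simp add: field_simps)
  qed
  finally have "real n * T \<le> real n * (ln (real n) + 4)"
    using psi_le[of n] ln_fact_le[of n] by (simp add: algebra_simps)
  hence "T \<le> ln (real n) + 4" using assms by simp
  with 1 show ?thesis unfolding T_def by linarith
qed

text \<open>Dyadic induction: by \<open>psi_le\<close> the upper half contributes at most 6 sqrt n,
  and the lower half at most 21 * 5/7 = 15 times sqrt n. The constant 21 is the fixed point of this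
  recursion.\<close>

lemma mangoldt_sum_sqrt: "(\<Sum>d=1..n. vM d / sqrt (real d)) \<le> 21 * sqrt (real n)"
proof (induction n rule: less_induct)
  case (less n)
  show ?case
  proof (cases "n = 0")
    case False
    define m where "m = n div 2"
    have m: "m < n" "real m \<le> real n / 2" "real n / 2 \<le> real (m+1)" using False unfolding m_def by linarith+
    have "{1..n} = {1..m} \<union> {m+1..n}" using m by auto
    hence "(\<Sum>d=1..n. vM d / sqrt (real d)) = (\<Sum>d=1..m. vM d / sqrt (real d)) + (\<Sum>d=m+1..n. vM d / sqrt (real d))"
      by (simp add: sum.union_disjoint)
    also have "(\<Sum>d=1..m. vM d / sqrt (real d)) \<le> 21 * sqrt (real m)" using less m by blast
    also have "sqrt (real m) \<le> sqrt (real n / 2)" using m by simp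
    also have "sqrt (real n / 2) \<le> 5/7 * sqrt (real n)"
      by (rule real_le_lsqrt) (auto simp: power_mult_distrib power_divide)
    also have "(\<Sum>d=m+1..n. vM d / sqrt (real d)) \<le> (\<Sum>d=m+1..n. vM d / sqrt (real n / 2))"
      using m False by (intro sum_mono divide_left_mono mangoldt_nonneg) auto
    also have "\<dots> \<le> psi n / sqrt (real n / 2)"
      unfolding sum_divide_distrib[symmetric] psi_def
      by (intro divide_right_mono sum_mono2) (auto simp: mangoldt_nonneg)
    also have "\<dots> \<le> 4 * real n / sqrt (real n / 2)" by (intro divide_right_mono psi_le) auto
    also have "\<dots> \<le> 6 * sqrt (real n)"
    proof -
      have "4 \<le> 6 * (1 / sqrt 2)" proof -
        have "sqrt 2 \<le> 3/2" by (rule real_le_lsqrt) (auto simp: power2_eq_square)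
        thus ?thesis by (simp add: field_simps)
      qed
      hence "4 * real n \<le> 6 * (1 / sqrt 2) * real n" by (intro mult_right_mono) auto
      also have "\<dots> = 6 * sqrt (real n) * sqrt (real n / 2)"
        by (simp add: real_sqrt_divide)
      finally show ?thesis using False by (simp add: field_simps)
    qed
    finally show ?thesis by (simp add: algebra_simps)
  qed auto
qed

text \<open>The subtracted \<open>32 / real n\<close> closes the halving induction: the lower half
  yields at most 32 - 64/n and the upper half at most 16/n.\<close>

lemma mangoldt_sum_sq: "n > 0 \<Longrightarrow> (\<Sum>d=1..n. vM d / real d ^ 2) \<le> 32 - 32 / real n"
proof (induction n rule: less_induct)
  case (less n)
  show ?case
  proof (cases "n = 1")
    case False
    define m where "m = n div 2"
    have m: "m < n" "m > 0" "real m \<le> real n / 2" "real n / 2 \<le> real (m+1)"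
      using False less.prems unfolding m_def by linarith+
    have "{1..n} = {1..m} \<union> {m+1..n}" using m by auto
    hence "(\<Sum>d=1..n. vM d / real d ^ 2) = (\<Sum>d=1..m. vM d / real d ^ 2) + (\<Sum>d=m+1..n. vM d / real d ^ 2)"
      by (simp add: sum.union_disjoint)
    also have "(\<Sum>d=1..m. vM d / real d ^ 2) \<le> 32 - 32 / real m" using less m by blast
    also have "32 - 32 / real m \<le> 32 - 32 / (real n / 2)" using m by (intro diff_left_mono divide_left_mono) auto
    also have "(\<Sum>d=m+1..n. vM d / real d ^ 2) \<le> (\<Sum>d=m+1..n. vM d / (real n / 2)^2)"
    proof (intro sum_mono divide_left_mono mangoldt_nonneg power_mono)
      fix d assume d: "d \<in> {m+1..n}"
      have "real (m+1) \<le> real d" using d by (subst of_nat_le_iff) auto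
      thus "real n / 2 \<le> real d" using m by linarith
      show "0 < real d ^ 2 * (real n / 2)^2" using m d by auto
    qed auto
    also have "\<dots> \<le> psi n / (real n / 2)^2"
      unfolding sum_divide_distrib[symmetric] psi_def
      by (intro divide_right_mono sum_mono2) (auto simp: mangoldt_nonneg)
    also have "\<dots> \<le> 4 * real n / (real n / 2)^2" by (intro divide_right_mono psi_le) auto
    also have "\<dots> = 16 / real n" using m by (simp add: field_simps power2_eq_square)
    finally have "(\<Sum>d=1..n. vM d / real d ^ 2) \<le> 32 - 32 / (real n / 2) + 16 / real n" by simp
    also have "\<dots> \<le> 32 - 32 / real n" using m by (simp add: field_simps)
    finally show ?thesis .
  qed auto
qed

subsection \<open>Mertens estimates in the residue class 1 modulo 8\<close>

text \<open>Summation by parts. Monotonicity and sign are asked for only beyond \<open>y\<close>,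
  because the weights ln k / k used below start to decrease at 3. The partial sums of
  \<open>a\<close> start at 1, so a boundary term at \<open>y\<close> appears as well, which
  accounts for the factor 2.\<close>

lemma abel_bound:
  fixes a b :: "nat \<Rightarrow> real"
  assumes A: "\<And>n. \<bar>\<Sum>k=1..n. a k\<bar> \<le> M"
    and dec: "\<And>k. k > y \<Longrightarrow> b (Suc k) \<le> b k" and nn: "\<And>k. k > y \<Longrightarrow> b k \<ge> 0"
    and "y \<le> z"
  shows "\<bar>\<Sum>k=y+1..z. a k * b k\<bar> \<le> 2 * M * b (y+1)"
proof (cases "y = z")
  case True
  have "M \<ge> 0" using A[of 0] by simp
  thus ?thesis using True nn[of "y+1"] by simp
next
  case False
  define S where "S n = (\<Sum>k=1..n. a k)" for n
  have Sb: "\<bar>S n\<bar> \<le> M" for n unfolding S_def by (rule A)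
  have "y + 1 \<le> z" using False assms(4) by simp
  \<comment> \<open>Peeling off both boundary terms leaves the sum of
    \<open>S n * (b n - b (Suc n))\<close>, whose bound telescopes.\<close>
  hence "\<bar>(\<Sum>k=y+1..z. a k * b k) - S z * b z + S y * b (y+1)\<bar> \<le> M * (b (y+1) - b z)"
  proof (induction z rule: dec_induct)
    case base
    have "S (y+1) = S y + a (y+1)" unfolding S_def by simp
    hence "a (y+1) * b (y+1) - S (y+1) * b (y+1) + S y * b (y+1) = 0" by (simp add: algebra_simps)
    thus ?case by simp
  next
    case (step n)
    have S: "S (Suc n) = S n + a (Suc n)" unfolding S_def by simp
    have "(\<Sum>k=y+1..Suc n. a k * b k) - S (Suc n) * b (Suc n) + S y * b (y+1)
      = ((\<Sum>k=y+1..n. a k * b k) - S n * b n + S y * b (y+1)) + S n * (b n - b (Suc n))"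
      using step(1) unfolding S by (simp add: algebra_simps)
    also have "\<bar>\<dots>\<bar> \<le> M * (b (y+1) - b n) + M * (b n - b (Suc n))"
    proof (rule order.trans[OF abs_triangle_ineq add_mono[OF step.IH]])
      have "b n - b (Suc n) \<ge> 0" using dec[of n] step by simp
      thus "\<bar>S n * (b n - b (Suc n))\<bar> \<le> M * (b n - b (Suc n))"
        using Sb[of n] by (simp add: abs_mult mult_right_mono)
    qed
    finally show ?case by (simp add: algebra_simps)
  qed
  moreover have "\<bar>S z * b z\<bar> \<le> M * b z" "\<bar>S y * b (y+1)\<bar> \<le> M * b (y+1)"
    using Sb nn[of z] nn[of "y+1"] False assms(4) by (auto simp: abs_mult intro!: mult_right_mono)
  moreover have "M * (b (y+1) - b z) = M * b (y+1) - M * b z" by (rule right_diff_distrib)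
  ultimately show ?thesis by linarith
qed

text \<open>The start 3 is the first integer above e: from there on ln k is at least 1, while k
  times the increment of ln is at most 1.\<close>

lemma ln_over_decreasing:
  assumes "k \<ge> 3"
  shows "ln (real (Suc k)) / real (Suc k) \<le> ln (real k) / real k"
proof -
  have "ln (1 + 1 / real k) \<le> 1 / real k" by (rule ln_add_one_self_le_self) auto
  moreover have "ln (1 + 1 / real k) = ln (real k + 1) - ln (real k)"
    using assms by (subst ln_divide_pos[symmetric]) (auto simp: field_simps)
  ultimately have 1: "ln (real k + 1) \<le> ln (real k) + 1 / real k" by simp
  have "exp 1 \<le> real k" using exp_le assms by linarith
  hence "1 \<le> ln (real k)" using assms by (subst ln_ge_iff) auto
  have "real k * ln (real k + 1) \<le> real k * (ln (real k) + 1 / real k)"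
    using 1 by (intro mult_left_mono) auto
  also have "\<dots> \<le> real k * ln (real k) + ln (real k)"
    using assms \<open>1 \<le> ln (real k)\<close> by (simp add: algebra_simps)
  finally show ?thesis using assms by (simp add: field_simps)
qed

text \<open>The argument behind Dirichlet's theorem: a lower bound on the partial sums of \<open>L(1,\<chi>)\<close>
  makes the Mertens sum twisted by \<open>\<chi>\<close> bounded.\<close>

lemma twisted_mertens:
  fixes chi :: "nat \<Rightarrow> real"
  assumes mult: "\<And>a b. chi (a * b) = chi a * chi b"
    and le1: "\<And>n. \<bar>chi n\<bar> \<le> 1"
    and per: "\<And>n. \<bar>\<Sum>k=1..n. chi k\<bar> \<le> 2"
    and pos: "c > 0" "\<And>n. n > 0 \<Longrightarrow> (\<Sum>m=1..n. chi m / real m) \<ge> c"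
  shows "\<exists>K. \<forall>n. \<bar>\<Sum>d=1..n. chi d * vM d / real d\<bar> \<le> K"
proof -
  define h where "h n = (\<Sum>m=1..n. chi m / real m)" for n
  define T where "T n = (\<Sum>d=1..n. chi d * vM d / real d)" for n
  have hdiff: "\<bar>h z - h y\<bar> \<le> 4 / real (y+1)" if "y \<le> z" for y z
  proof -
    have "{1..z} = {1..y} \<union> {y+1..z}" using that by auto
    hence "h z - h y = (\<Sum>k=y+1..z. chi k * (1 / real k))"
      unfolding h_def by (simp add: sum.union_disjoint)
    also have "\<bar>\<dots>\<bar> \<le> 2 * 2 * (1 / real (y+1))"
      by (rule abel_bound[OF per]) (use that in \<open>auto simp: frac_le\<close>)
    finally show ?thesis by simp
  qed
  \<comment> \<open>\<open>ln\<close> is the divisor sum of \<open>vM\<close>, and complete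
    multiplicativity of \<open>chi\<close> splits each term into a factor in \<open>d\<close> and a
    factor in \<open>n div d\<close>.\<close>
  have logsum: "(\<Sum>n=1..x. chi n * ln (real n) / real n)
      = (\<Sum>d=1..x. chi d * vM d / real d * h (x div d))" for x
  proof -
    have "(\<Sum>n=1..x. chi n * ln (real n) / real n)
      = (\<Sum>n=1..x. \<Sum>d | d dvd n. (chi d * vM d / real d) * (chi (n div d) / real (n div d)))"
    proof (rule sum.cong[OF refl])
      fix n assume n: "n \<in> {1..x}"
      have "chi n * ln (real n) / real n = (\<Sum>d | d dvd n. chi n * vM d / real n)"
        using n mangoldt_sum[of n, where 'a=real]
        by (simp add: sum_distrib_left[symmetric] sum_divide_distrib[symmetric])
      also have "\<dots> = (\<Sum>d | d dvd n. (chi d * vM d / real d) * (chi (n div d) / real (n div d)))"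
      proof (rule sum.cong[OF refl])
        fix d assume "d \<in> {d. d dvd n}"
        then obtain m where m: "n = d * m" by auto
        with n have "d > 0" "m > 0" by auto
        thus "chi n * vM d / real n = (chi d * vM d / real d) * (chi (n div d) / real (n div d))"
          by (simp add: m mult)
      qed
      finally show "chi n * ln (real n) / real n = \<dots>" .
    qed
    also have "\<dots> = (\<Sum>d=1..x. \<Sum>m=1..x div d. (chi d * vM d / real d) * (chi m / real m))"
      by (rule sum_divisors_swap)
    finally show ?thesis unfolding h_def by (simp add: sum_distrib_left)
  qed
  \<comment> \<open>The first two terms are set apart since ln k / k decreases only from 3 on; the
    rest falls under Abel summation.\<close>
  define L where "L = \<bar>\<Sum>n=1..2. chi n * ln (real n) / real n\<bar> + 4 * (ln 3 / 3)"
  have Lb: "\<bar>\<Sum>n=1..x. chi n * ln (real n) / real n\<bar> \<le> L" for x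
  proof (cases "x \<ge> 2")
    case True
    hence "{1..x} = {1..2} \<union> {2+1..x}" by auto
    hence "(\<Sum>n=1..x. chi n * ln (real n) / real n) = (\<Sum>n=1..2. chi n * ln (real n) / real n)
       + (\<Sum>n=2+1..x. chi n * (ln (real n) / real n))"
      by (simp add: sum.union_disjoint)
    moreover have "\<bar>\<Sum>n=2+1..x. chi n * (ln (real n) / real n)\<bar> \<le> 2 * 2 * (ln (real (2+1)) / real (2+1))"
      by (rule abel_bound[OF per]) (use True ln_over_decreasing in auto)
    ultimately show ?thesis unfolding L_def by simp
  next
    case False
    hence "x = 0 \<or> x = 1" by auto
    moreover have "L \<ge> 0" unfolding L_def by simp
    ultimately show ?thesis by auto
  qed
  \<comment> \<open>Replacing \<open>h (x div d)\<close> by \<open>h x\<close> costs at most 4 d / x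
    for each \<open>d\<close>, in total at most 4 \<open>psi x\<close> / x, hence 16. So
    \<open>T\<close> is bounded after multiplication by \<open>h\<close>, and \<open>pos\<close>
    keeps \<open>h\<close> away from 0.\<close>
  have main: "\<bar>h x * T x\<bar> \<le> L + 16" if "x > 0" for x
  proof -
    have e: "h x * T x - (\<Sum>n=1..x. chi n * ln (real n) / real n)
      = (\<Sum>d=1..x. chi d * vM d / real d * (h x - h (x div d)))"
    proof -
      have "h x * T x = (\<Sum>d=1..x. chi d * vM d / real d * h x)"
        unfolding T_def sum_distrib_right[symmetric] by (rule mult.commute)
      thus ?thesis unfolding logsum right_diff_distrib sum_subtractf by (rule arg_cong)
    qed
    have "\<bar>\<Sum>d=1..x. chi d * vM d / real d * (h x - h (x div d))\<bar> \<le> (\<Sum>d=1..x. vM d * (4 / real x))"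
    proof (rule order.trans[OF sum_abs sum_mono])
      fix d assume d: "d \<in> {1..x}"
      have "x < d * (x div d + 1)" using dividend_less_times_div[of d x] d by simp
      hence dx: "real x \<le> real d * (real (x div d) + 1)"
        by (metis of_nat_1 of_nat_add of_nat_less_iff of_nat_mult less_imp_le)
      have "\<bar>h x - h (x div d)\<bar> \<le> 4 / real (x div d + 1)" by (rule hdiff) simp
      also have "\<dots> \<le> 4 * real d / real x" using dx that by (simp add: field_simps)
      finally have "vM d / real d * \<bar>h x - h (x div d)\<bar> \<le> vM d / real d * (4 * real d / real x)"
        by (intro mult_left_mono) (auto simp: mangoldt_nonneg)
      moreover have "\<bar>chi d * vM d / real d * (h x - h (x div d))\<bar>
          \<le> 1 * (vM d / real d * \<bar>h x - h (x div d)\<bar>)"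
      proof -
        have "\<bar>chi d * vM d / real d * (h x - h (x div d))\<bar>
            = \<bar>chi d\<bar> * (vM d / real d * \<bar>h x - h (x div d)\<bar>)" by (simp add: abs_mult)
        also have "\<dots> \<le> 1 * (vM d / real d * \<bar>h x - h (x div d)\<bar>)"
          by (rule mult_right_mono[OF le1]) (auto simp: mangoldt_nonneg)
        finally show ?thesis .
      qed
      moreover have "vM d / real d * (4 * real d / real x) = vM d * (4 / real x)" using d by simp
      ultimately show "\<bar>chi d * vM d / real d * (h x - h (x div d))\<bar> \<le> vM d * (4 / real x)"
        by linarith
    qed
    also have "\<dots> = psi x * (4 / real x)" unfolding psi_def by (rule sum_distrib_right[symmetric])
    also have "\<dots> \<le> 4 * real x * (4 / real x)" by (intro mult_right_mono psi_le) auto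
    also have "\<dots> = 16" using that by simp
    finally show ?thesis using Lb[of x] e by linarith
  qed
  have "\<bar>T x\<bar> \<le> (L + 16) / c" for x
  proof (cases "x > 0")
    case True
    have "c * \<bar>T x\<bar> \<le> h x * \<bar>T x\<bar>" using pos(2)[OF True] unfolding h_def by (intro mult_right_mono) auto
    also have "\<dots> \<le> \<bar>h x * T x\<bar>" by (simp add: abs_mult mult_right_mono)
    also have "\<dots> \<le> L + 16" by (rule main[OF True])
    finally show ?thesis using pos(1) by (simp add: field_simps)
  next
    case False
    have "L \<ge> 0" unfolding L_def by simp
    thus ?thesis using False pos(1) unfolding T_def by simp
  qed
  thus ?thesis unfolding T_def by blast
qed

section \<open>The three non-principal characters modulo 8\<close>

text \<open>\<open>chi4\<close>, \<open>chi8\<close> and \<open>chi8'\<close> are the Kronecker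
  characters of Q(i), Q(sqrt 2) and Q(sqrt(-2)). With the principal character they exhaust the
  characters modulo 8; all are real, so no complex L-values enter.\<close>

definition chi4 :: "nat \<Rightarrow> real" where
  "chi4 n = (if n mod 8 \<in> {1,5} then 1 else if n mod 8 \<in> {3,7} then -1 else 0)"
definition chi8 :: "nat \<Rightarrow> real" where
  "chi8 n = (if n mod 8 \<in> {1,7} then 1 else if n mod 8 \<in> {3,5} then -1 else 0)"
definition chi8' :: "nat \<Rightarrow> real" where
  "chi8' n = (if n mod 8 \<in> {1,3} then 1 else if n mod 8 \<in> {5,7} then -1 else 0)"

lemma less_8_cases:
  "(n::nat) < 8 \<Longrightarrow> n = 0 \<or> n = 1 \<or> n = 2 \<or> n = 3 \<or> n = 4 \<or> n = 5 \<or> n = 6 \<or> n = 7"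
  by (auto simp: eval_nat_numeral less_Suc_eq)

lemma mod8_cases:
  "(n::nat) mod 8 = 0 \<or> n mod 8 = 1 \<or> n mod 8 = 2 \<or> n mod 8 = 3 \<or>
   n mod 8 = 4 \<or> n mod 8 = 5 \<or> n mod 8 = 6 \<or> n mod 8 = 7"
  by (rule less_8_cases) simp

lemma chi_mod: "chi4 n = chi4 (n mod 8)" "chi8 n = chi8 (n mod 8)" "chi8' n = chi8' (n mod 8)"
  unfolding chi4_def chi8_def chi8'_def mod_mod_trivial by (rule refl)+

lemma chi_values:
  "chi4 0 = 0" "chi4 1 = 1" "chi4 2 = 0" "chi4 3 = -1" "chi4 4 = 0" "chi4 5 = 1" "chi4 6 = 0" "chi4 7 = -1"
  "chi8 0 = 0" "chi8 1 = 1" "chi8 2 = 0" "chi8 3 = -1" "chi8 4 = 0" "chi8 5 = -1" "chi8 6 = 0" "chi8 7 = 1"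
  "chi8' 0 = 0" "chi8' 1 = 1" "chi8' 2 = 0" "chi8' 3 = 1" "chi8' 4 = 0" "chi8' 5 = -1" "chi8' 6 = 0" "chi8' 7 = -1"
  "chi4 8 = 0" "chi8 8 = 0" "chi8' 8 = 0"
  by (simp_all add: chi4_def chi8_def chi8'_def)

lemma chi_mult_less_8:
  assumes "i < 8" "j < 8"
  shows "chi4 (i * j mod 8) = chi4 i * chi4 j" "chi8 (i * j mod 8) = chi8 i * chi8 j"
    "chi8' (i * j mod 8) = chi8' i * chi8' j"
proof -
  have "chi4 (i * j mod 8) = chi4 i * chi4 j \<and> chi8 (i * j mod 8) = chi8 i * chi8 j
    \<and> chi8' (i * j mod 8) = chi8' i * chi8' j"
    using less_8_cases[OF assms(1)] less_8_cases[OF assms(2)]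
    by (elim disjE; simp only: mult_zero_left mult_zero_right mult_1_left mult_1_right; simp add: chi_values chi_values[unfolded One_nat_def])
  thus "chi4 (i * j mod 8) = chi4 i * chi4 j" "chi8 (i * j mod 8) = chi8 i * chi8 j"
    "chi8' (i * j mod 8) = chi8' i * chi8' j" by blast+
qed

lemma chi_mult:
  "chi4 (a * b) = chi4 a * chi4 b" "chi8 (a * b) = chi8 a * chi8 b" "chi8' (a * b) = chi8' a * chi8' b"
proof -
  have m: "a * b mod 8 = (a mod 8) * (b mod 8) mod 8" by (rule mod_mult_eq[symmetric])
  have l: "a mod 8 < 8" "b mod 8 < 8" by simp_all
  show "chi4 (a * b) = chi4 a * chi4 b" "chi8 (a * b) = chi8 a * chi8 b" "chi8' (a * b) = chi8' a * chi8' b"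
    unfolding chi_mod[of "a*b"] chi_mod[of a] chi_mod[of b] m by (rule chi_mult_less_8[OF l])+
qed

lemma sum_upto_8:
  "(\<Sum>m=1..0. f m) = 0" "(\<Sum>m=1..1. f m) = f 1" "(\<Sum>m=1..2. f m) = f 1 + f 2" "(\<Sum>m=1..3. f m) = f 1 + f 2 + f 3"
  "(\<Sum>m=1..4. f m) = f 1 + f 2 + f 3 + f 4" "(\<Sum>m=1..5. f m) = f 1 + f 2 + f 3 + f 4 + f 5"
  "(\<Sum>m=1..6. f m) = f 1 + f 2 + f 3 + f 4 + f 5 + f 6"
  "(\<Sum>m=1..7. f m) = f 1 + f 2 + f 3 + f 4 + f 5 + f 6 + f 7"
  "(\<Sum>m=1..8. f m) = f 1 + f 2 + f 3 + f 4 + f 5 + f 6 + f 7 + f 8" for f :: "nat \<Rightarrow> real"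
  by (simp_all add: eval_nat_numeral)

lemma chi_abs: "\<bar>chi4 n\<bar> \<le> 1" "\<bar>chi8 n\<bar> \<le> 1" "\<bar>chi8' n\<bar> \<le> 1"
proof -
  have "\<bar>if P then 1 else if Q then -1 else 0\<bar> \<le> (1::real)" for P Q by simp
  thus "\<bar>chi4 n\<bar> \<le> 1" "\<bar>chi8 n\<bar> \<le> 1" "\<bar>chi8' n\<bar> \<le> 1"
    unfolding chi4_def chi8_def chi8'_def by blast+
qed

lemma sum_mod8:
  fixes f :: "nat \<Rightarrow> real"
  assumes per: "\<And>n. f (n + 8) = f n" and z: "(\<Sum>k=1..8. f k) = 0"
  shows "(\<Sum>k=1..n. f k) = (\<Sum>k=1..n mod 8. f k)"
proof (induction n rule: less_induct)
  case (less n)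
  show ?case
  proof (cases "n < 8")
    case False
    define m where "m = n - 8"
    have n: "n = m + 8" using False m_def by simp
    have "(\<Sum>k=1..m+8. f k) = (\<Sum>k=1..8. f k) + (\<Sum>k=8+1..8+m. f k)"
      by (subst add.commute[of m], rule sum.ub_add_nat) simp
    also have "(\<Sum>k=8+1..8+m. f k) = (\<Sum>k=1..m. f k)"
      using sum.shift_bounds_cl_nat_ivl[of f 1 8 m] by (simp add: per add.commute)
    finally show ?thesis using z n less.IH[of m] by simp
  qed simp
qed

lemma chi_sum: "\<bar>\<Sum>k=1..n. chi4 k\<bar> \<le> 1" "\<bar>\<Sum>k=1..n. chi8 k\<bar> \<le> 1" "\<bar>\<Sum>k=1..n. chi8' k\<bar> \<le> 2"
proof -
  have e: "chi4 (n+8) = chi4 n" "chi8 (n+8) = chi8 n" "chi8' (n+8) = chi8' n" for n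
    unfolding chi4_def chi8_def chi8'_def mod_add_self2 by (rule refl)+
  have s: "(\<Sum>k=1..8. chi4 k) = 0" "(\<Sum>k=1..8. chi8 k) = 0" "(\<Sum>k=1..8. chi8' k) = 0"
    unfolding sum_upto_8 chi_values by simp_all
  show "\<bar>\<Sum>k=1..n. chi4 k\<bar> \<le> 1"
    using mod8_cases[of n] unfolding sum_mod8[OF e(1) s(1), of n]
    by (elim disjE; simp only: sum_upto_8 chi_values; simp)
  show "\<bar>\<Sum>k=1..n. chi8 k\<bar> \<le> 1"
    using mod8_cases[of n] unfolding sum_mod8[OF e(2) s(2), of n]
    by (elim disjE; simp only: sum_upto_8 chi_values; simp)
  show "\<bar>\<Sum>k=1..n. chi8' k\<bar> \<le> 2"
    using mod8_cases[of n] unfolding sum_mod8[OF e(3) s(3), of n]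
    by (elim disjE; simp only: sum_upto_8 chi_values; simp)
qed

text \<open>Beyond \<open>y\<close> the partial sums move by at most \<open>2 * M / (y+1)\<close>,
  so a margin of that size at \<open>y\<close> together with a finite check below \<open>y\<close>
  settles all \<open>n\<close>.\<close>

lemma chi_L_pos_aux:
  assumes per: "\<And>n. \<bar>\<Sum>k=1..n. chi k\<bar> \<le> M" and y: "(\<Sum>m=1..y. chi m / real m) \<ge> c + 2 * M / real (y+1)"
    and small: "\<And>n. 0 < n \<Longrightarrow> n < y \<Longrightarrow> (\<Sum>m=1..n. chi m / real m) \<ge> c"
    and n: "n > 0"
  shows "(\<Sum>m=1..n. chi m / real m) \<ge> (c::real)"
proof (cases "n < y")
  case False
  hence "{1..n} = {1..y} \<union> {y+1..n}" by auto
  hence "(\<Sum>m=1..n. chi m / real m) = (\<Sum>m=1..y. chi m / real m) + (\<Sum>k=y+1..n. chi k * (1 / real k))"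
    by (simp add: sum.union_disjoint)
  moreover have "\<bar>\<Sum>k=y+1..n. chi k * (1 / real k)\<bar> \<le> 2 * M * (1 / real (y+1))"
    by (rule abel_bound[OF per]) (use False in \<open>auto simp: frac_le\<close>)
  ultimately show ?thesis using y by simp
next
  case True
  show ?thesis by (rule small[OF n True])
qed

text \<open>Non-vanishing at 1 of the three L-functions by plain arithmetic: the partial sums up to
  8 exceed 1/10 with room for the tail. The room for \<open>chi8'\<close> is twice as large because
  its character sums reach 2.\<close>

lemma chi_L_pos:
  assumes "n > 0"
  shows "(\<Sum>m=1..n. chi4 m / real m) \<ge> 1/10" "(\<Sum>m=1..n. chi8 m / real m) \<ge> 1/10"
    "(\<Sum>m=1..n. chi8' m / real m) \<ge> 1/10"
proof -
  have "(\<Sum>m=1..8. chi4 m / real m) \<ge> 1/10 + 2 * 1 / real (8+1)"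
    "(\<Sum>m=1..8. chi8 m / real m) \<ge> 1/10 + 2 * 1 / real (8+1)"
    "(\<Sum>m=1..8. chi8' m / real m) \<ge> 1/10 + 2 * 2 / real (8+1)"
    unfolding sum_upto_8 chi_values by simp_all
  moreover have "(\<Sum>m=1..n. chi4 m / real m) \<ge> 1/10" "(\<Sum>m=1..n. chi8 m / real m) \<ge> 1/10"
    "(\<Sum>m=1..n. chi8' m / real m) \<ge> 1/10" if n: "0 < n" "n < 8" for n
    using less_8_cases[OF n(2)] n(1) by (elim disjE; simp only: sum_upto_8 chi_values; simp)+
  ultimately show "(\<Sum>m=1..n. chi4 m / real m) \<ge> 1/10" "(\<Sum>m=1..n. chi8 m / real m) \<ge> 1/10"
    "(\<Sum>m=1..n. chi8' m / real m) \<ge> 1/10"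
    using chi_L_pos_aux[of chi4 1 "1/10" 8 n, OF chi_sum(1)] chi_L_pos_aux[of chi8 1 "1/10" 8 n, OF chi_sum(2)]
      chi_L_pos_aux[of chi8' 2 "1/10" 8 n, OF chi_sum(3)] assms by blast+
qed

lemma mangoldt_even_nonzero: "vM d \<noteq> 0 \<Longrightarrow> even d \<Longrightarrow> \<exists>k>0. d = 2 ^ k"
proof -
  assume "vM d \<noteq> 0" "even d"
  hence "primepow d" by (auto simp: mangoldt_def split: if_splits)
  then obtain p k where pk: "prime p" "k > 0" "d = p ^ k" by (auto simp: primepow_def)
  have "p = 2" using \<open>even d\<close> pk by (metis even_power prime_nat_iff primes_dvd_imp_eq two_is_prime_nat)
  thus ?thesis using pk by blast
qed

text \<open>Passing from all \<open>d\<close> to odd \<open>d\<close>, that is to the principal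
  character modulo 8, removes only powers of 2, and ln 2 times (1/2 + 1/4 + ...) is at most
  1.\<close>

lemma mangoldt_even_sum: "(\<Sum>d\<in>{d\<in>{1..n}. even d}. vM d / real d) \<le> 1"
proof -
  have "(\<Sum>d\<in>{d\<in>{1..n}. even d}. vM d / real d) = (\<Sum>d\<in>{d\<in>{1..n}. even d \<and> vM d \<noteq> 0}. vM d / real d)"
    by (rule sum.mono_neutral_right) auto
  also have "\<dots> \<le> (\<Sum>d\<in>(\<lambda>k. 2^k) ` {1..n}. vM d / real d)"
  proof (rule sum_mono2)
    show "{d\<in>{1..n}. even d \<and> vM d \<noteq> 0} \<subseteq> (\<lambda>k. 2^k) ` {1..n}"
    proof
      fix d assume d: "d \<in> {d\<in>{1..n}. even d \<and> vM d \<noteq> 0}"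
      then obtain k where k: "k > 0" "d = 2^k" using mangoldt_even_nonzero by blast
      have "k < (2::nat)^k" by (rule less_exp)
      moreover have "d \<le> n" using d by simp
        ultimately have "k \<le> n" unfolding k(2) by linarith
        hence "k \<in> {1..n}" using k(1) by simp
        thus "d \<in> (\<lambda>k. 2^k) ` {1..n}" using k(2) by (rule image_eqI[rotated])
    qed
  qed (auto simp: mangoldt_nonneg)
  also have "\<dots> = (\<Sum>k=1..n. ln 2 * (1/2)^k)"
    by (subst sum.reindex) (auto simp: inj_on_def power_divide)
  also have "\<dots> \<le> (\<Sum>k=1..n. (1/2)^k)"
    using ln_2_less_1 by (intro sum_mono) (auto intro!: mult_left_le_one_le)
  also have "\<dots> = 1 - (1/2)^n" by (induction n) (auto simp: field_simps)
  finally show ?thesis by (rule order.trans) simp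
qed

text \<open>Orthogonality: the four characters add up to 4 on the class 1 modulo 8 and to 0
  elsewhere, and only the principal one contributes a logarithm. The factor 4 is kept because each
  such modulus will occur with up to four roots.\<close>

lemma mertens_one_mod_8:
  "\<exists>K. \<forall>n>0. \<bar>(\<Sum>d\<in>{d\<in>{1..n}. d mod 8 = 1}. 4 * vM d / real d) - ln (real n)\<bar> \<le> K"
proof -
  obtain K1 where K1: "\<And>n. \<bar>\<Sum>d=1..n. chi4 d * vM d / real d\<bar> \<le> K1"
    using twisted_mertens[of chi4, OF chi_mult(1) chi_abs(1) order.trans[OF chi_sum(1)] _ chi_L_pos(1)] by auto
  obtain K2 where K2: "\<And>n. \<bar>\<Sum>d=1..n. chi8 d * vM d / real d\<bar> \<le> K2"
    using twisted_mertens[of chi8, OF chi_mult(2) chi_abs(2) order.trans[OF chi_sum(2)] _ chi_L_pos(2)] by auto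
  obtain K3 where K3: "\<And>n. \<bar>\<Sum>d=1..n. chi8' d * vM d / real d\<bar> \<le> K3"
    using twisted_mertens[of chi8', OF chi_mult(3) chi_abs(3) chi_sum(3) _ chi_L_pos(3)] by auto
  have "\<bar>(\<Sum>d\<in>{d\<in>{1..n}. d mod 8 = 1}. 4 * vM d / real d) - ln (real n)\<bar> \<le> 5 + K1 + K2 + K3"
    if "n > 0" for n
  proof -
    have "(\<Sum>d\<in>{d\<in>{1..n}. d mod 8 = 1}. 4 * vM d / real d)
       = (\<Sum>d=1..n. if d mod 8 = 1 then 4 * vM d / real d else 0)"
      by (rule sum.inter_filter) simp
    also have "\<dots> = (\<Sum>d=1..n. vM d / real d - (if even d then vM d / real d else 0)
        + chi4 d * vM d / real d + chi8 d * vM d / real d + chi8' d * vM d / real d)"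
    proof (rule sum.cong[OF refl])
      fix d :: nat
      have ev: "even d \<longleftrightarrow> d mod 8 = 0 \<or> d mod 8 = 2 \<or> d mod 8 = 4 \<or> d mod 8 = 6" by presburger
      show "(if d mod 8 = 1 then 4 * vM d / real d else 0)
        = vM d / real d - (if even d then vM d / real d else 0)
        + chi4 d * vM d / real d + chi8 d * vM d / real d + chi8' d * vM d / real d"
        using mod8_cases[of d] unfolding ev chi_mod[of d]
        by (elim disjE; simp only: chi_values; simp)
    qed
    also have "\<dots> = (\<Sum>d=1..n. vM d / real d) - (\<Sum>d\<in>{d\<in>{1..n}. even d}. vM d / real d)
      + (\<Sum>d=1..n. chi4 d * vM d / real d) + (\<Sum>d=1..n. chi8 d * vM d / real d)
      + (\<Sum>d=1..n. chi8' d * vM d / real d)"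
      unfolding sum.distrib sum_subtractf by (subst sum.inter_filter) simp_all
    finally have e: "(\<Sum>d\<in>{d\<in>{1..n}. d mod 8 = 1}. 4 * vM d / real d) = \<dots>" .
    have "(\<Sum>d\<in>{d\<in>{1..n}. even d}. vM d / real d) \<ge> 0"
      by (intro sum_nonneg) (auto simp: mangoldt_nonneg)
    with e K1[of n] K2[of n] K3[of n] mertens[OF that] mangoldt_even_sum[of n]
    show ?thesis by linarith
  qed
  thus ?thesis by blast
qed

text \<open>A proper prime power \<open>p\<^sup>k\<close> is charged to \<open>s = p\<^bsup>k div 2\<^esup>\<close>, which is hit at most twice.\<close>

lemma nonprime_primepow_sum:
  fixes g :: "nat \<Rightarrow> real"
  assumes nn: "\<And>d. d > 0 \<Longrightarrow> g d \<ge> 0" and dec: "\<And>d e. 0 < d \<Longrightarrow> d \<le> e \<Longrightarrow> g e \<le> g d"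
    and X: "X \<le> Y ^ 2"
  shows "(\<Sum>d\<in>{d\<in>{1..X}. \<not> prime d}. vM d * g d) \<le> 2 * (\<Sum>s=1..Y. vM s * g (s^2))"
proof -
  \<comment> \<open>The parity \<open>i\<close> of the exponent is fixed so that
    \<open>p ^ (2*k+i)\<close> can be recovered from \<open>p ^ k\<close>; this makes
    \<open>r i\<close> injective on \<open>E i\<close>.\<close>
  define E where "E i = {d\<in>{1..X}. \<exists>p k. prime p \<and> k > 0 \<and> d = p ^ (2 * k + i)}" for i :: nat
  define r where "r i d = aprimedivisor d ^ ((multiplicity (aprimedivisor d) d - i) div 2)" for i d :: nat
  have bound: "(\<Sum>d\<in>E i. vM d * g d) \<le> (\<Sum>s=1..Y. vM s * g (s^2))" if i: "i \<le> 1" for i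
  proof -
    have r: "r i (p ^ (2*k+i)) = p ^ k" if "prime p" "k > 0" for p k :: nat
      using that unfolding r_def by (simp add: aprimedivisor_prime_power)
    have "inj_on (r i) (E i)"
    proof (rule inj_onI)
      fix x y assume xy: "x \<in> E i" "y \<in> E i" "r i x = r i y"
      then obtain p k q l where pk: "prime p" "k > 0" "x = p^(2*k+i)" "prime q" "l > 0" "y = q^(2*l+i)"
        unfolding E_def by auto
      hence "p ^ k = q ^ l" using xy r by simp
      hence "p = q \<and> k = l" using pk prime_power_inj''[of p q k l] by simp
      thus "x = y" using pk by simp
    qed
    have "(\<Sum>d\<in>E i. vM d * g d) \<le> (\<Sum>d\<in>E i. vM (r i d) * g ((r i d)^2))"
    proof (rule sum_mono)
      fix d assume "d \<in> E i"
      then obtain p k where pk: "prime p" "k > 0" "d = p^(2*k+i)" unfolding E_def by auto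
      have p0: "p > 0" using pk prime_gt_0_nat by blast
      have "vM d = vM (r i d)" using pk r by simp
      moreover have "g d \<le> g ((r i d)^2)"
      proof (rule dec)
        show "0 < (r i d)^2" using pk r p0 by simp
        have "p ^ (2*k) \<le> p ^ (2*k+i)" using p0 by (intro power_increasing) auto
        thus "(r i d)^2 \<le> d" using pk r by (simp add: power_even_eq)
      qed
      ultimately show "vM d * g d \<le> vM (r i d) * g ((r i d)^2)"
        by (simp add: mult_left_mono mangoldt_nonneg)
    qed
    also have "\<dots> = (\<Sum>s\<in>r i ` E i. vM s * g (s^2))"
      using \<open>inj_on (r i) (E i)\<close> by (simp add: sum.reindex)
    also have "\<dots> \<le> (\<Sum>s=1..Y. vM s * g (s^2))"
    proof (rule sum_mono2)
      show "r i ` E i \<subseteq> {1..Y}"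
      proof
        fix s assume "s \<in> r i ` E i"
        then obtain p k where pk: "prime p" "k > 0" "p^(2*k+i) \<le> X" "s = p ^ k"
          using r unfolding E_def by auto
        have p0: "p > 0" using pk prime_gt_0_nat by blast
        have "p ^ (2*k) \<le> p ^ (2*k+i)" using p0 by (intro power_increasing) auto
        hence "p ^ (2*k) \<le> Y^2" using pk(3) X by linarith
        hence "s^2 \<le> Y^2" unfolding pk(4) by (simp only: power_even_eq)
        hence "s \<le> Y" using power2_nat_le_eq_le by blast
        thus "s \<in> {1..Y}" using pk p0 by simp
      qed
    qed (auto simp: mangoldt_nonneg nn)
    finally show ?thesis .
  qed
  have fin: "finite (E i)" for i unfolding E_def by simp
  have "(\<Sum>d\<in>{d\<in>{1..X}. \<not> prime d}. vM d * g d) = (\<Sum>d\<in>{d\<in>{1..X}. \<not> prime d \<and> vM d \<noteq> 0}. vM d * g d)"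
    by (rule sum.mono_neutral_right) auto
  also have "\<dots> \<le> (\<Sum>d\<in>E 0 \<union> E 1. vM d * g d)"
  proof (rule sum_mono2)
    show "{d\<in>{1..X}. \<not> prime d \<and> vM d \<noteq> 0} \<subseteq> E 0 \<union> E 1"
    proof
      fix d assume d: "d \<in> {d\<in>{1..X}. \<not> prime d \<and> vM d \<noteq> 0}"
      hence "primepow d" by (auto simp: mangoldt_def split: if_splits)
      then obtain p k where pk: "prime p" "k > 0" "d = p ^ k" by (auto simp: primepow_def)
      have "k \<noteq> 1" using d pk by auto
      hence k: "k = 2 * (k div 2) + k mod 2" "k div 2 > 0" using pk(2) by auto
      have "d \<in> {1..X}" using d by blast
      moreover have "d = p ^ (2 * (k div 2) + k mod 2)" unfolding pk(3) by simp
      ultimately have "d \<in> E (k mod 2)" unfolding E_def using pk(1) k(2)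
        by (intro CollectI conjI exI[of _ p] exI[of _ "k div 2"]) simp_all
      moreover have "k mod 2 = 0 \<or> k mod 2 = 1" by auto
      ultimately show "d \<in> E 0 \<union> E 1" by auto
    qed
    show "0 \<le> vM d * g d" if "d \<in> E 0 \<union> E 1 - {d\<in>{1..X}. \<not> prime d \<and> vM d \<noteq> 0}" for d
    proof (intro mult_nonneg_nonneg mangoldt_nonneg nn)
      have "d \<in> {1..X}" using that unfolding E_def by blast
      thus "d > 0" by simp
    qed
  qed (simp add: fin)
  also have "\<dots> \<le> (\<Sum>d\<in>E 0. vM d * g d) + (\<Sum>d\<in>E 1. vM d * g d)"
  proof -
    have "(\<Sum>d\<in>E 0 \<inter> E 1. vM d * g d) \<ge> 0"
    proof (intro sum_nonneg mult_nonneg_nonneg mangoldt_nonneg nn)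
      fix d assume "d \<in> E 0 \<inter> E 1"
      hence "d \<in> {1..X}" unfolding E_def by blast
      thus "d > 0" by simp
    qed
    thus ?thesis using sum.union_inter[OF fin fin, of "\<lambda>d. vM d * g d" 0 1] by linarith
  qed
  also have "\<dots> \<le> 2 * (\<Sum>s=1..Y. vM s * g (s^2))" using bound[of 0] bound[of 1] by simp
  finally show ?thesis .
qed

subsection \<open>Points of a planar lattice in a box\<close>

text \<open>Measured from the minimum in units of \<delta>, distinct points have distinct integer
  parts.\<close>

lemma card_separated:
  fixes A :: "int set"
  assumes fin: "finite A" and D: "\<And>x y. x \<in> A \<Longrightarrow> y \<in> A \<Longrightarrow> \<bar>real_of_int (x - y)\<bar> \<le> D"
    and sep: "\<And>x y. x \<in> A \<Longrightarrow> y \<in> A \<Longrightarrow> x \<noteq> y \<Longrightarrow> real_of_int \<bar>x - y\<bar> \<ge> \<delta>"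
    and "\<delta> > 0" "D \<ge> 0"
  shows "real (card A) \<le> D / \<delta> + 1"
proof (cases "A = {}")
  case False
  define m where "m = Min A"
  have m: "m \<in> A" "\<And>x. x \<in> A \<Longrightarrow> m \<le> x" unfolding m_def using fin False by auto
  define f where "f x = \<lfloor>real_of_int (x - m) / \<delta>\<rfloor>" for x
  have "inj_on f A"
  proof (rule inj_onI, rule ccontr)
    fix x y assume xy: "x \<in> A" "y \<in> A" "f x = f y" "x \<noteq> y"
    have "\<bar>real_of_int (x - m) / \<delta> - real_of_int (y - m) / \<delta>\<bar> < 1"
      using xy(3) unfolding f_def by linarith
    hence "\<bar>real_of_int (x - y)\<bar> < \<delta>"
      using assms(4) by (simp add: diff_divide_distrib[symmetric] abs_divide)
    thus False using sep[OF xy(1,2,4)] by simp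
  qed
  moreover have "f ` A \<subseteq> {0..\<lfloor>D / \<delta>\<rfloor>}"
  proof
    fix k assume "k \<in> f ` A"
    then obtain x where x: "x \<in> A" "k = f x" by auto
    have "real_of_int (x - m) / \<delta> \<le> D / \<delta>" using D[OF x(1) m(1)] assms(4) by (intro divide_right_mono) auto
    moreover have "real_of_int (x - m) / \<delta> \<ge> 0" using m(2)[OF x(1)] assms(4) by simp
    ultimately show "k \<in> {0..\<lfloor>D / \<delta>\<rfloor>}" using x unfolding f_def by (auto intro: floor_mono)
  qed
  ultimately have "card A \<le> card {0..\<lfloor>D / \<delta>\<rfloor>}" by (meson card_inj_on_le finite_atLeastAtMost_int)
  hence "real (card A) \<le> real (nat (\<lfloor>D / \<delta>\<rfloor> + 1))" by simp
  also have "\<dots> = of_int (\<lfloor>D / \<delta>\<rfloor> + 1)" using assms(4,5) by (intro of_nat_nat) auto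
  also have "\<dots> \<le> D / \<delta> + 1" by simp
  finally show ?thesis .
next
  case True
  thus ?thesis using assms(4,5) by simp
qed

text \<open>For positive \<open>d\<close> a sublattice of index \<open>d\<close>. When
  \<open>z\<close> solves z^4 = -1 modulo \<open>d\<close>, it consists of zeros of t^4 + u^4 modulo
  \<open>d\<close>.\<close>

definition lat :: "nat \<Rightarrow> int \<Rightarrow> (int \<times> int) set" where
  "lat d z = {(t,u). int d dvd t - z * u}"

definition box :: "nat \<Rightarrow> (int \<times> int) set" where
  "box R = {1..int R} \<times> {1..int R}"

lemma finite_box [simp]: "finite (box R)" by (simp add: box_def)

lemma lat_diff: "(t,u) \<in> lat d z \<Longrightarrow> (t',u') \<in> lat d z \<Longrightarrow> (t - t', u - u') \<in> lat d z"
proof -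
  assume "(t,u) \<in> lat d z" "(t',u') \<in> lat d z"
  hence "int d dvd (t - z * u) - (t' - z * u')" unfolding lat_def by (auto intro: dvd_diff)
  thus ?thesis unfolding lat_def by (simp add: algebra_simps)
qed

lemma lat_det: "(t,u) \<in> lat d z \<Longrightarrow> (t',u') \<in> lat d z \<Longrightarrow> int d dvd t * u' - u * t'"
proof -
  assume "(t,u) \<in> lat d z" "(t',u') \<in> lat d z"
  hence "int d dvd (t - z * u) * u' - (t' - z * u') * u" unfolding lat_def by (auto intro!: dvd_diff)
  thus ?thesis by (simp add: algebra_simps)
qed

text \<open>Each row meets the lattice in a progression with difference \<open>d\<close>. The extra
  1 per row is harmless for \<open>d\<close> up to \<open>R\<close>, the range in which this bound
  is applied.\<close>

lemma lat_box_rows: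
  assumes "d > 0"
  shows "real (card (lat d z \<inter> box R)) \<le> real R * (real R / real d + 1)"
proof -
  have eq: "lat d z \<inter> box R = (\<lambda>(u,t). (t,u)) ` (SIGMA u:{1..int R}. {t\<in>{1..int R}. int d dvd t - z * u})"
    unfolding lat_def box_def by auto
  have "card (lat d z \<inter> box R) \<le> card (SIGMA u:{1..int R}. {t\<in>{1..int R}. int d dvd t - z * u})"
    unfolding eq by (intro card_image_le finite_SigmaI finite_Collect_conjI disjI1) simp_all
  also have "\<dots> = (\<Sum>u\<in>{1..int R}. card {t\<in>{1..int R}. int d dvd t - z * u})"
    by (intro card_SigmaI ballI finite_Collect_conjI disjI1) simp_all
  finally have "real (card (lat d z \<inter> box R))
      \<le> (\<Sum>u\<in>{1..int R}. real (card {t\<in>{1..int R}. int d dvd t - z * u}))"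
    using of_nat_mono by fastforce
  also have "\<dots> \<le> (\<Sum>u\<in>{1..int R}. real R / real d + 1)"
  proof (rule sum_mono, rule card_separated)
    show "finite {t\<in>{1..int R}. int d dvd t - z * u}" for u
      by (intro finite_Collect_conjI disjI1) simp
  next
    fix u x y assume xy: "x \<in> {t\<in>{1..int R}. int d dvd t - z * u}" "y \<in> {t\<in>{1..int R}. int d dvd t - z * u}" "x \<noteq> y"
    hence "int d dvd (x - z * u) - (y - z * u)" by - (rule dvd_diff; auto)
    hence "int d \<le> \<bar>x - y\<bar>" using xy by (intro zdvd_imp_le) auto
    thus "real d \<le> real_of_int \<bar>x - y\<bar>" by linarith
  next
    fix u x y assume "x \<in> {t\<in>{1..int R}. int d dvd t - z * u}" "y \<in> {t\<in>{1..int R}. int d dvd t - z * u}"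
    thus "\<bar>real_of_int (x - y)\<bar> \<le> real R" by auto
  qed (use assms in simp_all)
  finally show ?thesis by simp
qed

text \<open>The lattice points are sorted along lines parallel to a shortest vector
  \<open>(a,b)\<close>. The determinant with \<open>(a,b)\<close> labels the line; on lattice points
  it is a multiple of \<open>d\<close>, and in the box it varies by at most 2 l R, so at most 2 l R
  / d + 1 lines occur. Points on one line are at least \<open>l\<close> apart.\<close>

lemma lat_box_lines:
  fixes a b :: int
  assumes d: "d > 0" and v: "(a,b) \<in> lat d z" and l: "l = max \<bar>a\<bar> \<bar>b\<bar>" "l > 0"
    and min: "\<And>t u. (t,u) \<in> lat d z \<Longrightarrow> (t,u) \<noteq> (0,0) \<Longrightarrow> l \<le> max \<bar>t\<bar> \<bar>u\<bar>"
    and ld: "l ^ 2 \<le> int d"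
  shows "real (card (lat d z \<inter> box R)) \<le> 2 * real R ^ 2 / real d + 4 * real R / real_of_int l"
proof (cases "lat d z \<inter> box R = {}")
  case False
  define W where "W = lat d z \<inter> box R"
  define det where "det = (\<lambda>(t::int,u::int). a * u - b * t)"
  have fW: "finite W" unfolding W_def by simp
  obtain t0 u0 where "(t0,u0) \<in> W" using False unfolding W_def by auto
  hence "l \<le> max \<bar>t0\<bar> \<bar>u0\<bar>" "\<bar>t0\<bar> \<le> int R" "\<bar>u0\<bar> \<le> int R" "R > 0"
    using min[of t0 u0] unfolding W_def box_def by auto
  hence lR: "real_of_int l \<le> real R" and R: "R > 0" by auto
  have fiber: "real (card {w\<in>W. det w = k}) \<le> real R / real_of_int l + 1" for k
  proof -
    \<comment> \<open>The coordinate in which \<open>(a,b)\<close> is longer: the difference of two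
      points on one line is parallel to \<open>(a,b)\<close>, so its maximum norm is attained
      there.\<close>
    define f where "f = (\<lambda>(t::int,u::int). if \<bar>a\<bar> \<ge> \<bar>b\<bar> then t else u)"
    have key: "real_of_int \<bar>f w - f w'\<bar> \<ge> real_of_int l"
      if "w \<in> W" "w' \<in> W" "det w = k" "det w' = k" "w \<noteq> w'" for w w'
    proof -
      obtain t u t' u' where w: "w = (t,u)" "w' = (t',u')" by (metis surj_pair)
      have "a * (u - u') = b * (t - t')" using that(3,4) unfolding w det_def by (simp add: algebra_simps)
      hence eq: "\<bar>a\<bar> * \<bar>u - u'\<bar> = \<bar>b\<bar> * \<bar>t - t'\<bar>" by (metis abs_mult)
      have m: "l \<le> max \<bar>t - t'\<bar> \<bar>u - u'\<bar>"
        using min[OF lat_diff[of t u d z t' u']] that w unfolding W_def by auto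
      have "l \<le> \<bar>f w - f w'\<bar>"
      proof (cases "\<bar>a\<bar> \<ge> \<bar>b\<bar>")
        case True
        hence "\<bar>a\<bar> * \<bar>u - u'\<bar> \<le> \<bar>a\<bar> * \<bar>t - t'\<bar>" unfolding eq by (intro mult_right_mono) auto
        moreover have "\<bar>a\<bar> > 0" using True l by auto
        ultimately have "\<bar>u - u'\<bar> \<le> \<bar>t - t'\<bar>" by simp
        thus ?thesis using m True unfolding f_def w by auto
      next
        case False
        hence "\<bar>b\<bar> * \<bar>t - t'\<bar> \<le> \<bar>b\<bar> * \<bar>u - u'\<bar>" unfolding eq[symmetric] by (intro mult_right_mono) auto
        moreover have "\<bar>b\<bar> > 0" using False l by auto
        ultimately have "\<bar>t - t'\<bar> \<le> \<bar>u - u'\<bar>" by simp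
        thus ?thesis using m False unfolding f_def w by auto
      qed
      thus ?thesis by linarith
    qed
    have inj: "inj_on f {w\<in>W. det w = k}"
    proof (rule inj_onI, rule ccontr)
      fix w w' assume "w \<in> {w\<in>W. det w = k}" "w' \<in> {w\<in>W. det w = k}" "f w = f w'" "w \<noteq> w'"
      thus False using key[of w w'] l by auto
    qed
    have "real (card (f ` {w\<in>W. det w = k})) \<le> real R / real_of_int l + 1"
    proof (rule card_separated)
      fix x y assume "x \<in> f ` {w\<in>W. det w = k}" "y \<in> f ` {w\<in>W. det w = k}"
      thus "\<bar>real_of_int (x - y)\<bar> \<le> real R" unfolding f_def W_def box_def by (auto split: if_splits)
    qed (use key l fW in auto)
    thus ?thesis using card_image[OF inj] by simp
  qed
  have dets: "real (card (det ` W)) \<le> 2 * real_of_int l * real R / real d + 1"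
  proof (rule card_separated)
    fix x y assume "x \<in> det ` W" "y \<in> det ` W"
    then obtain t u t' u' where w: "(t,u) \<in> W" "(t',u') \<in> W" "x = a*u-b*t" "y = a*u'-b*t'"
      unfolding det_def by auto
    have "x - y = a * (u - u') - b * (t - t')" using w by (simp add: algebra_simps)
    hence "\<bar>x - y\<bar> \<le> \<bar>a\<bar> * \<bar>u - u'\<bar> + \<bar>b\<bar> * \<bar>t - t'\<bar>"
      by (metis abs_mult abs_triangle_ineq4)
    also have "\<dots> \<le> l * int R + l * int R"
      using w l unfolding W_def box_def by (intro add_mono mult_mono) auto
    finally have "real_of_int \<bar>x - y\<bar> \<le> real_of_int (2 * l * int R)" by linarith
    thus "\<bar>real_of_int (x - y)\<bar> \<le> 2 * real_of_int l * real R" by simp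
    have "int d dvd x" "int d dvd y"
      using lat_det[OF v, of t u] lat_det[OF v, of t' u'] w unfolding W_def by auto
    hence "int d dvd x - y" by (rule dvd_diff)
    moreover assume "x \<noteq> y"
    ultimately have "int d \<le> \<bar>x - y\<bar>" by (intro zdvd_imp_le) auto
    thus "real d \<le> real_of_int \<bar>x - y\<bar>" by linarith
  qed (use fW d l in auto)
  have "card W = (\<Sum>k\<in>det ` W. card {w\<in>W. det w = k})"
    unfolding card_eq_sum by (rule sum.image_gen[OF fW])
  hence "real (card W) = (\<Sum>k\<in>det ` W. real (card {w\<in>W. det w = k}))" by simp
  also have "\<dots> \<le> real (card (det ` W)) * (real R / real_of_int l + 1)"
    using sum_mono[of "det ` W", OF fiber] by simp
  also have "\<dots> \<le> (2 * real_of_int l * real R / real d + 1) * (real R / real_of_int l + 1)"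
    using l by (intro mult_right_mono dets) auto
  also have "\<dots> = 2 * real R ^ 2 / real d + 2 * real_of_int l * real R / real d + real R / real_of_int l + 1"
    using l d by (simp add: field_simps power2_eq_square)
  \<comment> \<open>The condition \<open>l ^ 2 \<le> int d\<close> turns 2 l R / d into at most 2 R
    / l, and a lattice point in the box forces \<open>l\<close> to be at most \<open>R\<close>, so
    the final 1 is also at most R / l.\<close>
  also have "\<dots> \<le> 2 * real R ^ 2 / real d + 4 * real R / real_of_int l"
  proof -
    have "real_of_int l * real_of_int l \<le> real d" using ld by (simp add: power2_eq_square) (metis of_int_le_iff of_int_mult of_int_of_nat_eq)
    hence "real_of_int l / real d \<le> 1 / real_of_int l" using l d by (simp add: field_simps)
    hence "2 * real R * (real_of_int l / real d) \<le> 2 * real R * (1 / real_of_int l)" by (intro mult_left_mono) auto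
    moreover have "1 \<le> real R / real_of_int l" using lR l by simp
    moreover have "2 * real_of_int l * real R / real d = 2 * real R * (real_of_int l / real d)"
      "2 * real R * (1 / real_of_int l) = 2 * (real R / real_of_int l)"
      "4 * real R / real_of_int l = 4 * (real R / real_of_int l)" by simp_all
    ultimately show ?thesis by linarith
  qed
  finally show ?thesis unfolding W_def .
next
  case True
  show ?thesis unfolding True using l(2) by simp
qed

text \<open>Thue's pigeonhole: the \<open>(s+1)^2 > d\<close> pairs with entries from 0 to
  \<open>s\<close> share only \<open>d\<close> values of i - z j modulo \<open>d\<close>.\<close>

lemma lat_short_vector:
  assumes d: "d > 0"
  shows "\<exists>a b. (a,b) \<in> lat d z \<and> (a,b) \<noteq> (0,0) \<and> (max \<bar>a\<bar> \<bar>b\<bar>)^2 \<le> int d"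
proof -
  define s where "s = nat \<lfloor>sqrt (real d)\<rfloor>"
  have s1: "s^2 \<le> d"
  proof -
    have "real s \<le> sqrt (real d)" unfolding s_def by simp
    hence "real s ^ 2 \<le> real d" by (metis of_nat_0_le_iff real_sqrt_pow2 power_mono)
    thus ?thesis by (metis of_nat_le_iff of_nat_power)
  qed
  have s2: "d < (s+1)^2"
  proof -
    have "sqrt (real d) < real (s+1)" unfolding s_def by linarith
    hence "real d < real (s+1) ^ 2" by (metis real_sqrt_less_iff real_sqrt_unique of_nat_0_le_iff)
    thus ?thesis by (metis of_nat_less_iff of_nat_power)
  qed
  define f where "f = (\<lambda>(i,j). (i - z * j) mod int d)"
  define P where "P = {0..int s} \<times> {0..int s}"
  have "card (f ` P) \<le> card {0..<int d}" using d by (intro card_mono) (auto simp: f_def)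
  also have "\<dots> < card P" using s2 by (simp add: P_def power2_eq_square nat_add_distrib)
  finally have "\<not> inj_on f P" by (metis card_image nat_less_le)
  then obtain v w where vw: "v \<in> P" "w \<in> P" "v \<noteq> w" "f v = f w" unfolding inj_on_def by blast
  obtain t u t' u' where e: "v = (t,u)" "w = (t',u')" by (metis surj_pair)
  have "int d dvd (t - z * u) - (t' - z * u')" using vw(4) unfolding e f_def by (simp add: mod_eq_dvd_iff)
  hence "(t - t', u - u') \<in> lat d z" unfolding lat_def by (simp add: algebra_simps)
  moreover have "(t - t', u - u') \<noteq> (0,0)" using vw e by auto
  moreover have "(max \<bar>t - t'\<bar> \<bar>u - u'\<bar>)^2 \<le> int d"
  proof -
    have "max \<bar>t - t'\<bar> \<bar>u - u'\<bar> \<le> int s" using vw(1,2) unfolding e P_def by auto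
    hence "(max \<bar>t - t'\<bar> \<bar>u - u'\<bar>)^2 \<le> (int s)^2" by (intro power_mono) auto
    also have "\<dots> \<le> int d" using s1 by (metis of_nat_le_iff of_nat_power)
    finally show ?thesis .
  qed
  ultimately show ?thesis by blast
qed

text \<open>Here \<open>l\<close> is any lower bound for the non-zero vectors. A true shortest
  vector exists, and Thue's argument supplies for it the inequality between squared length and
  \<open>d\<close> that \<open>lat_box_lines\<close> asks for.\<close>

lemma lat_box_count:
  assumes d: "d > 0" and l: "l > 0"
    and min: "\<And>t u. (t,u) \<in> lat d z \<Longrightarrow> (t,u) \<noteq> (0,0) \<Longrightarrow> l \<le> real_of_int (max \<bar>t\<bar> \<bar>u\<bar>)"
  shows "real (card (lat d z \<inter> box R)) \<le> 2 * real R ^ 2 / real d + 4 * real R / l"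
proof -
  define P where "P = (\<lambda>(t,u). (t,u) \<in> lat d z \<and> (t,u) \<noteq> (0,0))"
  define m where "m = (\<lambda>(t::int,u::int). nat (max \<bar>t\<bar> \<bar>u\<bar>))"
  obtain a0 b0 where ab0: "P (a0,b0)" "(max \<bar>a0\<bar> \<bar>b0\<bar>)^2 \<le> int d"
    using lat_short_vector[OF d, of z] unfolding P_def by auto
  obtain v where v: "P v" "\<And>w. P w \<Longrightarrow> m v \<le> m w"
    using ex_has_least_nat[of P "(a0,b0)" m] ab0(1) by blast
  obtain a b where ab: "v = (a,b)" by (metis surj_pair)
  have nat_le: "x \<le> y" if "nat x \<le> nat y" "0 \<le> y" for x y using that by linarith
  have le: "max \<bar>a\<bar> \<bar>b\<bar> \<le> max \<bar>t\<bar> \<bar>u\<bar>" if "P (t,u)" for t u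
  proof (rule nat_le)
    show "nat (max \<bar>a\<bar> \<bar>b\<bar>) \<le> nat (max \<bar>t\<bar> \<bar>u\<bar>)"
      using v(2)[OF that] unfolding ab m_def prod.case .
    show "0 \<le> max \<bar>t\<bar> \<bar>u\<bar>" by (rule max.coboundedI1) simp
  qed
  have "(max \<bar>a\<bar> \<bar>b\<bar>)^2 \<le> (max \<bar>a0\<bar> \<bar>b0\<bar>)^2" by (intro power_mono le ab0) auto
  hence l2: "(max \<bar>a\<bar> \<bar>b\<bar>)^2 \<le> int d" using ab0(2) by (rule order.trans)
  have vab: "(a,b) \<in> lat d z" "(a,b) \<noteq> (0,0)" using v(1) unfolding ab P_def by auto
  hence l0: "max \<bar>a\<bar> \<bar>b\<bar> > 0" by (auto simp: less_max_iff_disj)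
  have "real (card (lat d z \<inter> box R))
      \<le> 2 * real R ^ 2 / real d + 4 * real R / real_of_int (max \<bar>a\<bar> \<bar>b\<bar>)"
    by (rule lat_box_lines[OF d vab(1) refl l0 _ l2]) (use le P_def in auto)
  also have "4 * real R / real_of_int (max \<bar>a\<bar> \<bar>b\<bar>) \<le> 4 * real R / l"
    using min[of a b] v(1) l unfolding ab P_def by (intro divide_left_mono) auto
  finally show ?thesis by simp
qed

subsection \<open>Roots of \<open>z\<^sup>4 + 1\<close> modulo prime powers\<close>

text \<open>Modulo a non-trivial odd prime power these are the elements of order 8, one
  representative per class.\<close>

definition roots8 :: "nat \<Rightarrow> int set" where
  "roots8 d = {z\<in>{0..<int d}. int d dvd z ^ 4 + 1}"

lemma finite_roots8 [simp]: "finite (roots8 d)"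
  unfolding roots8_def by (intro finite_Collect_conjI disjI1) simp

lemma prime_power_dvd_mult:
  fixes p x y :: int
  assumes "prime p" "p ^ k dvd x * y" "\<not> (p dvd x \<and> p dvd y)"
  shows "p ^ k dvd x \<or> p ^ k dvd y"
proof (cases "p dvd x")
  case True
  hence "\<not> p dvd y" using assms(3) by simp
  hence "coprime (p ^ k) y" using assms(1) by (intro coprime_power_left_iff[THEN iffD2] disjI1 prime_imp_coprime)
  thus ?thesis using assms(2) by (simp add: coprime_dvd_mult_left_iff)
next
  case False
  hence "coprime (p ^ k) x" using assms(1) by (intro coprime_power_left_iff[THEN iffD2] disjI1 prime_imp_coprime)
  thus ?thesis using assms(2) by (simp add: coprime_dvd_mult_right_iff)
qed

text \<open>One root \<open>y\<close> yields all others: z^4 - y^4 = (z^2 - y^2)(z^2 + y^2), and z^2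
  + y^2 is congruent to (z - y^3)(z + y^3) because y^4 = -1. As \<open>p\<close> is odd and prime to
  \<open>y\<close>, it never divides both factors, so the whole power divides one. Prime powers are
  treated directly, without lifting roots.\<close>

lemma card_roots8:
  assumes p: "prime p" "odd p"
  shows "card (roots8 (p ^ k)) \<le> 4"
proof (cases "roots8 (p ^ k) = {}")
  case False
  define d where "d = int p ^ k"
  have d: "d = int (p ^ k)" "d > 0" unfolding d_def using p prime_gt_0_nat by auto
  have ip: "prime (int p)" using p by simp
  obtain y where y: "d dvd y ^ 4 + 1" using False unfolding roots8_def d by auto
  show ?thesis
  proof (cases "k = 0")
    case False
    hence pd: "int p dvd d" unfolding d_def by simp
    have p2: "\<not> int p dvd 2"
    proof
      assume "int p dvd 2"
      hence "p dvd 2" by presburger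
      thus False using p primes_dvd_imp_eq[of p 2] by auto
    qed
    have py: "\<not> int p dvd y"
    proof
      assume "int p dvd y"
      hence "int p dvd y ^ 4" by (rule dvd_power_le[where n=1, simplified]) simp
      with dvd_trans[OF pd y] have "int p dvd (y ^ 4 + 1) - y ^ 4" by (rule dvd_diff)
      thus False using ip not_prime_unit by auto
    qed
    have split: "d dvd (z - x) \<or> d dvd (z + x)" if "d dvd (z - x) * (z + x)" "\<not> int p dvd x" for x z
    proof -
      have "\<not> (int p dvd z - x \<and> int p dvd z + x)"
      proof
        assume "int p dvd z - x \<and> int p dvd z + x"
        hence "int p dvd (z + x) - (z - x)" by - (rule dvd_diff; auto)
        hence "int p dvd 2 * x" by (simp add: algebra_simps)
        thus False using that(2) p2 ip prime_dvd_mult_iff by blast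
      qed
      thus ?thesis using prime_power_dvd_mult[OF ip, of k] that(1) unfolding d_def by blast
    qed
    have "roots8 (p ^ k) \<subseteq> {y mod d, (-y) mod d, (y^3) mod d, (-(y^3)) mod d}"
    proof
      fix z assume "z \<in> roots8 (p ^ k)"
      hence z: "0 \<le> z" "z < d" "d dvd z ^ 4 + 1" unfolding roots8_def d by auto
      have "d dvd (z ^ 4 + 1) - (y ^ 4 + 1)" using z(3) y by (rule dvd_diff)
      hence prod: "d dvd (z^2 - y^2) * (z^2 + y^2)" by (simp add: algebra_simps flip: power_add)
      have "\<not> (int p dvd z^2 - y^2 \<and> int p dvd z^2 + y^2)"
      proof
        assume "int p dvd z^2 - y^2 \<and> int p dvd z^2 + y^2"
        hence "int p dvd (z^2 + y^2) - (z^2 - y^2)" by - (rule dvd_diff; auto)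
        hence "int p dvd 2 * y^2" by (simp add: algebra_simps)
        thus False using py p2 ip prime_dvd_mult_iff prime_dvd_power by blast
      qed
      hence "d dvd z^2 - y^2 \<or> d dvd z^2 + y^2"
        using prime_power_dvd_mult[OF ip, of k] prod unfolding d_def by blast
      hence "d dvd (z - y) * (z + y) \<or> d dvd (z - y^3) * (z + y^3)"
      proof
        assume "d dvd z^2 - y^2"
        thus ?thesis by (simp add: algebra_simps power2_eq_square)
      next
        assume "d dvd z^2 + y^2"
        hence "d dvd (z^2 + y^2) - y^2 * (y^4 + 1)" using y by - (rule dvd_diff; auto)
        hence "d dvd (z - y^3) * (z + y^3)" by (simp add: algebra_simps power2_eq_square eval_nat_numeral)
        thus ?thesis ..
      qed
      hence "d dvd z - y \<or> d dvd z + y \<or> d dvd z - y^3 \<or> d dvd z + y^3"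
        using split[of z y] split[of z "y^3"] py ip prime_dvd_power by blast
      moreover have "z = w mod d" if "d dvd z - w" for w
        using that z by (metis mod_eq_dvd_iff mod_pos_pos_trivial)
      from this[of y] this[of "-y"] this[of "y^3"] this[of "-(y^3)"]
      have "d dvd z - y \<Longrightarrow> z = y mod d" "d dvd z + y \<Longrightarrow> z = (-y) mod d"
        "d dvd z - y^3 \<Longrightarrow> z = (y^3) mod d" "d dvd z + y^3 \<Longrightarrow> z = (-(y^3)) mod d" by simp_all
      ultimately show "z \<in> {y mod d, (-y) mod d, (y^3) mod d, (-(y^3)) mod d}" by blast
    qed
    hence "card (roots8 (p ^ k)) \<le> card {y mod d, (-y) mod d, (y^3) mod d, (-(y^3)) mod d}"
      by (intro card_mono) auto
    also have "\<dots> \<le> 4" by (rule card_insert_le_m1; simp)+ 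
    finally show ?thesis .
  next
    case True
    have "card (roots8 (p ^ k)) \<le> card {0..<1::int}" unfolding roots8_def True by (intro card_mono) auto
    thus ?thesis by simp
  qed
qed simp

text \<open>A root has order exactly 8 modulo \<open>p\<close>, its fourth power being -1 and not 1;
  so 8 divides p - 1.\<close>

lemma roots8_mod_8:
  assumes p: "prime p" "odd p" and k: "k > 0" and ne: "roots8 (p ^ k) \<noteq> {}"
  shows "p ^ k mod 8 = 1"
proof -
  obtain z where z: "int (p ^ k) dvd z ^ 4 + 1" "0 \<le> z" using ne unfolding roots8_def by auto
  have "int p dvd int (p ^ k)" using k by simp
  hence "int p dvd z ^ 4 + 1" using z dvd_trans by blast
  moreover define x where "x = nat z"
  hence "z = int x" using z by simp
  ultimately have "int p dvd int (x ^ 4 + 1)" by (simp add: add.commute)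
  hence px: "p dvd x ^ 4 + 1" by (simp only: int_dvd_int_iff)
  have p2: "p \<noteq> 2" "p > 2" using p prime_ge_2_nat[of p] by (auto intro: le_neq_implies_less)
  have n4: "\<not> [x ^ 4 = 1] (mod p)"
  proof
    assume "[x ^ 4 = 1] (mod p)"
    hence "[x ^ 4 + 1 = 1 + 1] (mod p)" by (rule cong_add[OF _ cong_refl])
    hence "p dvd 2" using px by (metis cong_dvd_iff one_add_one)
    thus False using p2 dvd_imp_le[of p 2] by simp
  qed
  have "[x ^ 8 = 1] (mod p)"
  proof -
    have "p dvd (x ^ 4 + 1) * (x ^ 4 - 1)" using px by (rule dvd_mult2)
    also have "(x ^ 4 + 1) * (x ^ 4 - 1) = x ^ 8 - 1"
      by (simp add: algebra_simps diff_mult_distrib2 flip: power_add)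
    finally have "p dvd x ^ 8 - 1" .
    moreover have "x ^ 8 \<ge> 1"
    proof (rule ccontr)
      assume "\<not> x ^ 8 \<ge> 1"
      hence "x ^ 8 = 0" by linarith
      hence "x = 0" by simp
      thus False using px p2 by simp
    qed
    ultimately show ?thesis by (simp add: cong_altdef_nat)
  qed
  hence "ord p x dvd 8" by (rule ord_divides[THEN iffD1])
  moreover have "\<not> ord p x dvd 4" using n4 ord_divides by blast
  ultimately have "ord p x = 8"
  proof -
    assume a: "ord p x dvd 8" "\<not> ord p x dvd 4"
    obtain i where i: "i \<le> 3" "ord p x = 2 ^ i"
      using a(1) divides_primepow_nat[OF two_is_prime_nat, of "ord p x" 3] by auto
    have "i = 3"
    proof (rule ccontr)
      assume "i \<noteq> 3"
      hence "ord p x dvd 2 ^ 2" unfolding i(2) using i(1) by (intro le_imp_power_dvd) auto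
      thus False using a(2) by simp
    qed
    thus ?thesis using i by simp
  qed
  moreover have "coprime p x"
  proof -
    have "\<not> p dvd x"
    proof
      assume "p dvd x"
      hence "p dvd x ^ 4" by (simp add: dvd_power_iff_le dvd_trans[OF _ dvd_power])
      hence "p dvd 1" using px dvd_add_right_iff by blast
      thus False using p2 by simp
    qed
    thus ?thesis using p prime_imp_coprime by blast
  qed
  ultimately have "8 dvd totient p" using order_divides_totient[of p x] by simp
  hence "8 dvd p - 1" using p totient_prime by simp
  hence "[p = 1] (mod 8)" using p2 by (simp add: cong_altdef_nat)
  hence "[p ^ k = 1 ^ k] (mod 8)" by (rule cong_pow)
  thus ?thesis by (simp add: cong_def)
qed

text \<open>Fourth powers are 0 or 1 modulo 4, so 4 never divides z^4 + 1.\<close>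

lemma roots8_pow2: "k \<ge> 2 \<Longrightarrow> roots8 (2 ^ k) = {}"
proof (rule ccontr)
  assume k: "k \<ge> 2" and "roots8 (2 ^ k) \<noteq> {}"
  then obtain z where z: "int (2 ^ k) dvd z ^ 4 + 1" unfolding roots8_def by auto
  have "(2::int) ^ 2 dvd 2 ^ k" using k by (rule le_imp_power_dvd)
  hence 4: "4 dvd z ^ 4 + 1" using z dvd_trans[of "4::int"] by simp
  have "z ^ 4 mod 4 = (z mod 4) ^ 4 mod 4" by (simp add: power_mod)
  moreover have "z mod 4 = 0 \<or> z mod 4 = 1 \<or> z mod 4 = 2 \<or> z mod 4 = 3" by presburger
  ultimately have "z ^ 4 mod 4 = 0 \<or> z ^ 4 mod 4 = 1" by (elim disjE) simp_all
  thus False using 4 by presburger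
qed

lemma lat_dvd: "int d dvd z ^ 4 + 1 \<Longrightarrow> (t,u) \<in> lat d z \<Longrightarrow> int d dvd t ^ 4 + u ^ 4"
proof -
  assume "int d dvd z ^ 4 + 1" "(t,u) \<in> lat d z"
  hence "int d dvd (t - z * u) * (t^3 + t^2*(z*u) + t*(z*u)^2 + (z*u)^3) + (z ^ 4 + 1) * u ^ 4"
    unfolding lat_def by (intro dvd_add) auto
  also have "\<dots> = t ^ 4 + u ^ 4" by (simp add: algebra_simps eval_nat_numeral)
  finally show ?thesis .
qed

text \<open>The root is t / u modulo \<open>p ^ k\<close>. The quotient exists: if \<open>p\<close>
  divided \<open>u\<close>, it would also divide \<open>t\<close>, against coprimality.\<close>

lemma primitive_in_lat:
  assumes p: "prime p" and co: "coprime t u" and dv: "int (p ^ k) dvd t ^ 4 + u ^ 4" and k: "k > 0"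
  shows "\<exists>z\<in>roots8 (p ^ k). (t,u) \<in> lat (p ^ k) z"
proof -
  define d where "d = int (p ^ k)"
  have d: "d > 0" unfolding d_def using p prime_gt_0_nat by simp
  have ip: "prime (int p)" using p by simp
  have pd: "int p dvd d" unfolding d_def using k by simp
  have "\<not> int p dvd u"
  proof
    assume u: "int p dvd u"
    have "int p dvd t ^ 4 + u ^ 4" using dvd_trans[OF pd] dv unfolding d_def by blast
    moreover have "int p dvd u ^ 4" using u by (rule dvd_power_le[where n=1, simplified]) simp
    ultimately have "int p dvd (t ^ 4 + u ^ 4) - u ^ 4" by (rule dvd_diff)
    hence "int p dvd t" using prime_dvd_power[OF ip, of t 4] by simp
    hence "int p dvd 1" using u co coprime_common_divisor by blast
    thus False using ip not_prime_unit by blast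
  qed
  hence "coprime u (int p)" using prime_imp_coprime[OF ip] coprime_commute by blast
  hence "coprime u d" unfolding d_def by simp
  then obtain w where w: "[u * w = 1] (mod d)" using cong_solve_coprime_int by blast
  define z where "z = (t * w) mod d"
  have "[z = t * w] (mod d)" unfolding z_def by (simp add: cong_def)
  hence "[z * u = t * w * u] (mod d)" by (rule cong_mult[OF _ cong_refl])
  also have "t * w * u = t * (u * w)" by simp
  also have "[t * (u * w) = t * 1] (mod d)" by (rule cong_mult[OF cong_refl w])
  finally have zu: "[t = z * u] (mod d)" by (simp add: cong_sym)
  hence inl: "(t,u) \<in> lat (p ^ k) z" unfolding lat_def d_def by (simp add: cong_iff_dvd_diff)
  have "[t ^ 4 + u ^ 4 = (z * u) ^ 4 + u ^ 4] (mod d)" by (intro cong_add cong_pow zu cong_refl)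
  hence "d dvd (z * u) ^ 4 + u ^ 4" using dv cong_dvd_iff unfolding d_def by blast
  hence "d dvd u ^ 4 * (z ^ 4 + 1)" by (simp add: algebra_simps)
  hence "d dvd z ^ 4 + 1" using \<open>coprime u d\<close> by (simp add: coprime_dvd_mult_right_iff coprime_commute)
  hence "z \<in> roots8 (p ^ k)" unfolding roots8_def d_def[symmetric] using d by (simp add: z_def)
  thus ?thesis using inl by blast
qed

section \<open>Double counting of ln(t^4 + u^4) over the box\<close>

definition lat_count :: "nat \<Rightarrow> nat \<Rightarrow> real" where
  "lat_count R d = (\<Sum>z\<in>roots8 d. real (card (lat d z \<inter> box R)))"

lemma mangoldt_nonzeroE:
  assumes "vM d \<noteq> 0"
  obtains p k where "prime p" "k > 0" "d = p ^ k"
proof -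
  have "primepow d" using assms by (cases "primepow d") (simp_all add: mangoldt_def)
  thus ?thesis using that unfolding primepow_def by blast
qed

text \<open>The gcd is split off because a prime power dividing its fourth power need not place
  \<open>(t,u)\<close> in any lattice, whereas each prime power dividing the value at the primitive
  part does. The range \<open>2*R^4\<close> covers all values on the box.\<close>

lemma ln_le_lat_sum:
  assumes "(t,u) \<in> box R"
  shows "ln (real_of_int (t ^ 4 + u ^ 4))
    \<le> 4 * ln (real_of_int (gcd t u)) + (\<Sum>d=1..2*R^4. \<Sum>z\<in>roots8 d. if (t,u) \<in> lat d z then vM d else 0)"
proof -
  have tu: "1 \<le> t" "t \<le> int R" "1 \<le> u" "u \<le> int R" using assms unfolding box_def by auto
  define g where "g = gcd t u"
  have g: "g > 0" unfolding g_def using tu by simp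
  obtain t' u' where t': "t = g * t'" and u': "u = g * u'" and co: "coprime t' u'"
    unfolding g_def using gcd_coprime_exists[of t u] tu by (metis gcd_eq_0_iff mult.commute not_one_le_zero)
  have pos: "t' > 0" "u' > 0" 
    using tu g zero_less_mult_pos[of g t'] zero_less_mult_pos[of g u'] unfolding t' u' by linarith+
  define n where "n = nat (t' ^ 4 + u' ^ 4)"
  have n: "int n = t' ^ 4 + u' ^ 4" "n > 0" unfolding n_def using pos by (simp_all add: add_pos_pos)
  have G: "t ^ 4 + u ^ 4 = g ^ 4 * int n" unfolding n t' u' by (simp add: algebra_simps)
  have "ln (real_of_int (t ^ 4 + u ^ 4)) = 4 * ln (real_of_int g) + ln (real n)"
    unfolding G using g n(2) by (simp add: ln_mult ln_realpow)
  also have "ln (real n) = (\<Sum>d | d dvd n. vM d)" using n(2) mangoldt_sum[of n, where 'a=real] by simp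
  also have "\<dots> \<le> (\<Sum>d | d dvd n. \<Sum>z\<in>roots8 d. if (t,u) \<in> lat d z then vM d else 0)"
  proof (rule sum_mono)
    fix d assume "d \<in> {d. d dvd n}"
    hence dn: "d dvd n" by simp
    show "vM d \<le> (\<Sum>z\<in>roots8 d. if (t,u) \<in> lat d z then vM d else 0)"
    proof (cases "vM d = 0")
      case True
      show ?thesis unfolding True by simp
    next
      case False
      then obtain p k where pk: "prime p" "k > 0" "d = p ^ k" by (rule mangoldt_nonzeroE)
      have "int (p ^ k) dvd t' ^ 4 + u' ^ 4" using dn unfolding n(1)[symmetric] pk(3) by (simp only: int_dvd_int_iff)
      then obtain z where z: "z \<in> roots8 d" "(t',u') \<in> lat d z"
        using primitive_in_lat[OF pk(1) co _ pk(2)] unfolding pk(3) by blast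
      have "int d dvd g * (t' - z * u')" using z(2) unfolding lat_def by simp
      hence "(t,u) \<in> lat d z" unfolding lat_def t' u' by (simp add: algebra_simps)
      hence "vM d = (if (t,u) \<in> lat d z then vM d else 0)" by simp
      also have "\<dots> \<le> (\<Sum>z\<in>roots8 d. if (t,u) \<in> lat d z then vM d else 0)"
        by (rule member_le_sum[OF z(1)]) (auto simp: mangoldt_nonneg)
      finally show ?thesis .
    qed
  qed
  also have "\<dots> \<le> (\<Sum>d=1..2*R^4. \<Sum>z\<in>roots8 d. if (t,u) \<in> lat d z then vM d else 0)"
  proof (rule sum_mono2)
    show "{d. d dvd n} \<subseteq> {1..2*R^4}"
    proof
      fix d assume "d \<in> {d. d dvd n}"
      hence d: "d \<le> n" "d > 0" using n(2) by (auto intro: dvd_imp_le Nat.gr0I)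
      have "int n \<le> g ^ 4 * int n" using g by (simp add: mult_le_cancel_right1 n(2))
      also have "\<dots> \<le> int R ^ 4 + int R ^ 4" unfolding G[symmetric] using tu by (intro add_mono power_mono) auto
      also have "\<dots> = int (2 * R ^ 4)" by simp
      finally have "n \<le> 2 * R ^ 4" by (simp only: zle_int)
      thus "d \<in> {1..2*R^4}" using d by simp
    qed
  qed (auto intro!: sum_nonneg simp: mangoldt_nonneg)
  finally show ?thesis unfolding g_def by simp
qed

lemma card_multiples_le: "d > 0 \<Longrightarrow> real (card {t\<in>{1..int R}. int d dvd t}) \<le> real R / real d"
proof -
  assume d: "d > 0"
  have "{t\<in>{1..int R}. int d dvd t} \<subseteq> (\<lambda>k. int d * k) ` {1..int (R div d)}"
  proof
    fix t assume "t \<in> {t\<in>{1..int R}. int d dvd t}"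
    then obtain k where k: "t = int d * k" "1 \<le> t" "t \<le> int R" by auto
    have "k \<ge> 1" using k(1,2) d by (smt (verit) mult_nonneg_nonpos of_nat_0_le_iff)
    moreover have "k \<le> int R div int d" using k d by (simp add: pos_imp_zdiv_nonneg_iff zdiv_mono1[of "int d * k" "int R" "int d", simplified])
    ultimately show "t \<in> (\<lambda>k. int d * k) ` {1..int (R div d)}" using k by (auto simp: zdiv_int)
  qed
  hence "card {t\<in>{1..int R}. int d dvd t} \<le> card {1..int (R div d)}" by (rule surj_card_le[rotated]) simp
  hence "real (card {t\<in>{1..int R}. int d dvd t}) \<le> real (R div d)" by simp
  also have "\<dots> \<le> real R / real d" by (rule of_nat_div_le_of_nat)
  finally show ?thesis .
qed

text \<open>ln of the gcd is the sum of \<open>vM d\<close> over common divisors, each shared by at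
  most (R/d)^2 points, and the sum of \<open>vM d\<close> / d^2 converges. Non-primitive points thus
  affect only the O(R^2) term.\<close>

lemma sum_ln_gcd_box: "(\<Sum>(t,u)\<in>box R. ln (real_of_int (gcd t u))) \<le> 32 * real R ^ 2"
proof -
  have "(\<Sum>(t,u)\<in>box R. ln (real_of_int (gcd t u)))
      = (\<Sum>(t,u)\<in>box R. \<Sum>d=1..R. if int d dvd t \<and> int d dvd u then vM d else 0)"
  proof (rule sum.cong[OF refl], clarify)
    fix t u assume "(t,u) \<in> box R"
    hence tu: "1 \<le> t" "t \<le> int R" "1 \<le> u" unfolding box_def by auto
    define n where "n = nat (gcd t u)"
    have n: "int n = gcd t u" unfolding n_def by simp
    have n0: "n > 0" using n tu by (metis gcd_pos_int not_one_le_zero of_nat_0_less_iff)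
    have nR: "n \<le> R" 
    proof -
      have "gcd t u \<le> t" by (rule zdvd_imp_le) (use tu in auto)
      thus ?thesis using n tu(2) by linarith
    qed
    have "ln (real_of_int (gcd t u)) = ln (real n)" unfolding n[symmetric] by simp
    also have "\<dots> = (\<Sum>d | d dvd n. vM d)" using n0 mangoldt_sum[of n, where 'a=real] by simp
    also have "{d. d dvd n} = {d\<in>{1..R}. int d dvd t \<and> int d dvd u}"
    proof -
      have "d dvd n \<longleftrightarrow> int d dvd t \<and> int d dvd u" for d
        by (metis n gcd_greatest_iff int_dvd_int_iff)
      moreover have "d dvd n \<Longrightarrow> d \<in> {1..R}" for d
        using dvd_imp_le[of d n] n0 nR by (auto simp: Suc_le_eq intro: Nat.gr0I)
      ultimately show ?thesis by blast
    qed
    also have "(\<Sum>d\<in>\<dots>. vM d) = (\<Sum>d=1..R. if int d dvd t \<and> int d dvd u then vM d else 0)"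
      by (rule sum.inter_filter) simp
    finally show "ln (real_of_int (gcd t u)) = \<dots>" .
  qed
  also have "\<dots> = (\<Sum>d=1..R. \<Sum>(t,u)\<in>box R. if int d dvd t \<and> int d dvd u then vM d else 0)"
    unfolding case_prod_unfold by (rule sum.swap)
  also have "\<dots> \<le> (\<Sum>d=1..R. vM d * (real R / real d) ^ 2)"
  proof (rule sum_mono)
    fix d assume d: "d \<in> {1..R}"
    let ?M = "{t\<in>{1..int R}. int d dvd t}"
    have "(\<Sum>(t,u)\<in>box R. if int d dvd t \<and> int d dvd u then vM d else 0)
        = (\<Sum>t\<in>{1..int R}. \<Sum>u\<in>{1..int R}. if int d dvd t \<and> int d dvd u then vM d else 0)"
      unfolding box_def by (rule sum.cartesian_product[symmetric])
    also have "\<dots> = (\<Sum>t\<in>{1..int R}. if int d dvd t then real (card ?M) * vM d else 0)"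
    proof (rule sum.cong[OF refl])
      fix t
      have "(\<Sum>u\<in>{1..int R}. if int d dvd u then vM d else 0) = (\<Sum>u\<in>?M. vM d)"
        by (rule sum.inter_filter[symmetric]) simp
      thus "(\<Sum>u\<in>{1..int R}. if int d dvd t \<and> int d dvd u then vM d else 0)
          = (if int d dvd t then real (card ?M) * vM d else 0)" by (cases "int d dvd t") simp_all
    qed
    also have "\<dots> = (\<Sum>t\<in>?M. real (card ?M) * vM d)"
      by (rule sum.inter_filter[symmetric]) simp
    also have "\<dots> = vM d * real (card ?M) ^ 2" by (simp add: power2_eq_square)
    also have "\<dots> \<le> vM d * (real R / real d) ^ 2"
      using d by (intro mult_left_mono power_mono card_multiples_le) (auto simp: mangoldt_nonneg)
    finally show "(\<Sum>(t,u)\<in>box R. if int d dvd t \<and> int d dvd u then vM d else 0) \<le> \<dots>" .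
  qed
  also have "\<dots> = real R ^ 2 * (\<Sum>d=1..R. vM d / real d ^ 2)"
    by (simp add: sum_distrib_left power_divide mult_ac)
  also have "\<dots> \<le> real R ^ 2 * 32"
  proof (cases "R = 0")
    case False
    have "(\<Sum>d=1..R. vM d / real d ^ 2) \<le> 32 - 32 / real R" using False by (intro mangoldt_sum_sq) auto
    also have "\<dots> \<le> 32" by simp
    finally show ?thesis by (intro mult_left_mono) auto
  qed simp
  finally show ?thesis by simp
qed

text \<open>The constant is 4 * 32, from the gcd terms; the rest is the pointwise bound with the
  summations exchanged.\<close>

lemma sum_ln_box_le:
  "(\<Sum>(t,u)\<in>box R. ln (real_of_int (t ^ 4 + u ^ 4)))
    \<le> 128 * real R ^ 2 + (\<Sum>d=1..2*R^4. vM d * lat_count R d)"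
proof -
  have "(\<Sum>(t,u)\<in>box R. ln (real_of_int (t ^ 4 + u ^ 4)))
    \<le> (\<Sum>(t,u)\<in>box R. 4 * ln (real_of_int (gcd t u))
        + (\<Sum>d=1..2*R^4. \<Sum>z\<in>roots8 d. if (t,u) \<in> lat d z then vM d else 0))"
    by (rule sum_mono) (use ln_le_lat_sum in auto)
  also have "\<dots> = 4 * (\<Sum>(t,u)\<in>box R. ln (real_of_int (gcd t u)))
      + (\<Sum>(t,u)\<in>box R. \<Sum>d=1..2*R^4. \<Sum>z\<in>roots8 d. if (t,u) \<in> lat d z then vM d else 0)"
    by (simp add: case_prod_unfold sum.distrib sum_distrib_left)
  also have "(\<Sum>(t,u)\<in>box R. \<Sum>d=1..2*R^4. \<Sum>z\<in>roots8 d. if (t,u) \<in> lat d z then vM d else 0)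
      = (\<Sum>d=1..2*R^4. vM d * lat_count R d)"
  proof -
    have "(\<Sum>(t,u)\<in>box R. \<Sum>d=1..2*R^4. \<Sum>z\<in>roots8 d. if (t,u) \<in> lat d z then vM d else 0)
       = (\<Sum>d=1..2*R^4. \<Sum>v\<in>box R. \<Sum>z\<in>roots8 d. if v \<in> lat d z then vM d else 0)"
      unfolding case_prod_unfold prod.collapse by (rule sum.swap)
    also have "\<dots> = (\<Sum>d=1..2*R^4. \<Sum>z\<in>roots8 d. \<Sum>v\<in>box R. if v \<in> lat d z then vM d else 0)"
      by (rule sum.cong[OF refl], rule sum.swap)
    also have "\<dots> = (\<Sum>d=1..2*R^4. vM d * lat_count R d)"
    proof (rule sum.cong[OF refl])
      fix d
      have "(\<Sum>v\<in>box R. if v \<in> lat d z then vM d else 0) = vM d * real (card (lat d z \<inter> box R))" for z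
      proof -
        have "(\<Sum>v\<in>box R. if v \<in> lat d z then vM d else 0) = (\<Sum>v\<in>{v\<in>box R. v \<in> lat d z}. vM d)"
          by (rule sum.inter_filter[symmetric]) simp
        also have "{v\<in>box R. v \<in> lat d z} = lat d z \<inter> box R" by auto
        finally show ?thesis by simp
      qed
      thus "(\<Sum>z\<in>roots8 d. \<Sum>v\<in>box R. if v \<in> lat d z then vM d else 0) = vM d * lat_count R d"
        unfolding lat_count_def by (simp add: sum_distrib_left)
    qed
    finally show ?thesis .
  qed
  finally show ?thesis using sum_ln_gcd_box[of R] by linarith
qed

text \<open>Dropping u^4 leaves \<open>R\<close> copies of 4 ln R!, and Stirling's lower bound
  applies.\<close>

lemma sum_ln_box_ge:
  assumes "R > 0"
  shows "(\<Sum>(t,u)\<in>box R. ln (real_of_int (t ^ 4 + u ^ 4))) \<ge> 4 * real R ^ 2 * (ln (real R) - 1)"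
proof -
  have "4 * real R ^ 2 * (ln (real R) - 1) = 4 * real R * (real R * ln (real R) - real R)"
    by (simp add: algebra_simps power2_eq_square)
  also have "\<dots> \<le> 4 * real R * ln (fact R)" by (intro mult_left_mono ln_fact_ge) auto
  also have "ln (fact R :: real) = (\<Sum>n=1..R. ln (real n))"
    by (subst fact_prod, subst of_nat_prod, subst ln_prod) auto
  also have "\<dots> = (\<Sum>t\<in>{1..int R}. ln (real_of_int t))"
    by (rule sum.reindex_bij_witness[of _ nat int]) auto
  also have "4 * real R * \<dots> = (\<Sum>t\<in>{1..int R}. \<Sum>u\<in>{1..int R}. 4 * ln (real_of_int t))"
    by (simp add: sum_distrib_left mult_ac)
  also have "\<dots> = (\<Sum>(t,u)\<in>box R. 4 * ln (real_of_int t))"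
    unfolding box_def by (rule sum.cartesian_product)
  also have "\<dots> \<le> (\<Sum>(t,u)\<in>box R. ln (real_of_int (t ^ 4 + u ^ 4)))"
  proof (rule sum_mono, clarify)
    fix t u assume "(t,u) \<in> box R"
    hence tu: "1 \<le> t" "1 \<le> u" unfolding box_def by auto
    have "4 * ln (real_of_int t) = ln (real_of_int (t ^ 4))" using tu by (simp add: ln_realpow)
    also have "\<dots> \<le> ln (real_of_int (t ^ 4 + u ^ 4))"
      using tu by (subst ln_le_cancel_iff) (auto intro!: add_pos_nonneg simp del: of_int_power of_int_add)
    finally show "4 * ln (real_of_int t) \<le> ln (real_of_int (t ^ 4 + u ^ 4))" .
  qed
  finally show ?thesis .
qed

subsection \<open>A value \<open>t\<^sup>4 + u\<^sup>4\<close> with a large prime factor\<close>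

lemma lat_count_le_of_bound:
  assumes p: "prime p" "odd p" and B: "B \<ge> 0"
    and bd: "\<And>z. z \<in> roots8 (p ^ k) \<Longrightarrow> real (card (lat (p ^ k) z \<inter> box R)) \<le> B"
  shows "lat_count R (p ^ k) \<le> 4 * B"
proof -
  have "lat_count R (p ^ k) \<le> (\<Sum>z\<in>roots8 (p ^ k). B)"
    unfolding lat_count_def by (rule sum_mono) (rule bd)
  also have "\<dots> = real (card (roots8 (p ^ k))) * B" by simp
  also have "\<dots> \<le> 4 * B" using card_roots8[OF p, of k] B by (intro mult_right_mono) auto
  finally show ?thesis .
qed

text \<open>A non-zero lattice vector gives a positive value t^4 + u^4 divisible by
  \<open>d\<close>, hence at least \<open>d\<close>. This weak bound serves the proper prime powers,
  about which a hypothesis on primes says nothing.\<close>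

lemma lat_min_quartic:
  assumes d: "d > 0" and z: "z \<in> roots8 d" and v: "(t,u) \<in> lat d z" "(t,u) \<noteq> (0,0)"
  shows "sqrt (sqrt (real d)) / 2 \<le> real_of_int (max \<bar>t\<bar> \<bar>u\<bar>)"
proof -
  define m where "m = max \<bar>t\<bar> \<bar>u\<bar>"
  have m: "\<bar>t\<bar> \<le> m" "\<bar>u\<bar> \<le> m" "m \<ge> 0" unfolding m_def by auto
  have "int d dvd t ^ 4 + u ^ 4" using lat_dvd[OF _ v(1)] z unfolding roots8_def by simp
  moreover have "t ^ 4 + u ^ 4 > 0"
  proof -
    have "t ^ 4 > 0 \<or> u ^ 4 > 0" using v(2) by auto
    moreover have "t ^ 4 \<ge> 0" "u ^ 4 \<ge> 0" by simp_all
    ultimately show ?thesis by linarith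
  qed
  ultimately have "int d \<le> t ^ 4 + u ^ 4" by (rule zdvd_imp_le)
  also have "\<dots> = \<bar>t\<bar> ^ 4 + \<bar>u\<bar> ^ 4" by simp
  also have "\<dots> \<le> m ^ 4 + m ^ 4" using m by (intro add_mono power_mono) auto
  also have "\<dots> \<le> (2 * m) ^ 4" by (simp add: power_mult_distrib)
  finally have "int d \<le> (2 * m) ^ 4" .
  hence "real_of_int (int d) \<le> real_of_int ((2 * m) ^ 4)" by (simp only: of_int_le_iff)
  hence "real d \<le> ((2 * real_of_int m)^2)^2" by (simp add: power_mult_distrib flip: power_mult)
  hence "sqrt (real d) \<le> (2 * real_of_int m)^2" by (rule real_le_lsqrt[rotated]) simp
  hence "sqrt (sqrt (real d)) \<le> 2 * real_of_int m" by (rule real_le_lsqrt[rotated]) (use m in simp)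
  thus ?thesis unfolding m_def by simp
qed

text \<open>The negated claim bounds the lattices of primes from below: every non-zero vector has
  maximum norm above sqrt(d/C). Hence primes beyond C R^2 miss the box, and the lattices of smaller
  primes suit the line count. \<open>C\<close> is arbitrary, so \<open>p\<close> can exceed the
  squared norm by any prescribed factor.\<close>

lemma big_prime_factor:
  fixes C :: nat
  shows "\<exists>p t u. prime p \<and> (t,u) \<noteq> (0,0) \<and> int p dvd t ^ 4 + u ^ 4 \<and> int C * (max \<bar>t\<bar> \<bar>u\<bar>)^2 \<le> int p"
proof (rule ccontr)
  assume neg: "\<nexists>p t u. prime p \<and> (t,u) \<noteq> (0,0) \<and> int p dvd t ^ 4 + u ^ 4 \<and> int C * (max \<bar>t\<bar> \<bar>u\<bar>)^2 \<le> int p"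
  have H: "int p < int C * (max \<bar>t\<bar> \<bar>u\<bar>)^2"
    if "prime p" "(t,u) \<noteq> (0,0)" "int p dvd t ^ 4 + u ^ 4" for p t u
    using neg that by (meson not_le)
  have C: "C \<ge> 1"
  proof (rule ccontr)
    assume "\<not> C \<ge> 1"
    thus False using H[of 2 1 1] by simp
  qed
  obtain K where K: "\<And>n. n > 0 \<Longrightarrow>
      \<bar>(\<Sum>d\<in>{d\<in>{1..n}. d mod 8 = 1}. 4 * vM d / real d) - ln (real n)\<bar> \<le> K"
    using mertens_one_mod_8 by blast
  define S where "S n = (\<Sum>d\<in>{d\<in>{1..n}. d mod 8 = 1}. 4 * vM d / real d)" for n :: nat
  \<comment> \<open>All constants in front of R^2: gcd terms, the modulus 2, \<open>psi R\<close>,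
    the boundary terms R/l, proper prime powers, and what 2 S(Y) - S(R) leaves besides 3 ln
    R.\<close>
  define A where "A = 128 + 1 + 16 + 336 * real C + 3200 + 2 * ln (real C) + 3 * K"
  have main: "ln (real R) \<le> A + 4" if R: "R > 0" for R
  proof -
    define Y where "Y = C * R ^ 2"
    define X where "X = 2 * R ^ 4"
    have RY: "R \<le> Y" unfolding Y_def using C R by (simp add: power2_eq_square)
    \<comment> \<open>Five majorants: the modulus 2; prime powers up to \<open>R\<close>, counted by
      rows; main term and boundary term of the line count for primes in (R, Y]; proper prime powers
      beyond \<open>R\<close>.\<close>
    define f1 where "f1 d = (if d = 2 then vM d * real R ^ 2 else 0)" for d :: nat
    define f2 where "f2 d = (if d \<le> R \<and> d mod 8 = 1 then 4 * vM d * (real R ^ 2 / real d + real R) else 0)" for d :: nat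
    define f3 where "f3 d = (if R < d \<and> d \<le> Y \<and> d mod 8 = 1 then 4 * vM d * (2 * real R ^ 2 / real d) else 0)" for d :: nat
    define f4 where "f4 d = (if d \<le> Y then 16 * real R * sqrt (real C) * (vM d / sqrt (real d)) else 0)" for d :: nat
    define f5 where "f5 d = (if \<not> prime d then vM d * (8 * real R ^ 2 / real d + 32 * real R / sqrt (sqrt (real d))) else 0)" for d :: nat
    have f0: "f1 d \<ge> 0" "f2 d \<ge> 0" "f3 d \<ge> 0" "f4 d \<ge> 0" "f5 d \<ge> 0" for d
      unfolding f1_def f2_def f3_def f4_def f5_def by (simp_all add: mangoldt_nonneg)
    have pointwise: "vM d * lat_count R d \<le> f1 d + f2 d + f3 d + f4 d + f5 d" if "d \<in> {1..X}" for d
    proof (cases "vM d = 0")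
      case False
      then obtain p k where pk: "prime p" "k > 0" "d = p ^ k" by (rule mangoldt_nonzeroE)
      have d: "d > 0" using that by simp
      have vM0: "vM d \<ge> 0" by (rule mangoldt_nonneg)
      show ?thesis
      proof (cases "p = 2")
        case True
        show ?thesis
        proof (cases "k = 1")
          case k: True
          have "roots8 2 \<subseteq> {1}"
          proof
            fix z assume "z \<in> roots8 2"
            hence "0 \<le> z" "z < 2" "2 dvd z ^ 4 + 1" unfolding roots8_def by auto
            moreover from this have "z \<noteq> 0" by auto
            ultimately show "z \<in> {1}" by simp
          qed
          hence c1: "card (roots8 2) \<le> 1" using card_mono[of "{1::int}" "roots8 2"] by simp
          have "card (lat 2 z \<inter> box R) \<le> R ^ 2" for z
          proof -
            have "card (lat 2 z \<inter> box R) \<le> card (box R)" by (intro card_mono) auto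
            thus ?thesis by (simp add: box_def power2_eq_square)
          qed
          hence "lat_count R 2 \<le> (\<Sum>z\<in>roots8 2. real R ^ 2)"
            unfolding lat_count_def by (intro sum_mono) (metis of_nat_le_iff of_nat_power)
          also have "\<dots> = real (card (roots8 2)) * real R ^ 2" by simp
          also have "\<dots> \<le> 1 * real R ^ 2" using c1 by (intro mult_right_mono) auto
          finally have "vM d * lat_count R d \<le> vM d * real R ^ 2"
            using vM0 True k pk by (intro mult_left_mono) auto
          also have "\<dots> = f1 d" using True k pk unfolding f1_def by simp
          finally show ?thesis using f0[of d] by linarith
        next
          case False
          hence "roots8 d = {}" using roots8_pow2[of k] pk True by simp
          hence "lat_count R d = 0" unfolding lat_count_def by simp
          thus ?thesis using f0[of d] by simp
        qed
      next
        case False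
        hence odd: "odd p" using pk(1) primes_dvd_imp_eq[OF two_is_prime_nat pk(1)] by auto
        show ?thesis
        proof (cases "roots8 d = {}")
          case True
          hence "lat_count R d = 0" unfolding lat_count_def by simp
          thus ?thesis using f0[of d] by simp
        next
          case ne: False
          have d8: "d mod 8 = 1" using roots8_mod_8[OF pk(1) odd pk(2)] ne pk(3) by simp
          consider "d \<le> R" | "d > R" "\<not> prime d" | "d > R" "prime d" by linarith
          thus ?thesis
          proof cases
            case 1
            have "lat_count R d \<le> 4 * (real R * (real R / real d + 1))"
              unfolding pk(3) using d pk(3) by (intro lat_count_le_of_bound[OF pk(1) odd] lat_box_rows) auto
            hence "vM d * lat_count R d \<le> vM d * (4 * (real R * (real R / real d + 1)))"
              using vM0 by (intro mult_left_mono) auto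
            also have "\<dots> = f2 d" unfolding f2_def using 1 d8
              by (simp add: algebra_simps power2_eq_square)
            finally show ?thesis using f0[of d] by linarith
          next
            case 2
            have sd: "sqrt (sqrt (real d)) > 0" using d by simp
            have "lat_count R d \<le> 4 * (2 * real R ^ 2 / real d + 4 * real R / (sqrt (sqrt (real d)) / 2))"
              unfolding pk(3)
            proof (rule lat_count_le_of_bound[OF pk(1) odd], goal_cases)
              case (2 z)
              have z: "z \<in> roots8 d" using 2 unfolding pk(3) .
              show ?case unfolding pk(3)[symmetric]
                by (rule lat_box_count[OF d _ lat_min_quartic[OF d z]]) (use sd in simp_all)
            qed simp
            hence "vM d * lat_count R d
              \<le> vM d * (4 * (2 * real R ^ 2 / real d + 4 * real R / (sqrt (sqrt (real d)) / 2)))"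
              using vM0 by (intro mult_left_mono) auto
            also have "\<dots> = f5 d" unfolding f5_def using 2 by (simp add: algebra_simps)
            finally show ?thesis using f0[of d] by linarith
          next
            case 3
            have Hd: "real d / real C \<le> (real_of_int (max \<bar>t\<bar> \<bar>u\<bar>))^2"
              if "z \<in> roots8 d" "(t,u) \<in> lat d z" "(t,u) \<noteq> (0,0)" for z t u
            proof -
              have "int d dvd t ^ 4 + u ^ 4" using lat_dvd[OF _ that(2)] that(1) unfolding roots8_def by simp
              hence "int d < int C * (max \<bar>t\<bar> \<bar>u\<bar>)^2" using H[of d t u] 3 that by blast
              hence "real_of_int (int d) < real_of_int (int C * (max \<bar>t\<bar> \<bar>u\<bar>)^2)" by (simp only: of_int_less_iff)
              thus ?thesis using C by (simp add: divide_le_eq mult.commute)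
            qed
            show ?thesis
            proof (cases "d \<le> Y")
              case True
              define l where "l = sqrt (real d) / sqrt (real C)"
              have l: "l > 0" unfolding l_def using d C by simp
              have "lat_count R d \<le> 4 * (2 * real R ^ 2 / real d + 4 * real R / l)"
                unfolding pk(3)
              proof (rule lat_count_le_of_bound[OF pk(1) odd], goal_cases)
                case (2 z)
                have "l \<le> real_of_int (max \<bar>t\<bar> \<bar>u\<bar>)" if "(t,u) \<in> lat d z" "(t,u) \<noteq> (0,0)" for t u
                proof -
                  have "l = sqrt (real d / real C)" unfolding l_def by (simp add: real_sqrt_divide)
                  also have "\<dots> \<le> real_of_int (max \<bar>t\<bar> \<bar>u\<bar>)"
                    by (rule real_le_lsqrt[OF _ Hd[OF _ that]]) (use 2 pk(3) in \<open>auto simp: le_max_iff_disj\<close>)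
                  finally show ?thesis .
                qed
                thus ?case unfolding pk(3)[symmetric] by (rule lat_box_count[OF d l])
              qed (use l in simp)
              hence "vM d * lat_count R d \<le> vM d * (4 * (2 * real R ^ 2 / real d + 4 * real R / l))"
                using vM0 by (intro mult_left_mono) auto
              also have "\<dots> = f3 d + f4 d" unfolding f3_def f4_def l_def using 3 True d8
                by (simp add: algebra_simps)
              finally show ?thesis using f0[of d] by linarith
            next
              case False
              \<comment> \<open>A point of the box has maximum norm at most \<open>R\<close>, so a
                prime above C R^2 dividing its value would already prove the claim.\<close>
              have "lat d z \<inter> box R = {}" if z: "z \<in> roots8 d" for z
              proof (rule ccontr)
                assume "lat d z \<inter> box R \<noteq> {}"
                then obtain t u where tu: "(t,u) \<in> lat d z" "(t,u) \<in> box R" by auto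
                have b: "1 \<le> t" "t \<le> int R" "1 \<le> u" "u \<le> int R" using tu(2) unfolding box_def by auto
                have "real d / real C \<le> (real_of_int (max \<bar>t\<bar> \<bar>u\<bar>))^2"
                  by (rule Hd[OF z tu(1)]) (use b in auto)
                also have "\<dots> \<le> real R ^ 2" using b by (intro power_mono) auto
                finally have "real d \<le> real Y" unfolding Y_def using C by (simp add: divide_le_eq mult.commute)
                thus False using False by simp
              qed
              hence "lat_count R d = 0" unfolding lat_count_def by simp
              thus ?thesis using f0[of d] by simp
            qed
          qed
        qed
      qed
    qed (use f0 in simp)
    have s1: "(\<Sum>d=1..X. f1 d) \<le> real R ^ 2"
    proof -
      have "(\<Sum>d=1..X. f1 d) = (\<Sum>d\<in>{1..X} \<inter> {2}. f1 d)"
        by (rule sum.mono_neutral_right) (auto simp: f1_def)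
      also have "\<dots> \<le> (\<Sum>d\<in>{2}. f1 d)" by (rule sum_mono2) (use f0 in auto)
      also have "\<dots> = vM 2 * real R ^ 2" unfolding f1_def by simp
      also have "\<dots> \<le> 1 * real R ^ 2" using ln_2_less_1 by (intro mult_right_mono) auto
      finally show ?thesis by simp
    qed
    have s2: "(\<Sum>d=1..X. f2 d) \<le> real R ^ 2 * S R + 16 * real R ^ 2"
    proof -
      have "(\<Sum>d=1..X. f2 d) \<le> (\<Sum>d\<in>{1..X} \<union> {1..R}. f2 d)" by (rule sum_mono2) (use f0 in auto)
      also have "\<dots> = (\<Sum>d\<in>{d\<in>{1..R}. d mod 8 = 1}. f2 d)"
        by (rule sum.mono_neutral_right) (auto simp: f2_def)
      also have "\<dots> = (\<Sum>d\<in>{d\<in>{1..R}. d mod 8 = 1}. real R ^ 2 * (4 * vM d / real d) + 4 * real R * vM d)"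
        by (rule sum.cong) (auto simp: f2_def algebra_simps)
      also have "\<dots> = real R ^ 2 * S R + 4 * real R * (\<Sum>d\<in>{d\<in>{1..R}. d mod 8 = 1}. vM d)"
        unfolding S_def sum.distrib sum_distrib_left ..
      also have "(\<Sum>d\<in>{d\<in>{1..R}. d mod 8 = 1}. vM d) \<le> psi R"
        unfolding psi_def by (rule sum_mono2) (auto simp: mangoldt_nonneg)
      also have "psi R \<le> 4 * real R" by (rule psi_le)
      finally show ?thesis by (simp add: power2_eq_square mult_left_mono)
    qed
    have s3: "(\<Sum>d=1..X. f3 d) \<le> 2 * real R ^ 2 * (S Y - S R)"
    proof -
      have "(\<Sum>d=1..X. f3 d) \<le> (\<Sum>d\<in>{1..X} \<union> {1..Y}. f3 d)" by (rule sum_mono2) (use f0 in auto)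
      also have "\<dots> = (\<Sum>d\<in>{d\<in>{1..Y}. d mod 8 = 1} - {d\<in>{1..R}. d mod 8 = 1}. f3 d)"
        by (rule sum.mono_neutral_right) (auto simp: f3_def)
      also have "\<dots> = (\<Sum>d\<in>{d\<in>{1..Y}. d mod 8 = 1} - {d\<in>{1..R}. d mod 8 = 1}. 2 * real R ^ 2 * (4 * vM d / real d))"
        by (rule sum.cong) (auto simp: f3_def)
      also have "\<dots> = 2 * real R ^ 2 * (\<Sum>d\<in>{d\<in>{1..Y}. d mod 8 = 1} - {d\<in>{1..R}. d mod 8 = 1}. 4 * vM d / real d)"
        by (rule sum_distrib_left[symmetric])
      also have "(\<Sum>d\<in>{d\<in>{1..Y}. d mod 8 = 1} - {d\<in>{1..R}. d mod 8 = 1}. 4 * vM d / real d) = S Y - S R"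
        unfolding S_def by (rule sum_diff) (use RY in auto)
      finally show ?thesis .
    qed
    have s4: "(\<Sum>d=1..X. f4 d) \<le> 336 * real C * real R ^ 2"
    proof -
      have "(\<Sum>d=1..X. f4 d) \<le> (\<Sum>d\<in>{1..X} \<union> {1..Y}. f4 d)" by (rule sum_mono2) (use f0 in auto)
      also have "\<dots> = (\<Sum>d=1..Y. f4 d)" by (rule sum.mono_neutral_right) (auto simp: f4_def)
      also have "\<dots> = (\<Sum>d=1..Y. 16 * real R * sqrt (real C) * (vM d / sqrt (real d)))"
        by (rule sum.cong) (auto simp: f4_def)
      also have "\<dots> = 16 * real R * sqrt (real C) * (\<Sum>d=1..Y. vM d / sqrt (real d))"
        by (rule sum_distrib_left[symmetric])
      also have "\<dots> \<le> 16 * real R * sqrt (real C) * (21 * sqrt (real Y))"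
        by (intro mult_left_mono mangoldt_sum_sqrt) auto
      also have "sqrt (real Y) = sqrt (real C) * real R" unfolding Y_def by (simp add: real_sqrt_mult)
      also have "16 * real R * sqrt (real C) * (21 * (sqrt (real C) * real R))
          = 336 * (sqrt (real C) * sqrt (real C)) * real R ^ 2" by (simp add: power2_eq_square)
      also have "sqrt (real C) * sqrt (real C) = real C" by simp
      finally show ?thesis .
    qed
    have s5: "(\<Sum>d=1..X. f5 d) \<le> 3200 * real R ^ 2"
    proof -
      define g where "g d = 8 * real R ^ 2 / real d + 32 * real R / sqrt (sqrt (real d))" for d :: nat
      have "(\<Sum>d=1..X. f5 d) = (\<Sum>d\<in>{d\<in>{1..X}. \<not> prime d}. vM d * g d)"
        unfolding f5_def g_def by (rule sum.inter_filter[symmetric]) simp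
      also have "\<dots> \<le> 2 * (\<Sum>s=1..2*R^2. vM s * g (s^2))"
      proof (rule nonprime_primepow_sum)
        show "g d \<ge> 0" for d unfolding g_def by simp
        show "g e \<le> g d" if "0 < d" "d \<le> e" for d e
          unfolding g_def using that by (intro add_mono divide_left_mono) auto
        show "X \<le> (2 * R ^ 2) ^ 2" unfolding X_def by (simp add: power_mult_distrib flip: power_mult)
      qed
      also have "(\<Sum>s=1..2*R^2. vM s * g (s^2))
          = (\<Sum>s=1..2*R^2. 8 * real R ^ 2 * (vM s / real s ^ 2) + 32 * real R * (vM s / sqrt (real s)))"
        unfolding g_def by (rule sum.cong) (auto simp: algebra_simps)
      also have "\<dots> = 8 * real R ^ 2 * (\<Sum>s=1..2*R^2. vM s / real s ^ 2) + 32 * real R * (\<Sum>s=1..2*R^2. vM s / sqrt (real s))"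
        unfolding sum.distrib sum_distrib_left ..
      also have "(\<Sum>s=1..2*R^2. vM s / real s ^ 2) \<le> 32 - 32 / real (2*R^2)" by (rule mangoldt_sum_sq) (use R in simp)
      also have "\<dots> \<le> 32" by simp
      also have "(\<Sum>s=1..2*R^2. vM s / sqrt (real s)) \<le> 21 * sqrt (real (2*R^2))" by (rule mangoldt_sum_sqrt)
      also have "sqrt (real (2*R^2)) = sqrt 2 * real R" by (simp add: real_sqrt_mult)
      also have "sqrt 2 \<le> (3/2::real)" by (rule real_le_lsqrt) (auto simp: power2_eq_square)
      finally have "(\<Sum>d=1..X. f5 d) \<le> 2 * (8 * real R ^ 2 * 32 + 32 * real R * (21 * (3/2 * real R)))"
        by (simp add: mult_left_mono mult_right_mono)
      also have "\<dots> = 2528 * real R ^ 2" by (simp add: power2_eq_square)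
      also have "\<dots> \<le> 3200 * real R ^ 2" by (intro mult_right_mono) auto
      finally show ?thesis .
    qed
    have Sb: "S R \<ge> ln (real R) - K" "S Y \<le> ln (real C) + 2 * ln (real R) + K"
    proof -
      show "S R \<ge> ln (real R) - K" using K[OF R] unfolding S_def by linarith
      have "Y > 0" using RY R by simp
      hence "S Y \<le> ln (real Y) + K" using K[of Y] unfolding S_def by linarith
      also have "ln (real Y) = ln (real C) + 2 * ln (real R)"
        unfolding Y_def using C R by (simp add: ln_mult ln_realpow)
      finally show "S Y \<le> ln (real C) + 2 * ln (real R) + K" by simp
    qed
    have "4 * real R ^ 2 * (ln (real R) - 1) \<le> 128 * real R ^ 2 + (\<Sum>d=1..X. vM d * lat_count R d)"
      using sum_ln_box_ge[OF R] sum_ln_box_le[of R] unfolding X_def by linarith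
    also have "(\<Sum>d=1..X. vM d * lat_count R d) \<le> (\<Sum>d=1..X. f1 d + f2 d + f3 d + f4 d + f5 d)"
      by (rule sum_mono) (rule pointwise)
    also have "\<dots> = (\<Sum>d=1..X. f1 d) + (\<Sum>d=1..X. f2 d) + (\<Sum>d=1..X. f3 d) + (\<Sum>d=1..X. f4 d) + (\<Sum>d=1..X. f5 d)"
      by (simp only: sum.distrib)
    finally have "4 * real R ^ 2 * (ln (real R) - 1) \<le> 128 * real R ^ 2 + (real R ^ 2
       + (real R ^ 2 * S R + 16 * real R ^ 2) + 2 * real R ^ 2 * (S Y - S R) + 336 * real C * real R ^ 2 + 3200 * real R ^ 2)"
      using s1 s2 s3 s4 s5 by linarith
    also have "\<dots> = real R ^ 2 * (128 + 1 + 16 + 336 * real C + 3200 + 2 * S Y - S R)" by (simp add: algebra_simps)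
    \<comment> \<open>2 S(Y) - S(R) is at most 2 (ln C + 2 ln R + K) - (ln R - K), which carries the
      decisive coefficient 3 of ln R.\<close>
    also have "\<dots> \<le> real R ^ 2 * (A + 3 * ln (real R))"
      using Sb unfolding A_def by (intro mult_left_mono) auto
    also have "4 * real R ^ 2 * (ln (real R) - 1) = real R ^ 2 * (4 * (ln (real R) - 1))" by simp
    finally have "real R ^ 2 * (4 * (ln (real R) - 1)) \<le> real R ^ 2 * (A + 3 * ln (real R))" .
    hence "4 * (ln (real R) - 1) \<le> A + 3 * ln (real R)" using R by (simp add: mult_le_cancel_left_pos)
    thus ?thesis by simp
  qed
  define R where "R = nat \<lceil>exp (A + 5)\<rceil>"
  have "exp (A + 5) \<le> real R" unfolding R_def by (rule real_nat_ceiling_ge)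
  moreover have "exp (A + 5) > 0" by simp
  ultimately have R: "real R > 0" "A + 5 \<le> ln (real R)" by (linarith, subst ln_ge_iff, linarith+)
  thus False using main[of R] by simp
qed

subsection \<open>Five integral points on the curve \<open>\<phi>(x) = \<gamma>(y)\<close>\<close>

text \<open>Monic, because the restriction of a form to a line v1 + x v0 will be divided by its
  value at v0.\<close>

definition quartic :: "real \<Rightarrow> real \<Rightarrow> real \<Rightarrow> real \<Rightarrow> real \<Rightarrow> real" where
  "quartic c1 c2 c3 c4 x = x^4 + c1 * x^3 + c2 * x^2 + c3 * x + c4"

definition quartic_deriv :: "real \<Rightarrow> real \<Rightarrow> real \<Rightarrow> real \<Rightarrow> real" where
  "quartic_deriv c1 c2 c3 x = 4 * x^3 + 3 * c1 * x^2 + 2 * c2 * x + c3"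

text \<open>Divided differences of \<open>quartic\<close> with two nodes and, in
  \<open>divdiff3\<close>, with three. As polynomials they allow coinciding nodes, and their size
  can be read off. The constant term drops out of both, the linear coefficient out of the
  second.\<close>

definition divdiff2 :: "real \<Rightarrow> real \<Rightarrow> real \<Rightarrow> real \<Rightarrow> real \<Rightarrow> real" where
  "divdiff2 c1 c2 c3 x y = (x^3 + x^2*y + x*y^2 + y^3) + c1 * (x^2 + x*y + y^2) + c2 * (x + y) + c3"

definition divdiff3 :: "real \<Rightarrow> real \<Rightarrow> real \<Rightarrow> real \<Rightarrow> real \<Rightarrow> real" where
  "divdiff3 c1 c2 x y z = (x^2 + y^2 + z^2 + x*y + y*z + z*x) + c1 * (x + y + z) + c2"

lemma quartic_diff: "quartic c1 c2 c3 c4 y - quartic c1 c2 c3 c4 x = (y - x) * divdiff2 c1 c2 c3 x y"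
  unfolding quartic_def divdiff2_def
  by (simp add: algebra_simps power2_eq_square power3_eq_cube power4_eq_xxxx)

lemma divdiff2_diff: "divdiff2 c1 c2 c3 x y - divdiff2 c1 c2 c3 y z = (x - z) * divdiff3 c1 c2 x y z"
  unfolding divdiff2_def divdiff3_def
  by (simp add: algebra_simps power2_eq_square power3_eq_cube power4_eq_xxxx)

text \<open>Three points of the curve \<open>\<phi>(x) = \<gamma>(y)\<close>: the determinant measuring their non-collinearity
  is a second-order quantity.\<close>

lemma curve_det:
  assumes e1: "quartic c1 c2 c3 c4 x1 = quartic d1 d2 d3 d4 y1"
    and e2: "quartic c1 c2 c3 c4 x2 = quartic d1 d2 d3 d4 y2"
    and e3: "quartic c1 c2 c3 c4 x3 = quartic d1 d2 d3 d4 y3"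
  shows "((x3 - x2) * (y2 - y1) - (x2 - x1) * (y3 - y2)) * divdiff2 c1 c2 c3 x1 x2
    = (y2 - y1) * ((x3 - x2) * (x1 - x3) * divdiff3 c1 c2 x1 x2 x3 - (y3 - y2) * (y1 - y3) * divdiff3 d1 d2 y1 y2 y3)"
proof -
  define p q r s where "p = divdiff2 c1 c2 c3 x1 x2" and "q = divdiff2 d1 d2 d3 y1 y2"
    and "r = divdiff2 c1 c2 c3 x2 x3" and "s = divdiff2 d1 d2 d3 y2 y3"
  have 1: "(x2 - x1) * p = (y2 - y1) * q"
    unfolding p_def q_def
    using quartic_diff[of c1 c2 c3 c4 x2 x1] quartic_diff[of d1 d2 d3 d4 y2 y1] e1 e2 by linarith
  have 2: "(x3 - x2) * r = (y3 - y2) * s"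
    unfolding r_def s_def
    using quartic_diff[of c1 c2 c3 c4 x3 x2] quartic_diff[of d1 d2 d3 d4 y3 y2] e2 e3 by linarith
  have 3: "p - r = (x1 - x3) * divdiff3 c1 c2 x1 x2 x3" unfolding p_def r_def by (rule divdiff2_diff)
  have 4: "q - s = (y1 - y3) * divdiff3 d1 d2 y1 y2 y3" unfolding q_def s_def by (rule divdiff2_diff)
  have "((x3 - x2) * (y2 - y1) - (x2 - x1) * (y3 - y2)) * p
      = (x3 - x2) * (y2 - y1) * p - (y3 - y2) * ((x2 - x1) * p)"
    by (simp add: algebra_simps)
  also have "\<dots> = (y2 - y1) * ((x3 - x2) * (p - r) - (y3 - y2) * (q - s)) + (y2 - y1) * ((x3 - x2) * r - (y3 - y2) * s)"
    unfolding 1 by (simp add: algebra_simps)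
  also have "\<dots> = (y2 - y1) * ((x3 - x2) * (p - r) - (y3 - y2) * (q - s))"
    unfolding 2 by simp
  finally show ?thesis unfolding 3 4 unfolding p_def by (simp only: mult.assoc)
qed

text \<open>Collinear points lie on one line y = r x + s, so two polynomials of degree at most 4 in
  x agree at five places and are equal. Leading coefficients give r^4 = 1, and \<open>s\<close> is
  integral because the line passes through an integral point with slope 1 or -1.\<close>

lemma quartic_eq_of_five_points:
  fixes f :: "int \<Rightarrow> int"
  assumes T: "finite T" "card T \<ge> 5"
    and on: "\<And>a. a \<in> T \<Longrightarrow> quartic c1 c2 c3 c4 (real_of_int a) = quartic d1 d2 d3 d4 (real_of_int (f a))"
    and col: "\<And>x y z. x \<in> T \<Longrightarrow> y \<in> T \<Longrightarrow> z \<in> T \<Longrightarrow> (z - y) * (f y - f x) = (y - x) * (f z - f y)"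
  shows "\<exists>r s::int. (r = 1 \<or> r = -1) \<and> (\<forall>x. quartic c1 c2 c3 c4 x = quartic d1 d2 d3 d4 (real_of_int r * x + real_of_int s))"
proof -
  have "T \<noteq> {}" using T by auto
  then obtain a1 where a1: "a1 \<in> T" by blast
  have "T \<noteq> {a1}" using T by auto
  then obtain a2 where a2: "a2 \<in> T" "a2 \<noteq> a1" using a1 by blast
  define r where "r = real_of_int (f a2 - f a1) / real_of_int (a2 - a1)"
  define s where "s = real_of_int (f a1) - r * real_of_int a1"
  have ne: "real_of_int (a2 - a1) \<noteq> 0" using a2(2) by simp
  have line: "real_of_int (f a) = r * real_of_int a + s" if "a \<in> T" for a
  proof -
    have "(a2 - a) * (f a - f a1) = (a - a1) * (f a2 - f a)" by (rule col[OF a1 that a2(1)])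
    hence "(f a - f a1) * (a2 - a1) = (a - a1) * (f a2 - f a1)" by (simp add: algebra_simps)
    hence "real_of_int ((f a - f a1) * (a2 - a1)) = real_of_int ((a - a1) * (f a2 - f a1))" by (simp only:)
    hence e: "real_of_int (f a - f a1) * real_of_int (a2 - a1) = real_of_int (a - a1) * real_of_int (f a2 - f a1)"
      by (simp only: of_int_mult)
    have "real_of_int (f a - f a1) = real_of_int (a - a1) * r"
      unfolding r_def using e ne by (simp add: eq_divide_eq del: of_int_diff)
    thus ?thesis unfolding s_def by (simp add: algebra_simps)
  qed
  define P where "P = [:c4, c3, c2, c1, 1:]"
  define Q where "Q = pcompose [:d4, d3, d2, d1, 1:] [:s, r:]"
  have evP: "poly P x = quartic c1 c2 c3 c4 x" for x
    unfolding P_def quartic_def by (simp add: algebra_simps power4_eq_xxxx power3_eq_cube power2_eq_square)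
  have evQ: "poly Q x = quartic d1 d2 d3 d4 (r * x + s)" for x
    unfolding Q_def poly_pcompose quartic_def by (simp add: algebra_simps power4_eq_xxxx power3_eq_cube power2_eq_square)
  have dP: "degree P = 4" unfolding P_def by simp
  have dQ: "degree Q \<le> 4"
  proof -
    have "degree [:s, r:] \<le> 1" by (simp add: degree_pCons_le[THEN order.trans])
    moreover have "degree Q = 4 * degree [:s, r:]" unfolding Q_def degree_pcompose by simp
    ultimately show ?thesis by simp
  qed
  have PQ: "P = Q"
  proof (rule ccontr)
    assume "P \<noteq> Q"
    hence nz: "P - Q \<noteq> 0" by simp
    have "card (real_of_int ` T) \<le> card {x. poly (P - Q) x = 0}"
      by (rule card_mono[OF poly_roots_finite[OF nz]]) (use on line in \<open>auto simp: evP evQ\<close>)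
    also have "\<dots> \<le> degree (P - Q)" by (rule card_poly_roots_bound[OF nz])
    also have "\<dots> \<le> 4" using dP dQ by (intro degree_diff_le) auto
    finally show False using T by (simp add: card_image inj_on_def)
  qed
  have r0: "r \<noteq> 0"
  proof
    assume "r = 0"
    hence "degree Q = 0" unfolding Q_def degree_pcompose by simp
    thus False using dP PQ by simp
  qed
  have "lead_coeff P = lead_coeff Q" using PQ by simp
  moreover have "lead_coeff P = 1" unfolding P_def by simp
  moreover have "lead_coeff Q = r ^ 4"
  proof -
    have "degree [:s, r:] > 0" using r0 by simp
    from lead_coeff_comp[OF this, of "[:d4, d3, d2, d1, 1:]"] show ?thesis unfolding Q_def using r0
      by (simp add: power4_eq_xxxx mult.assoc)
  qed
  ultimately have "r ^ 4 = 1" by simp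
  hence "\<bar>r\<bar> ^ 4 = 1 ^ 4" by simp
  hence "\<bar>r\<bar> = 1" by (subst (asm) power_eq_iff_eq_base) auto
  hence r1: "r = 1 \<or> r = -1" by linarith
  define ri where "ri = (if r = 1 then 1 else -1 :: int)"
  have ri: "real_of_int ri = r" "ri = 1 \<or> ri = -1" unfolding ri_def using r1 by auto
  define si where "si = f a1 - ri * a1"
  have si: "real_of_int si = s" unfolding si_def s_def by (simp add: ri(1))
  have "quartic c1 c2 c3 c4 x = quartic d1 d2 d3 d4 (real_of_int ri * x + real_of_int si)" for x
    unfolding ri(1) si evP[symmetric] evQ[symmetric] PQ ..
  thus ?thesis using ri(2) by blast
qed

text \<open>With L = A k, each of the four cubic monomials lies between L^3 and 8 L^3, and
  \<open>A = 12 * M\<close> makes each of the three lower-order terms at most L^3. This gives 4 - 3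
  = 1 below and 32 + 3 = 35 above.\<close>

lemma divdiff2_bounds:
  fixes M k x y :: real
  assumes M: "M \<ge> 1" and k: "k > 0" and A: "A = 12 * M"
    and c: "\<bar>c1\<bar> \<le> M * k" "\<bar>c2\<bar> \<le> M * k^2" "\<bar>c3\<bar> \<le> M * k^3"
    and x: "A * k \<le> x" "x \<le> 2 * A * k" and y: "A * k \<le> y" "y \<le> 2 * A * k"
  shows "k^3 \<le> divdiff2 c1 c2 c3 x y" "divdiff2 c1 c2 c3 x y \<le> 35 * A^3 * k^3"
proof -
  define L where "L = A * k"
  have A12: "A \<ge> 12" "M = A / 12" using M A by auto
  have L0: "L > 0" unfolding L_def using A12 k by simp
  have xL: "L \<le> x" "x \<le> 2 * L" "L \<le> y" "y \<le> 2 * L" using x y unfolding L_def by auto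
  have kL: "k \<le> L / 12" unfolding L_def using A12 k by simp
  have Mk: "M * k = L / 12" unfolding L_def A12(2) by simp
  have 2: "L^2 \<le> x^2" "x^2 \<le> 4 * L^2" "L^2 \<le> x*y" "x*y \<le> 4 * L^2" "L^2 \<le> y^2" "y^2 \<le> 4*L^2"
    using xL L0 power_mono[of L x 2] power_mono[of x "2*L" 2] power_mono[of L y 2] power_mono[of y "2*L" 2]
      mult_mono[of L x L y] mult_mono[of x "2*L" y "2*L"] by (auto simp: power2_eq_square)
  have 3: "L^3 \<le> x^3" "x^3 \<le> 8 * L^3" "L^3 \<le> y^3" "y^3 \<le> 8 * L^3"
    using xL L0 power_mono[of L x 3] power_mono[of x "2*L" 3] power_mono[of L y 3] power_mono[of y "2*L" 3]
    by (auto simp: power_mult_distrib)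
  have 4: "L^3 \<le> x^2*y" "x^2*y \<le> 8 * L^3" "L^3 \<le> x*y^2" "x*y^2 \<le> 8 * L^3"
    using mult_mono[of "L^2" "x^2" L y] mult_mono[of "x^2" "4*L^2" y "2*L"]
      mult_mono[of L x "L^2" "y^2"] mult_mono[of x "2*L" "y^2" "4*L^2"] 2 xL L0
    by (auto simp: power2_eq_square power3_eq_cube mult_ac)
  have b1: "\<bar>c1 * (x^2 + x*y + y^2)\<bar> \<le> L^3"
  proof -
    have "\<bar>c1 * (x^2 + x*y + y^2)\<bar> \<le> (L/12) * (12 * L^2)"
      unfolding abs_mult using c(1) 2 Mk L0 by (intro mult_mono) auto
    thus ?thesis by (simp add: power2_eq_square power3_eq_cube)
  qed
  have b2: "\<bar>c2 * (x + y)\<bar> \<le> L^3"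
  proof -
    have "M * k^2 = (L/12) * k" using Mk by (simp add: power2_eq_square)
    also have "\<dots> \<le> (L/12) * (L/12)" using kL L0 by (intro mult_left_mono) auto
    finally have "\<bar>c2\<bar> \<le> (L/12) * (L/12)" using c(2) by linarith
    hence "\<bar>c2 * (x + y)\<bar> \<le> (L/12 * (L/12)) * (4 * L)"
      unfolding abs_mult using xL L0 by (intro mult_mono) auto
    also have "\<dots> \<le> L^3" using L0 by (simp add: power3_eq_cube)
    finally show ?thesis .
  qed
  have b3: "\<bar>c3\<bar> \<le> L^3"
  proof -
    have "M * k^3 = (L/12) * k^2" using Mk by (simp add: power2_eq_square power3_eq_cube)
    also have "\<dots> \<le> (L/12) * (L/12)^2" using kL L0 k by (intro mult_left_mono power_mono) auto
    also have "\<dots> \<le> L^3" using L0 by (simp add: power3_eq_cube power2_eq_square)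
    finally show ?thesis using c(3) by linarith
  qed
  have "L^3 \<le> divdiff2 c1 c2 c3 x y" unfolding divdiff2_def using 3 4 b1 b2 b3 by linarith
  moreover have "k^3 \<le> L^3" using kL L0 k by (intro power_mono) auto
  ultimately show "k^3 \<le> divdiff2 c1 c2 c3 x y" by linarith
  have "divdiff2 c1 c2 c3 x y \<le> 35 * L^3" unfolding divdiff2_def using 3 4 b1 b2 b3 by linarith
  thus "divdiff2 c1 c2 c3 x y \<le> 35 * A^3 * k^3" unfolding L_def by (simp add: power_mult_distrib)
qed

text \<open>Ten summands after expansion, each at most (N k)^2.\<close>

lemma divdiff3_bound:
  fixes N k x y z :: real
  assumes N: "N \<ge> 1" and c: "\<bar>c1\<bar> \<le> N * k" "\<bar>c2\<bar> \<le> N * k^2" and k: "k > 0"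
    and b: "\<bar>x\<bar> \<le> N * k" "\<bar>y\<bar> \<le> N * k" "\<bar>z\<bar> \<le> N * k"
  shows "\<bar>divdiff3 c1 c2 x y z\<bar> \<le> 10 * N^2 * k^2"
proof -
  define L where "L = N * k"
  have L0: "L > 0" unfolding L_def using N k by simp
  have m: "u * v \<le> L^2 \<and> - (L^2) \<le> u * v" if "\<bar>u\<bar> \<le> L" "\<bar>v\<bar> \<le> L" for u v
  proof -
    have "\<bar>u * v\<bar> \<le> L^2"
      unfolding abs_mult power2_eq_square using that L0 by (intro mult_mono) auto
    thus ?thesis unfolding abs_le_iff by linarith
  qed
  have bL: "\<bar>x\<bar> \<le> L" "\<bar>y\<bar> \<le> L" "\<bar>z\<bar> \<le> L" "\<bar>c1\<bar> \<le> L" using b c unfolding L_def by auto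
  have "N * k^2 \<le> N^2 * k^2" using N by (intro mult_right_mono) (auto simp: power2_eq_square)
  hence c2: "c2 \<le> L^2" "- (L^2) \<le> c2" unfolding L_def power_mult_distrib using c(2) by linarith+
  have "divdiff3 c1 c2 x y z = x*x + y*y + z*z + x*y + y*z + z*x + c1*x + c1*y + c1*z + c2"
    unfolding divdiff3_def by (simp add: algebra_simps power2_eq_square)
  hence e: "divdiff3 c1 c2 x y z = x*x + y*y + z*z + x*y + y*z + z*x + c1*x + c1*y + c1*z + c2" .
  have "\<bar>divdiff3 c1 c2 x y z\<bar> \<le> 10 * L^2" unfolding e
    using m[OF bL(1) bL(1)] m[OF bL(2) bL(2)] m[OF bL(3) bL(3)] m[OF bL(1) bL(2)] m[OF bL(2) bL(3)]
      m[OF bL(3) bL(1)] m[OF bL(4) bL(1)] m[OF bL(4) bL(2)] m[OF bL(4) bL(3)] c2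
    by (intro abs_leI) linarith+
  thus ?thesis unfolding L_def by (simp add: power_mult_distrib)
qed

lemma pigeonhole_five:
  assumes S: "finite S" and T: "finite T" "f ` S \<subseteq> T" and card: "card S > 4 * card T"
  shows "\<exists>t\<in>T. card {s\<in>S. f s = t} \<ge> 5"
proof (rule ccontr)
  assume neg: "\<not> (\<exists>t\<in>T. card {s\<in>S. f s = t} \<ge> 5)"
  have "card S = (\<Sum>t\<in>f ` S. card {s\<in>S. f s = t})"
    unfolding card_eq_sum by (rule sum.image_gen[OF S])
  also have "\<dots> \<le> (\<Sum>t\<in>f ` S. 4)"
  proof (rule sum_mono)
    fix t assume "t \<in> f ` S"
    hence "t \<in> T" using T(2) by blast
    hence "\<not> card {s\<in>S. f s = t} \<ge> 5" using neg by blast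
    thus "card {s\<in>S. f s = t} \<le> 4" by linarith
  qed
  also have "\<dots> \<le> 4 * card T" using card_mono[OF T] by simp
  finally show False using card by simp
qed

text \<open>\<open>W\<close> exceeds by one the number 2B + 1 of curves. A window of
  \<open>K + 1\<close> integers has more than four times as many points as there are pairs of a
  curve and a sign of slope. \<open>c\<close> is the slope, in units of k^3, below which a point
  counts as flat; it is chosen so that flat points of one curve are within k / (2W) of each other.
  \<open>K2\<close> bounds the steps of \<open>z\<close> away from flat points, and \<open>V\<close>
  bounds k times the determinant of three points.\<close>

lemma quartic_curve_points:
  fixes M N k :: real and B :: nat and g1 g2 g3 g4 :: "int \<Rightarrow> real"
  defines "A \<equiv> 12 * M"
  defines "W \<equiv> 2 * B + 2"
  defines "K \<equiv> 8 * (2 * B + 1)"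
  defines "c \<equiv> 1 / (4 * N * real W)"
  defines "K2 \<equiv> real K * (35 * A ^ 3) / c"
  defines "V \<equiv> K2 * (real K ^ 2 * (10 * (24 * M)^2) + K2 ^ 2 * (10 * N ^ 2))"
  assumes M: "M \<ge> 1" and N: "N \<ge> 1"
    and k1: "k \<ge> 1" and kW: "k > 2 * real W * (real K + 1)" and kV: "k > V"
    and ph: "\<bar>c1\<bar> \<le> M * k" "\<bar>c2\<bar> \<le> M * k^2" "\<bar>c3\<bar> \<le> M * k^3"
    and ga: "\<And>b. \<bar>b\<bar> \<le> int B \<Longrightarrow> \<bar>g1 b\<bar> \<le> N * k" "\<And>b. \<bar>b\<bar> \<le> int B \<Longrightarrow> \<bar>g2 b\<bar> \<le> N * k^2"
    and conv: "\<And>b x y. quartic (g1 b) (g2 b) (g3 b) (g4 b) x + quartic_deriv (g1 b) (g2 b) (g3 b) x * (y - x)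
        \<le> quartic (g1 b) (g2 b) (g3 b) (g4 b) y"
    and sol: "\<And>a::int. A * k \<le> real_of_int a \<Longrightarrow> real_of_int a \<le> 2 * A * k \<Longrightarrow>
       \<exists>b z::int. \<bar>b\<bar> \<le> int B \<and> \<bar>real_of_int z\<bar> \<le> N * k \<and>
         quartic c1 c2 c3 c4 (real_of_int a) = quartic (g1 b) (g2 b) (g3 b) (g4 b) (real_of_int z)"
  shows "\<exists>b r s::int. (r = 1 \<or> r = -1) \<and>
    (\<forall>x. quartic c1 c2 c3 c4 x = quartic (g1 b) (g2 b) (g3 b) (g4 b) (real_of_int r * x + real_of_int s))"
proof -
  define \<phi> where "\<phi> = quartic c1 c2 c3 c4"
  define \<gamma> where "\<gamma> b = quartic (g1 b) (g2 b) (g3 b) (g4 b)" for b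
  define \<gamma>' where "\<gamma>' b = quartic_deriv (g1 b) (g2 b) (g3 b)" for b
  have W: "W > 0" "real W \<ge> 1" unfolding W_def by auto
  have A: "A \<ge> 12" unfolding A_def using M by simp
  have c0: "c > 0" unfolding c_def using N W by simp
  have K20: "K2 \<ge> 0" unfolding K2_def using c0 A by simp
  have V0: "V \<ge> 0" unfolding V_def using K20 by simp
  define dom where "dom a \<longleftrightarrow> A * k \<le> real_of_int a \<and> real_of_int a \<le> 2 * A * k" for a :: int
  have "\<forall>a. \<exists>b z. dom a \<longrightarrow> \<bar>b\<bar> \<le> int B \<and> \<bar>real_of_int z\<bar> \<le> N * k \<and> \<phi> (real_of_int a) = \<gamma> b (real_of_int z)"
    using sol unfolding dom_def \<phi>_def \<gamma>_def by blast
  then obtain be ze where bz: "\<And>a. dom a \<Longrightarrow> \<bar>be a\<bar> \<le> int B"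
     "\<And>a. dom a \<Longrightarrow> \<bar>real_of_int (ze a)\<bar> \<le> N * k"
     "\<And>a. dom a \<Longrightarrow> \<phi> (real_of_int a) = \<gamma> (be a) (real_of_int (ze a))"
    by metis
  have dd: "k^3 \<le> divdiff2 c1 c2 c3 (real_of_int x) (real_of_int y)"
    "divdiff2 c1 c2 c3 (real_of_int x) (real_of_int y) \<le> 35 * A^3 * k^3" if "dom x" "dom y" for x y
    using that divdiff2_bounds[OF M _ A_def[THEN meta_eq_to_obj_eq] ph] k1 unfolding dom_def by auto
  have k0: "k > 0" using k1 by simp
  have phi_low: "\<bar>real_of_int (x - y)\<bar> * k^3 \<le> \<bar>\<phi> (real_of_int x) - \<phi> (real_of_int y)\<bar>"
    and phi_up: "\<bar>\<phi> (real_of_int x) - \<phi> (real_of_int y)\<bar> \<le> \<bar>real_of_int (x - y)\<bar> * (35 * A^3 * k^3)"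
    if "dom x" "dom y" for x y
  proof -
    have e: "\<bar>\<phi> (real_of_int x) - \<phi> (real_of_int y)\<bar>
        = \<bar>real_of_int (x - y)\<bar> * divdiff2 c1 c2 c3 (real_of_int y) (real_of_int x)"
    proof -
      have "k^3 \<ge> 0" using k0 by simp
      hence "divdiff2 c1 c2 c3 (real_of_int y) (real_of_int x) \<ge> 0" using dd(1)[OF that(2,1)] by linarith
      thus ?thesis unfolding \<phi>_def quartic_diff by (simp add: abs_mult)
    qed
    show "\<bar>real_of_int (x - y)\<bar> * k^3 \<le> \<bar>\<phi> (real_of_int x) - \<phi> (real_of_int y)\<bar>"
      unfolding e by (intro mult_left_mono dd(1) that) auto
    show "\<bar>\<phi> (real_of_int x) - \<phi> (real_of_int y)\<bar> \<le> \<bar>real_of_int (x - y)\<bar> * (35 * A^3 * k^3)"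
      unfolding e by (intro mult_left_mono dd(2) that) auto
  qed
  \<comment> \<open>Distance between the starts of consecutive windows; the lower bound on
    \<open>k\<close> makes the gaps between windows exceed k / (2W).\<close>
  define st where "st = A * k / real W"
  have stW: "real W * st = A * k" unfolding st_def using W by simp
  have st0: "st \<ge> 0" unfolding st_def using A k0 by simp
  define w where "w j = \<lceil>A * k + real j * st\<rceil>" for j :: nat
  have step: "st > real K + 1" "st - real K - 1 > k / (2 * real W)"
  proof -
    have "real W * (real K + 1) \<ge> 0" using W by simp
    have 1: "k / (2 * real W) > real K + 1" using kW W by (simp add: pos_less_divide_eq mult_ac)
    have "12 * k \<le> A * k" using A k0 by (intro mult_right_mono) auto
    hence "12 * k / real W \<le> A * k / real W" using W by (intro divide_right_mono) auto
    moreover have "12 * k / real W = 24 * (k / (2 * real W))" by simp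
    ultimately show "st > real K + 1" "st - real K - 1 > k / (2 * real W)"
      unfolding st_def using 1 by linarith+
  qed
  define win where "win j = {w j..w j + int K}" for j
  have wdom: "dom a" if j: "j < W" and a: "a \<in> win j" for a j
  proof -
    have "A * k + real j * st \<le> real_of_int (w j)" unfolding w_def by linarith
    moreover have "real j * st \<ge> 0" using st0 by simp
    moreover have "real_of_int (w j) \<le> A * k + real j * st + 1" unfolding w_def by linarith
    moreover have "(real j + 1) * st \<le> real W * st"
      using j st0 by (intro mult_right_mono) auto
    moreover note stW
    moreover have "(real j + 1) * st = real j * st + st" by (simp only: distrib_right mult_1_left)
    moreover have "real_of_int (w j) \<le> real_of_int a" "real_of_int a \<le> real_of_int (w j) + real K"
      using a[unfolded win_def atLeastAtMost_iff, THEN conjunct1]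
        a[unfolded win_def atLeastAtMost_iff, THEN conjunct2] by linarith+
    ultimately have "A * k \<le> real_of_int a" "real_of_int a \<le> 2 * (A * k)" using step(1) by linarith+
    thus ?thesis unfolding dom_def by simp
  qed
  have sep: "\<bar>real_of_int (a - a')\<bar> > k / (2 * real W)"
    if j: "i < j" and a: "a \<in> win i" "a' \<in> win j" for a a' i j
  proof -
    have "real_of_int (w i) \<le> A * k + real i * st + 1" unfolding w_def by linarith
    moreover have "A * k + real j * st \<le> real_of_int (w j)" unfolding w_def by linarith
    moreover have "(real i + 1) * st \<le> real j * st"
      using j st0 by (intro mult_right_mono) auto
    moreover have "(real i + 1) * st = real i * st + st" by (simp only: distrib_right mult_1_left)
    moreover have "real_of_int a \<le> real_of_int (w i) + real K" "real_of_int (w j) \<le> real_of_int a'"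
      using a(2)[unfolded win_def atLeastAtMost_iff, THEN conjunct1]
        a(1)[unfolded win_def atLeastAtMost_iff, THEN conjunct2] by linarith+
    ultimately have "real_of_int a' - real_of_int a > k / (2 * real W)" using step(2) by linarith
    thus ?thesis by simp
  qed
  \<comment> \<open>At two flat points of one curve the tangent inequalities from convexity squeeze
    the difference of the \<gamma>-values, and \<phi>, which is steep on the whole domain, turns
    this into closeness of \<open>a\<close> and \<open>a'\<close>.\<close>
  have bad_close: "\<bar>real_of_int (a - a')\<bar> \<le> k / (2 * real W)"
    if d: "dom a" "dom a'" and b: "be a = be a'" and sm: "\<bar>\<gamma>' (be a) (real_of_int (ze a))\<bar> < c * k^3"
      "\<bar>\<gamma>' (be a') (real_of_int (ze a'))\<bar> < c * k^3" for a a'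
  proof -
    define z z' where "z = real_of_int (ze a)" and "z' = real_of_int (ze a')"
    have zd: "\<bar>z' - z\<bar> \<le> 2 * N * k" "\<bar>z - z'\<bar> \<le> 2 * N * k" using bz(2)[OF d(1)] bz(2)[OF d(2)] unfolding z_def z'_def by linarith+
    have bd: "\<bar>\<gamma>' (be a) z * (z' - z)\<bar> \<le> c * k^3 * (2 * N * k)"
      "\<bar>\<gamma>' (be a) z' * (z - z')\<bar> \<le> c * k^3 * (2 * N * k)"
      unfolding abs_mult using sm b zd c0 k0 unfolding z_def z'_def by (intro mult_mono; simp)+
    have "\<gamma> (be a) z + \<gamma>' (be a) z * (z' - z) \<le> \<gamma> (be a) z'" "\<gamma> (be a) z' + \<gamma>' (be a) z' * (z - z') \<le> \<gamma> (be a) z"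
      unfolding \<gamma>_def \<gamma>'_def by (rule conv)+
    with bd have "\<bar>\<gamma> (be a) z - \<gamma> (be a) z'\<bar> \<le> c * k^3 * (2 * N * k)" by linarith
    moreover have "\<phi> (real_of_int a) = \<gamma> (be a) z" "\<phi> (real_of_int a') = \<gamma> (be a) z'"
      using bz(3)[OF d(1)] bz(3)[OF d(2)] b unfolding z_def z'_def by simp_all
    ultimately have "\<bar>real_of_int (a - a')\<bar> * k^3 \<le> c * k^3 * (2 * N * k)" using phi_low[OF d] by simp
    also have "\<dots> = (2 * N * c * k) * k^3" by simp
    finally have "\<bar>real_of_int (a - a')\<bar> \<le> 2 * N * c * k" using k0 by (simp add: mult_le_cancel_right)
    also have "2 * N * c * k = k / (2 * real W)" unfolding c_def using N W by (simp add: field_simps)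
    finally show ?thesis .
  qed
  \<comment> \<open>Otherwise every window has a flat point; two of these 2B + 2 points share a
    curve, yet they are farther apart than \<open>bad_close\<close> allows.\<close>
  have "\<exists>j<W. \<forall>a\<in>win j. c * k^3 \<le> \<bar>\<gamma>' (be a) (real_of_int (ze a))\<bar>"
  proof (rule ccontr)
    assume "\<not> (\<exists>j<W. \<forall>a\<in>win j. c * k^3 \<le> \<bar>\<gamma>' (be a) (real_of_int (ze a))\<bar>)"
    hence "\<forall>j. \<exists>a. j < W \<longrightarrow> a \<in> win j \<and> \<bar>\<gamma>' (be a) (real_of_int (ze a))\<bar> < c * k^3"
      by (meson not_le)
    then obtain al where al: "\<And>j. j < W \<Longrightarrow> al j \<in> win j"
      "\<And>j. j < W \<Longrightarrow> \<bar>\<gamma>' (be (al j)) (real_of_int (ze (al j)))\<bar> < c * k^3" by metis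
    have ne: "be (al i) \<noteq> be (al j)" if "i < j" "j < W" for i j
    proof
      assume eq: "be (al i) = be (al j)"
      have i: "i < W" using that by simp
      have "\<bar>real_of_int (al i - al j)\<bar> \<le> k / (2 * real W)"
        by (rule bad_close[OF wdom[OF i al(1)[OF i]] wdom[OF that(2) al(1)[OF that(2)]] eq al(2)[OF i] al(2)[OF that(2)]])
      thus False using sep[OF that(1) al(1)[OF i] al(1)[OF that(2)]] by simp
    qed
    have "inj_on (\<lambda>j. be (al j)) {..<W}"
    proof (rule inj_onI)
      fix i j assume "i \<in> {..<W}" "j \<in> {..<W}" "be (al i) = be (al j)"
      thus "i = j" using ne[of i j] ne[of j i] by (cases i j rule: linorder_cases) auto
    qed
    moreover have "(\<lambda>j. be (al j)) ` {..<W} \<subseteq> {- int B..int B}"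
    proof
      fix b assume "b \<in> (\<lambda>j. be (al j)) ` {..<W}"
      then obtain j where j: "j < W" "b = be (al j)" by auto
      have "\<bar>b\<bar> \<le> int B" unfolding j(2) by (rule bz(1)[OF wdom[OF j(1) al(1)[OF j(1)]]])
      thus "b \<in> {- int B..int B}" by auto
    qed
    ultimately have "card {..<W} \<le> card {- int B..int B}" by (intro card_inj_on_le) auto
    thus False unfolding W_def by simp
  qed
  then obtain j where j: "j < W" and good: "\<And>a. a \<in> win j \<Longrightarrow> c * k^3 \<le> \<bar>\<gamma>' (be a) (real_of_int (ze a))\<bar>"
    by blast
  \<comment> \<open>The sign of the slope is recorded because, for two points of equal sign, at
    least one of the two tangent inequalities has a non-negative increment and so bounds a growth of
    \<gamma> from below.\<close>
  define cl where "cl a = (be a, \<gamma>' (be a) (real_of_int (ze a)) > 0)" for a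
  have wd: "dom a" if "a \<in> win j" for a by (rule wdom[OF j that])
  have "\<exists>t\<in>{- int B..int B} \<times> UNIV. card {a\<in>win j. cl a = t} \<ge> 5"
  proof (rule pigeonhole_five)
    show "cl ` win j \<subseteq> {- int B..int B} \<times> UNIV"
    proof
      fix t assume "t \<in> cl ` win j"
      then obtain a where a: "a \<in> win j" "t = cl a" by auto
      have "\<bar>be a\<bar> \<le> int B" by (rule bz(1)[OF wd[OF a(1)]])
      thus "t \<in> {- int B..int B} \<times> UNIV" unfolding a(2) cl_def by auto
    qed
    have "card (({- int B..int B} :: int set) \<times> (UNIV :: bool set)) = (2 * B + 1) * 2"
      by (simp add: card_cartesian_product)
    thus "4 * card (({- int B..int B} :: int set) \<times> (UNIV :: bool set)) < card (win j)"
      unfolding win_def K_def by simp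
  qed (auto simp: win_def)
  then obtain b \<sigma> where T5: "card {a\<in>win j. cl a = (b, \<sigma>)} \<ge> 5" by auto
  define T where "T = {a\<in>win j. cl a = (b, \<sigma>)}"
  have T: "dom a" "be a = b" "(\<gamma>' b (real_of_int (ze a)) > 0) = \<sigma>" "c * k^3 \<le> \<bar>\<gamma>' b (real_of_int (ze a))\<bar>"
    "\<bar>b\<bar> \<le> int B" "a \<in> win j" if "a \<in> T" for a
  proof -
    have 1: "a \<in> win j" "cl a = (b, \<sigma>)" using that unfolding T_def by auto
    show "dom a" by (rule wd[OF 1(1)])
    show b: "be a = b" using 1(2) unfolding cl_def by simp
    show "(\<gamma>' b (real_of_int (ze a)) > 0) = \<sigma>" using 1(2) b unfolding cl_def by simp
    show "c * k^3 \<le> \<bar>\<gamma>' b (real_of_int (ze a))\<bar>" using good[OF 1(1)] b by simp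
    show "\<bar>b\<bar> \<le> int B" using bz(1)[OF wd[OF 1(1)]] b by simp
    show "a \<in> win j" by (rule 1)
  qed
  have aK: "\<bar>real_of_int (x - y)\<bar> \<le> real K" if "x \<in> T" "y \<in> T" for x y
  proof -
    have "\<bar>x - y\<bar> \<le> int K" using T(6)[OF that(1)] T(6)[OF that(2)] unfolding win_def by auto
    thus ?thesis by linarith
  qed
  \<comment> \<open>\<phi> changes by O(k^3) within a window, while \<gamma> changes by at least c
    k^3 for each unit of \<open>z\<close>.\<close>
  have zK: "\<bar>real_of_int (ze x - ze y)\<bar> \<le> K2" if xy: "x \<in> T" "y \<in> T" for x y
  proof -
    define p q where "p = real_of_int (ze x)" and "q = real_of_int (ze y)"
    have "c * k^3 > 0" using c0 k0 by simp
    have cv: "\<gamma> b p + \<gamma>' b p * (q - p) \<le> \<gamma> b q" "\<gamma> b q + \<gamma>' b q * (p - q) \<le> \<gamma> b p"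
      unfolding \<gamma>_def \<gamma>'_def by (rule conv)+
    have low: "c * k^3 * \<bar>p - q\<bar> \<le> \<bar>\<gamma> b p - \<gamma> b q\<bar>"
    proof -
      have mono: "c * k^3 * \<bar>u\<bar> \<le> s * u" if "c * k^3 \<le> \<bar>s\<bar>" "s * u \<ge> 0" for s u
      proof -
        have "c * k^3 * \<bar>u\<bar> \<le> \<bar>s\<bar> * \<bar>u\<bar>" using that(1) by (rule mult_right_mono) simp
        also have "\<dots> = s * u" using that(2) by (simp flip: abs_mult)
        finally show ?thesis .
      qed
      have "\<gamma>' b p * (q - p) \<ge> 0 \<or> \<gamma>' b q * (p - q) \<ge> 0"
      proof (cases \<sigma>)
        case True
        hence "\<gamma>' b p > 0" "\<gamma>' b q > 0" using T(3)[OF xy(1)] T(3)[OF xy(2)] unfolding p_def q_def by auto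
        thus ?thesis by (cases "p \<le> q") auto
      next
        case False
        hence "\<gamma>' b p \<le> 0" "\<gamma>' b q \<le> 0" using T(3)[OF xy(1)] T(3)[OF xy(2)] unfolding p_def q_def by auto
        thus ?thesis by (cases "p \<le> q") (auto simp: mult_nonpos_nonpos)
      qed
      thus ?thesis
      proof
        assume "\<gamma>' b p * (q - p) \<ge> 0"
        from mono[OF T(4)[OF xy(1)], of "q - p"] this cv(1) show ?thesis
          unfolding p_def[symmetric] by (simp add: abs_minus_commute)
      next
        assume "\<gamma>' b q * (p - q) \<ge> 0"
        from mono[OF T(4)[OF xy(2)], of "p - q"] this cv(2) show ?thesis
          unfolding q_def[symmetric] by simp
      qed
    qed
    have "\<gamma> b p = \<phi> (real_of_int x)" "\<gamma> b q = \<phi> (real_of_int y)"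
      using bz(3)[OF T(1)[OF xy(1)]] bz(3)[OF T(1)[OF xy(2)]] T(2)[OF xy(1)] T(2)[OF xy(2)]
      unfolding p_def q_def by simp_all
    hence "c * k^3 * \<bar>p - q\<bar> \<le> \<bar>real_of_int (x - y)\<bar> * (35 * A^3 * k^3)"
      using low phi_up[OF T(1)[OF xy(1)] T(1)[OF xy(2)]] by simp
    also have "\<dots> \<le> real K * (35 * A^3 * k^3)" using A k0 by (intro mult_right_mono aK xy) auto
    finally have "(c * \<bar>p - q\<bar>) * k^3 \<le> (real K * (35 * A^3)) * k^3" by (simp add: mult_ac)
    hence "c * \<bar>p - q\<bar> \<le> real K * (35 * A^3)" using k0 by (simp add: mult_le_cancel_right)
    hence "\<bar>p - q\<bar> \<le> K2" unfolding K2_def using c0 by (simp add: pos_le_divide_eq mult.commute)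
    thus ?thesis unfolding p_def q_def by simp
  qed
  \<comment> \<open>In \<open>curve_det\<close> the factor \<open>P\<close> is at least k^3 whereas
    the second-order terms are O(k^2), so the integer \<open>D\<close> satisfies |D| k \<le> V < k
    and vanishes.\<close>
  have col: "(z - y) * (ze y - ze x) = (y - x) * (ze z - ze y)" if xyz: "x \<in> T" "y \<in> T" "z \<in> T" for x y z
  proof -
    define D where "D = (z - y) * (ze y - ze x) - (y - x) * (ze z - ze y)"
    define P where "P = divdiff2 c1 c2 c3 (real_of_int x) (real_of_int y)"
    define Q where "Q = divdiff3 c1 c2 (real_of_int x) (real_of_int y) (real_of_int z)"
    define R where "R = divdiff3 (g1 b) (g2 b) (real_of_int (ze x)) (real_of_int (ze y)) (real_of_int (ze z))"
    have on: "quartic c1 c2 c3 c4 (real_of_int a) = quartic (g1 b) (g2 b) (g3 b) (g4 b) (real_of_int (ze a))"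
      if "a \<in> T" for a
      using bz(3)[OF T(1)[OF that]] T(2)[OF that] unfolding \<phi>_def \<gamma>_def by simp
    have det: "real_of_int D * P = real_of_int (ze y - ze x) * (real_of_int (z - y) * real_of_int (x - z) * Q
        - real_of_int (ze z - ze y) * real_of_int (ze x - ze z) * R)"
      unfolding D_def P_def Q_def R_def
      using curve_det[OF on[OF xyz(1)] on[OF xyz(2)] on[OF xyz(3)]] by simp
    have Q: "\<bar>Q\<bar> \<le> 10 * (24 * M)^2 * k^2"
      unfolding Q_def
    proof (rule divdiff3_bound)
      show "1 \<le> 24 * M" "0 < k" using M k0 by auto
      have "M * k \<le> 24 * M * k" "M * k^2 \<le> 24 * M * k^2" using M k0 by (intro mult_right_mono; simp)+
      thus "\<bar>c1\<bar> \<le> 24 * M * k" "\<bar>c2\<bar> \<le> 24 * M * k^2" using ph by linarith+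
      have "\<bar>real_of_int a\<bar> \<le> 24 * M * k" if "dom a" for a
      proof -
        have "0 \<le> A * k" using A k0 by simp
        hence "0 \<le> real_of_int a" "real_of_int a \<le> 2 * A * k" using that unfolding dom_def by linarith+
        thus ?thesis unfolding A_def by simp
      qed
      thus "\<bar>real_of_int x\<bar> \<le> 24 * M * k" "\<bar>real_of_int y\<bar> \<le> 24 * M * k" "\<bar>real_of_int z\<bar> \<le> 24 * M * k"
        using T(1) xyz by blast+
    qed
    have R: "\<bar>R\<bar> \<le> 10 * N^2 * k^2"
      unfolding R_def by (rule divdiff3_bound[OF N ga(1)[OF T(5)[OF xyz(1)]] ga(2)[OF T(5)[OF xyz(1)]] k0])
        (intro bz(2) T(1) xyz)+
    have b1: "\<bar>real_of_int (z - y) * real_of_int (x - z) * Q\<bar> \<le> real K ^ 2 * (10 * (24 * M)^2) * k^2"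
    proof -
      have "\<bar>real_of_int (z - y)\<bar> * \<bar>real_of_int (x - z)\<bar> \<le> real K * real K"
        by (intro mult_mono aK xyz) auto
      from this Q have "\<bar>real_of_int (z - y)\<bar> * \<bar>real_of_int (x - z)\<bar> * \<bar>Q\<bar> \<le> real K * real K * (10 * (24 * M)^2 * k^2)"
        by (rule mult_mono) auto
      thus ?thesis by (simp add: abs_mult power2_eq_square mult_ac)
    qed
    have b2: "\<bar>real_of_int (ze z - ze y) * real_of_int (ze x - ze z) * R\<bar> \<le> K2 ^ 2 * (10 * N ^ 2) * k^2"
    proof -
      have "\<bar>real_of_int (ze z - ze y)\<bar> * \<bar>real_of_int (ze x - ze z)\<bar> \<le> K2 * K2"
        by (intro mult_mono zK xyz K20) auto
      from this R have "\<bar>real_of_int (ze z - ze y)\<bar> * \<bar>real_of_int (ze x - ze z)\<bar> * \<bar>R\<bar> \<le> K2 * K2 * (10 * N^2 * k^2)"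
        by (rule mult_mono) (use K20 in auto)
      thus ?thesis by (simp add: abs_mult power2_eq_square mult_ac)
    qed
    have "\<bar>real_of_int D * P\<bar> \<le> K2 * (real K ^ 2 * (10 * (24 * M)^2) * k^2 + K2 ^ 2 * (10 * N ^ 2) * k^2)"
      unfolding det abs_mult[of "real_of_int (ze y - ze x)"]
    proof (rule mult_mono[OF zK[OF xyz(2,1)] _ K20])
      show "\<bar>real_of_int (z - y) * real_of_int (x - z) * Q - real_of_int (ze z - ze y) * real_of_int (ze x - ze z) * R\<bar>
        \<le> real K ^ 2 * (10 * (24 * M)^2) * k^2 + K2 ^ 2 * (10 * N ^ 2) * k^2"
        using b1 b2 by (intro order.trans[OF abs_triangle_ineq4] add_mono)
    qed simp
    also have "\<dots> = V * k^2" unfolding V_def by (simp add: distrib_left distrib_right mult_ac)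
    finally have DP: "\<bar>real_of_int D\<bar> * \<bar>P\<bar> \<le> V * k^2" by (simp add: abs_mult)
    have "k^3 \<le> \<bar>P\<bar>" unfolding P_def using dd(1)[OF T(1)[OF xyz(1)] T(1)[OF xyz(2)]] by linarith
    hence "\<bar>real_of_int D\<bar> * k^3 \<le> \<bar>real_of_int D\<bar> * \<bar>P\<bar>" by (intro mult_left_mono) auto
    hence "(\<bar>real_of_int D\<bar> * k) * k^2 \<le> V * k^2" using DP by (simp add: power3_eq_cube power2_eq_square mult_ac)
    hence Dk: "\<bar>real_of_int D\<bar> * k \<le> V" using k0 by (simp add: mult_le_cancel_right)
    have "D = 0"
    proof (rule ccontr)
      assume "D \<noteq> 0"
      hence "1 \<le> \<bar>real_of_int D\<bar>" by linarith
      hence "1 * k \<le> \<bar>real_of_int D\<bar> * k" using k0 by (intro mult_right_mono) auto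
      thus False using Dk kV by linarith
    qed
    thus ?thesis unfolding D_def by simp
  qed
  have "\<exists>r s::int. (r = 1 \<or> r = -1) \<and>
    (\<forall>x. quartic c1 c2 c3 c4 x = quartic (g1 b) (g2 b) (g3 b) (g4 b) (real_of_int r * x + real_of_int s))"
  proof (rule quartic_eq_of_five_points[where T = T and f = ze])
    show "finite T" unfolding T_def win_def by (intro finite_Collect_conjI disjI1) simp
    show "card T \<ge> 5" unfolding T_def by (rule T5)
    show "quartic c1 c2 c3 c4 (real_of_int a) = quartic (g1 b) (g2 b) (g3 b) (g4 b) (real_of_int (ze a))" if "a \<in> T" for a
      using bz(3)[OF T(1)[OF that]] T(2)[OF that] unfolding \<phi>_def \<gamma>_def by simp
  qed (rule col)
  thus ?thesis by blast
qed

text \<open>The threshold depends on \<open>M\<close>, \<open>N\<close> and \<open>B\<close> alone.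
  This order of quantifiers lets the prime, and with it the curves, be chosen after
  \<open>k0\<close>.\<close>

lemma quartic_curve_points_large:
  fixes M N :: real and B :: nat
  assumes M: "M \<ge> 1" and N: "N \<ge> 1"
  shows "\<exists>k0\<ge>1. \<forall>k>k0. \<forall>c1 c2 c3 c4. \<forall>g1 g2 g3 g4 :: int \<Rightarrow> real.
    \<bar>c1\<bar> \<le> M * k \<longrightarrow> \<bar>c2\<bar> \<le> M * k^2 \<longrightarrow> \<bar>c3\<bar> \<le> M * k^3 \<longrightarrow>
    (\<forall>b. \<bar>b\<bar> \<le> int B \<longrightarrow> \<bar>g1 b\<bar> \<le> N * k \<and> \<bar>g2 b\<bar> \<le> N * k^2) \<longrightarrow>
    (\<forall>b x y. quartic (g1 b) (g2 b) (g3 b) (g4 b) x + quartic_deriv (g1 b) (g2 b) (g3 b) x * (y - x)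
        \<le> quartic (g1 b) (g2 b) (g3 b) (g4 b) y) \<longrightarrow>
    (\<forall>a::int. 12 * M * k \<le> real_of_int a \<longrightarrow> real_of_int a \<le> 24 * M * k \<longrightarrow>
       (\<exists>b z::int. \<bar>b\<bar> \<le> int B \<and> \<bar>real_of_int z\<bar> \<le> N * k \<and>
         quartic c1 c2 c3 c4 (real_of_int a) = quartic (g1 b) (g2 b) (g3 b) (g4 b) (real_of_int z))) \<longrightarrow>
    (\<exists>b r s::int. (r = 1 \<or> r = -1) \<and>
      (\<forall>x. quartic c1 c2 c3 c4 x = quartic (g1 b) (g2 b) (g3 b) (g4 b) (real_of_int r * x + real_of_int s)))"
proof -
  define W where "W = 2 * B + 2"
  define K where "K = 8 * (2 * B + 1)"
  define K2 where "K2 = real K * (35 * (12 * M) ^ 3) / (1 / (4 * N * real W))"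
  define V where "V = K2 * (real K ^ 2 * (10 * (24 * M)^2) + K2 ^ 2 * (10 * N ^ 2))"
  define k0 where "k0 = max 1 (max (2 * real W * (real K + 1)) V)"
  have k0: "k0 \<ge> 1" unfolding k0_def by simp
  have "k \<ge> 1" "k > 2 * real W * (real K + 1)" "k > V" if "k > k0" for k
    using that unfolding k0_def by auto
  note kk = this[unfolded V_def K2_def W_def K_def]
  show ?thesis
  proof (intro exI[of _ k0] conjI allI impI k0, goal_cases)
    case (1 k c1 c2 c3 c4 g1 g2 g3 g4)
    show ?case
      by (rule quartic_curve_points[OF M N kk[OF 1(1)] 1(2-4)]) (use 1(5-7) in auto)
  qed
qed

subsection \<open>Binary quartic forms\<close>

definition bform :: "'a::comm_ring_1 \<Rightarrow> 'a \<Rightarrow> 'a \<Rightarrow> 'a \<Rightarrow> 'a \<Rightarrow> 'a \<Rightarrow> 'a \<Rightarrow> 'a" where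
  "bform a b c d e x y = a * x^4 + b * x^3 * y + c * x^2 * y^2 + d * x * y^3 + e * y^4"

text \<open>The formula of \<open>disc4\<close> as a function of the five coefficients, so that it
  can be carried along \<open>of_int\<close> to the rationals and the reals.\<close>

definition bdisc :: "'a::comm_ring_1 \<Rightarrow> 'a \<Rightarrow> 'a \<Rightarrow> 'a \<Rightarrow> 'a \<Rightarrow> 'a" where
  "bdisc a b c d e = 256 * a^3 * e^3 - 192 * a^2 * b * d * e^2 - 128 * a^2 * c^2 * e^2
        + 144 * a^2 * c * d^2 * e - 27 * a^2 * d^4 + 144 * a * b^2 * c * e^2
        - 6 * a * b^2 * d^2 * e - 80 * a * b * c^2 * d * e + 18 * a * b * c * d^3
        + 16 * a * c^4 * e - 4 * a * c^3 * d^2 - 27 * b^4 * e^2 + 18 * b^3 * c * d * e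
        - 4 * b^3 * d^3 - 4 * b^2 * c^3 * e + b^2 * c^2 * d^2"

lemma bform_swap: "bform a b c d e x y = bform e d c b a y x"
  unfolding bform_def by (simp add: algebra_simps)

lemma bform_scale: "bform a b c d e (s * x) (s * y) = s^4 * bform a b c d e x y"
  unfolding bform_def by (simp add: algebra_simps eval_nat_numeral)

lemma bdisc_swap: "bdisc e d c b a = bdisc a b c d e"
  unfolding bdisc_def by (simp add: algebra_simps)

text \<open>The hypotheses say that \<open>r\<close> is a root of the dehomogenised quartic and of
  its derivative. They are solved for \<open>e\<close> and \<open>d\<close>, so that substitution
  leaves a polynomial identity.\<close>

lemma bdisc_double_root:
  fixes a b c d e r :: "'a::idom"
  assumes "e = - (a*r^4 + b*r^3 + c*r^2 + d*r)" "d = - (4*a*r^3 + 3*b*r^2 + 2*c*r)"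
  shows "bdisc a b c d e = 0"
proof -
  have e: "e = 3*a*r^4 + 2*b*r^3 + c*r^2" unfolding assms(1) assms(2) by (simp add: algebra_simps power2_eq_square power3_eq_cube power4_eq_xxxx)
  show ?thesis unfolding bdisc_def e assms(2)
    by (simp add: algebra_simps power2_eq_square power3_eq_cube power4_eq_xxxx)
qed

text \<open>Non-negativity passes from integral to rational points by homogeneity and to real ones
  by continuity. A real zero would then be a minimum, hence a double root, against the
  discriminant.\<close>

lemma bform_pos_aux:
  fixes a b c d e :: real
  assumes nn: "\<And>x y::int. bform a b c d e (of_int x) (of_int y) \<ge> 0" and disc: "bdisc a b c d e \<noteq> 0"
  shows "bform a b c d e x 1 > 0"
proof -
  define f where "f x = bform a b c d e x 1" for x
  have cont: "isCont f x" for x unfolding f_def bform_def by (intro continuous_intros)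
  have deriv: "(f has_real_derivative (4*a*x^3 + 3*b*x^2 + 2*c*x + d)) (at x)" for x
    unfolding f_def bform_def by (auto intro!: derivative_eq_intros)
  have rat: "f q \<ge> 0" if qr: "q \<in> \<rat>" for q
  proof -
    obtain m n :: int where q: "q = of_int m / of_int n" "n > 0"
      using qr by (elim Rats_cases') auto
    have "bform a b c d e (of_int n * q) (of_int n * 1) = of_int n ^ 4 * f q"
      unfolding f_def by (rule bform_scale)
    moreover have "of_int n * q = of_int m" using q by simp
    ultimately have "0 \<le> of_int n ^ 4 * f q" using nn[of m n] by simp
    moreover have "(of_int n :: real) ^ 4 > 0" using q(2) by simp
    ultimately show ?thesis by (simp add: zero_le_mult_iff)
  qed
  have f0: "f x \<ge> 0" for x
  proof (rule ccontr)
    assume "\<not> f x \<ge> 0"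
    hence "f x < 0" by simp
    from cont[of x, unfolded isCont_def, THEN order_tendstoD(2), OF this]
    obtain s where s: "s > 0" "\<And>y. y \<noteq> x \<Longrightarrow> dist y x < s \<Longrightarrow> f y < 0"
      unfolding eventually_at by auto
    obtain q where q: "q \<in> \<rat>" "x < q" "q < x + s" using Rats_dense_in_real[of x "x + s"] s(1) by auto
    have "f q < 0" by (rule s(2)) (use q in \<open>auto simp: dist_real_def\<close>)
    thus False using rat[OF q(1)] by simp
  qed
  show ?thesis
  proof (rule ccontr)
    assume "\<not> ?thesis"
    hence fx: "f x = 0" using f0[of x] unfolding f_def by simp
    have "4*a*x^3 + 3*b*x^2 + 2*c*x + d = 0"
      by (rule DERIV_local_min[OF deriv[of x], of 1]) (use f0 fx in auto)
    hence "d = - (4*a*x^3 + 3*b*x^2 + 2*c*x)" by linarith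
    moreover have "e = - (a*x^4 + b*x^3 + c*x^2 + d*x)" using fx unfolding f_def bform_def by simp
    ultimately show False using bdisc_double_root[of e a x b c d] disc by simp
  qed
qed

text \<open>Compactness of [-1, 1] in the chart |x| \<le> |y|; reversing the coefficients gives the
  other chart. The loss of a factor 4 comes from (x^2 + y^2)^2 \<le> 4 y^4.\<close>

lemma bform_lower_bound:
  fixes a b c d e :: real
  assumes nn: "\<And>x y::int. bform a b c d e (of_int x) (of_int y) \<ge> 0" and disc: "bdisc a b c d e \<noteq> 0"
  shows "\<exists>K>0. \<forall>x y. bform a b c d e x y \<ge> K * (x^2 + y^2)^2"
proof -
  have half: "\<exists>K>0. \<forall>x y. \<bar>x\<bar> \<le> \<bar>y\<bar> \<longrightarrow> bform a b c d e x y \<ge> K * (x^2 + y^2)^2"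
    if nn: "\<And>x y::int. bform a b c d e (of_int x) (of_int y) \<ge> 0" and disc: "bdisc a b c d e \<noteq> 0"
    for a b c d e :: real
  proof -
    have "\<forall>x. -1 \<le> x \<and> x \<le> 1 \<longrightarrow> isCont (\<lambda>x. bform a b c d e x 1) x"
      unfolding bform_def by (intro allI impI continuous_intros)
    from isCont_eq_Lb[of "-1::real" 1, OF _ this] obtain x0 where x0:
      "\<And>x. -1 \<le> x \<Longrightarrow> x \<le> 1 \<Longrightarrow> bform a b c d e x0 1 \<le> bform a b c d e x 1" by auto
    define K where "K = bform a b c d e x0 1"
    have K: "K > 0" unfolding K_def by (rule bform_pos_aux[OF nn disc])
    have "bform a b c d e x y \<ge> K / 4 * (x^2 + y^2)^2" if xy: "\<bar>x\<bar> \<le> \<bar>y\<bar>" for x y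
    proof (cases "y = 0")
      case True
      thus ?thesis using xy by (simp add: bform_def)
    next
      case False
      have "\<bar>x / y\<bar> \<le> 1" using xy False by (simp add: abs_divide)
      hence "-1 \<le> x / y" "x / y \<le> 1" unfolding abs_le_iff by linarith+
      hence "K \<le> bform a b c d e (x / y) 1" unfolding K_def by (rule x0)
      hence "y^4 * K \<le> y^4 * bform a b c d e (x / y) 1" by (intro mult_left_mono) auto
      also have "\<dots> = bform a b c d e x y" using bform_scale[of a b c d e y "x/y" 1] False by simp
      finally have 1: "y^4 * K \<le> bform a b c d e x y" .
      have "x^2 \<le> y^2" using xy by (simp add: abs_le_square_iff)
      hence "x^2 + y^2 \<le> 2 * y^2" by simp
      hence "(x^2 + y^2)^2 \<le> (2 * y^2)^2" by (intro power_mono) auto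
      hence "(x^2 + y^2)^2 \<le> 4 * y^4" by (simp add: power_mult_distrib flip: power_mult)
      hence "K / 4 * (x^2 + y^2)^2 \<le> K / 4 * (4 * y^4)" using K by (intro mult_left_mono) auto
      also have "\<dots> = y^4 * K" by simp
      finally show ?thesis using 1 by linarith
    qed
    thus ?thesis using K by (intro exI[of _ "K/4"]) auto
  qed
  obtain K1 where K1: "K1 > 0" "\<And>x y. \<bar>x\<bar> \<le> \<bar>y\<bar> \<Longrightarrow> bform a b c d e x y \<ge> K1 * (x^2 + y^2)^2"
    using half[OF nn disc] by blast
  have "\<And>x y::int. bform e d c b a (of_int x) (of_int y) \<ge> 0"
    using nn bform_swap[of a b c d e] by metis
  moreover have "bdisc e d c b a \<noteq> 0" using disc bdisc_swap by metis
  ultimately obtain K2 where K2: "K2 > 0" "\<And>x y. \<bar>x\<bar> \<le> \<bar>y\<bar> \<Longrightarrow> bform e d c b a x y \<ge> K2 * (x^2 + y^2)^2"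
    using half[of e d c b a] by blast
  have "bform a b c d e x y \<ge> min K1 K2 * (x^2 + y^2)^2" for x y
  proof (cases "\<bar>x\<bar> \<le> \<bar>y\<bar>")
    case True
    have "min K1 K2 * (x^2 + y^2)^2 \<le> K1 * (x^2 + y^2)^2" by (intro mult_right_mono) auto
    thus ?thesis using K1(2)[OF True] by linarith
  next
    case False
    hence yx: "\<bar>y\<bar> \<le> \<bar>x\<bar>" by simp
    have "min K1 K2 * (x^2 + y^2)^2 \<le> K2 * (y^2 + x^2)^2" unfolding add.commute[of "y^2"] by (intro mult_right_mono) auto
    thus ?thesis using K2(2)[OF yx] bform_swap[of a b c d e x y] by linarith
  qed
  thus ?thesis using K1(1) K2(1) by (intro exI[of _ "min K1 K2"]) auto
qed

lemma bform_upper_bound: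
  fixes a b c d e x y :: real
  shows "bform a b c d e x y \<le> (\<bar>a\<bar> + \<bar>b\<bar> + \<bar>c\<bar> + \<bar>d\<bar> + \<bar>e\<bar>) * (x^2 + y^2)^2"
proof -
  define r where "r = sqrt (x^2 + y^2)"
  have r: "\<bar>x\<bar> \<le> r" "\<bar>y\<bar> \<le> r" "r \<ge> 0" unfolding r_def by (auto intro: real_le_rsqrt)
  have r4: "r^4 = (x^2 + y^2)^2"
  proof -
    have "r^2 = x^2 + y^2" unfolding r_def by simp
    thus ?thesis by (metis mult_2 numeral_Bit0 power2_eq_square power_add)
  qed
  have m: "k * x^i * y^j \<le> \<bar>k\<bar> * r^4" if "i + j = 4" for k i j
  proof -
    have "k * x^i * y^j \<le> \<bar>k * x^i * y^j\<bar>" by simp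
    also have "\<dots> = \<bar>k\<bar> * (\<bar>x\<bar>^i * \<bar>y\<bar>^j)" by (simp add: abs_mult power_abs)
    also have "\<dots> \<le> \<bar>k\<bar> * (r^i * r^j)" using r by (intro mult_left_mono mult_mono power_mono) auto
    also have "r^i * r^j = r^4" using that by (simp flip: power_add)
    finally show ?thesis .
  qed
  have "bform a b c d e x y = a * x^4 * y^0 + b * x^3 * y^1 + c * x^2 * y^2 + d * x^1 * y^3 + e * x^0 * y^4"
    unfolding bform_def by simp
  also have "\<dots> \<le> \<bar>a\<bar> * r^4 + \<bar>b\<bar> * r^4 + \<bar>c\<bar> * r^4 + \<bar>d\<bar> * r^4 + \<bar>e\<bar> * r^4"
    by (intro add_mono m) simp_all
  finally show ?thesis unfolding r4 by (simp add: algebra_simps)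
qed

text \<open>The constants count monomials: five coefficients times the binomial numbers 4, 6 and 4.
  The bounds stop at \<open>c3\<close> because divided differences do not see the constant
  term.\<close>

lemma bform_expand:
  fixes a b c d e p0 q0 p1 q1 H X Y :: real
  assumes H: "\<bar>a\<bar> \<le> H" "\<bar>b\<bar> \<le> H" "\<bar>c\<bar> \<le> H" "\<bar>d\<bar> \<le> H" "\<bar>e\<bar> \<le> H"
    and X: "\<bar>p0\<bar> \<le> X" "\<bar>q0\<bar> \<le> X" and Y: "\<bar>p1\<bar> \<le> Y" "\<bar>q1\<bar> \<le> Y"
  obtains c1 c2 c3 c4 where
    "\<And>x y. bform a b c d e (x * p0 + y * p1) (x * q0 + y * q1)
      = bform a b c d e p0 q0 * x^4 + c1 * x^3 * y + c2 * x^2 * y^2 + c3 * x * y^3 + c4 * y^4"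
    "\<bar>c1\<bar> \<le> 20 * H * (X^3 * Y)" "\<bar>c2\<bar> \<le> 30 * H * (X^2 * Y^2)" "\<bar>c3\<bar> \<le> 20 * H * (X * Y^3)"
proof
  define c1 c2 c3 c4 where
    "c1 = a * (4*(p0*p0*p0*p1)) + b * (3*(p0*p0*q0*p1) + p0*p0*p0*q1) + c * (2*(p0*q0*q0*p1) + 2*(p0*p0*q0*q1))
        + d * (q0*q0*q0*p1 + 3*(p0*q0*q0*q1)) + e * (4*(q0*q0*q0*q1))"
    and "c2 = a * (6*(p0*p0*p1*p1)) + b * (3*(p0*q0*p1*p1) + 3*(p0*p0*p1*q1)) + c * (q0*q0*p1*p1 + 4*(p0*q0*p1*q1) + p0*p0*q1*q1)
        + d * (3*(q0*q0*p1*q1) + 3*(p0*q0*q1*q1)) + e * (6*(q0*q0*q1*q1))"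
    and "c3 = a * (4*(p0*p1*p1*p1)) + b * (q0*p1*p1*p1 + 3*(p0*p1*p1*q1)) + c * (2*(q0*p1*p1*q1) + 2*(p0*p1*q1*q1))
        + d * (3*(q0*p1*q1*q1) + p0*q1*q1*q1) + e * (4*(q0*q1*q1*q1))"
    and "c4 = bform a b c d e p1 q1"
  show "bform a b c d e (x * p0 + y * p1) (x * q0 + y * q1)
      = bform a b c d e p0 q0 * x^4 + c1 * x^3 * y + c2 * x^2 * y^2 + c3 * x * y^3 + c4 * y^4" for x y
    unfolding c1_def c2_def c3_def c4_def bform_def
    by (simp add: algebra_simps power2_eq_square power3_eq_cube power4_eq_xxxx)
  have XY: "X \<ge> 0" "Y \<ge> 0" "H \<ge> 0" using X(1) Y(1) H(1) by linarith+
  have m: "\<bar>u*v*w*z\<bar> \<le> A*B*C*D" if "\<bar>u\<bar> \<le> A" "\<bar>v\<bar> \<le> B" "\<bar>w\<bar> \<le> C" "\<bar>z\<bar> \<le> D" for u v w z A B C D :: real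
  proof -
    have "A \<ge> 0" "B \<ge> 0" "C \<ge> 0" "D \<ge> 0" using that by linarith+
    thus ?thesis unfolding abs_mult using that by (intro mult_mono mult_nonneg_nonneg) auto
  qed
  have hm: "\<bar>h * s\<bar> \<le> H * T" if "\<bar>h\<bar> \<le> H" "\<bar>s\<bar> \<le> T" for h s T
    unfolding abs_mult using that by (intro mult_mono) auto
  have five: "\<bar>u1 + u2 + u3 + u4 + u5\<bar> \<le> T1 + T2 + T3 + T4 + T5"
    if "\<bar>u1\<bar> \<le> T1" "\<bar>u2\<bar> \<le> T2" "\<bar>u3\<bar> \<le> T3" "\<bar>u4\<bar> \<le> T4" "\<bar>u5\<bar> \<le> T5" for u1 u2 u3 u4 u5 T1 T2 T3 T4 T5 :: real
    using that by linarith
  note X1 = X(1) and X2 = X(2) and Y1 = Y(1) and Y2 = Y(2)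
  have "\<bar>c1\<bar> \<le> H * (4*(X*X*X*Y)) + H * (4*(X*X*X*Y)) + H * (4*(X*X*X*Y)) + H * (4*(X*X*X*Y)) + H * (4*(X*X*X*Y))"
    unfolding c1_def
  proof (intro five hm H)
    show "\<bar>4*(p0*p0*p0*p1)\<bar> \<le> 4*(X*X*X*Y)" using m[OF X1 X1 X1 Y1] by linarith
    show "\<bar>3*(p0*p0*q0*p1) + p0*p0*p0*q1\<bar> \<le> 4*(X*X*X*Y)" using m[OF X1 X1 X2 Y1] m[OF X1 X1 X1 Y2] by linarith
    show "\<bar>2*(p0*q0*q0*p1) + 2*(p0*p0*q0*q1)\<bar> \<le> 4*(X*X*X*Y)" using m[OF X1 X2 X2 Y1] m[OF X1 X1 X2 Y2] by linarith
    show "\<bar>q0*q0*q0*p1 + 3*(p0*q0*q0*q1)\<bar> \<le> 4*(X*X*X*Y)" using m[OF X2 X2 X2 Y1] m[OF X1 X2 X2 Y2] by linarith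
    show "\<bar>4*(q0*q0*q0*q1)\<bar> \<le> 4*(X*X*X*Y)" using m[OF X2 X2 X2 Y2] by linarith
  qed
  thus "\<bar>c1\<bar> \<le> 20 * H * (X^3 * Y)" by (simp add: power3_eq_cube)
  have "\<bar>c2\<bar> \<le> H * (6*(X*X*Y*Y)) + H * (6*(X*X*Y*Y)) + H * (6*(X*X*Y*Y)) + H * (6*(X*X*Y*Y)) + H * (6*(X*X*Y*Y))"
    unfolding c2_def
  proof (intro five hm H)
    show "\<bar>6*(p0*p0*p1*p1)\<bar> \<le> 6*(X*X*Y*Y)" using m[OF X1 X1 Y1 Y1] by linarith
    show "\<bar>3*(p0*q0*p1*p1) + 3*(p0*p0*p1*q1)\<bar> \<le> 6*(X*X*Y*Y)" using m[OF X1 X2 Y1 Y1] m[OF X1 X1 Y1 Y2] by linarith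
    show "\<bar>q0*q0*p1*p1 + 4*(p0*q0*p1*q1) + p0*p0*q1*q1\<bar> \<le> 6*(X*X*Y*Y)"
      using m[OF X2 X2 Y1 Y1] m[OF X1 X2 Y1 Y2] m[OF X1 X1 Y2 Y2] by linarith
    show "\<bar>3*(q0*q0*p1*q1) + 3*(p0*q0*q1*q1)\<bar> \<le> 6*(X*X*Y*Y)" using m[OF X2 X2 Y1 Y2] m[OF X1 X2 Y2 Y2] by linarith
    show "\<bar>6*(q0*q0*q1*q1)\<bar> \<le> 6*(X*X*Y*Y)" using m[OF X2 X2 Y2 Y2] by linarith
  qed
  thus "\<bar>c2\<bar> \<le> 30 * H * (X^2 * Y^2)" by (simp add: power2_eq_square mult.assoc)
  have "\<bar>c3\<bar> \<le> H * (4*(X*Y*Y*Y)) + H * (4*(X*Y*Y*Y)) + H * (4*(X*Y*Y*Y)) + H * (4*(X*Y*Y*Y)) + H * (4*(X*Y*Y*Y))"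
    unfolding c3_def
  proof (intro five hm H)
    show "\<bar>4*(p0*p1*p1*p1)\<bar> \<le> 4*(X*Y*Y*Y)" using m[OF X1 Y1 Y1 Y1] by linarith
    show "\<bar>q0*p1*p1*p1 + 3*(p0*p1*p1*q1)\<bar> \<le> 4*(X*Y*Y*Y)" using m[OF X2 Y1 Y1 Y1] m[OF X1 Y1 Y1 Y2] by linarith
    show "\<bar>2*(q0*p1*p1*q1) + 2*(p0*p1*q1*q1)\<bar> \<le> 4*(X*Y*Y*Y)" using m[OF X2 Y1 Y1 Y2] m[OF X1 Y1 Y2 Y2] by linarith
    show "\<bar>3*(q0*p1*q1*q1) + p0*q1*q1*q1\<bar> \<le> 4*(X*Y*Y*Y)" using m[OF X2 Y1 Y2 Y2] m[OF X1 Y2 Y2 Y2] by linarith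
    show "\<bar>4*(q0*q1*q1*q1)\<bar> \<le> 4*(X*Y*Y*Y)" using m[OF X2 Y2 Y2 Y2] by linarith
  qed
  thus "\<bar>c3\<bar> \<le> 20 * H * (X * Y^3)" by (simp add: power3_eq_cube mult.assoc)
qed

section \<open>Lattices of determinant p\<close>

text \<open>\<open>p\<close> times a Bezout complement is shifted by a multiple of
  \<open>(x0,y0)\<close> until the inner product lies in [0, n). Lagrange's identity, |v0|^2 |v1|^2
  = det^2 + (v0 . v1)^2, then gives the bound, as \<open>n\<close> is at most
  \<open>p\<close>.\<close>

lemma reduced_complement:
  fixes x0 y0 p :: int
  assumes co: "coprime x0 y0" and np: "x0^2 + y0^2 \<le> p"
  obtains x1 y1 where "x0 * y1 - y0 * x1 = p" "(x1^2 + y1^2) * (x0^2 + y0^2) \<le> 2 * p^2"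
proof -
  obtain u v where uv: "u * x0 + v * y0 = 1"
    using bezout_int[of x0 y0] co by (auto simp: coprime_iff_gcd_eq_1)
  define n where "n = x0^2 + y0^2"
  have n: "n > 0"
  proof -
    have "x0 \<noteq> 0 \<or> y0 \<noteq> 0" using uv by auto
    thus ?thesis unfolding n_def by (simp add: sum_power2_gt_zero_iff)
  qed
  define q where "q = p * (x0 * (- v) + y0 * u)"
  define k where "k = - (q div n)"
  define x1 y1 where "x1 = p * (- v) + k * x0" and "y1 = p * u + k * y0"
  have det: "x0 * y1 - y0 * x1 = p"
  proof -
    have "x0 * y1 - y0 * x1 = p * (u * x0 + v * y0)" unfolding x1_def y1_def by (simp add: algebra_simps)
    thus ?thesis using uv by simp
  qed
  have "x0 * x1 + y0 * y1 = q + k * n" unfolding x1_def y1_def q_def n_def by (simp add: algebra_simps power2_eq_square)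
  also have "\<dots> = q mod n" unfolding k_def by (simp add: minus_div_mult_eq_mod)
  finally have dot: "x0 * x1 + y0 * y1 = q mod n" .
  have "(x0 * x1 + y0 * y1)^2 \<le> p^2"
  proof (rule power_mono)
    show "x0 * x1 + y0 * y1 \<le> p" unfolding dot using pos_mod_bound[OF n, of q] np unfolding n_def by linarith
    show "0 \<le> x0 * x1 + y0 * y1" unfolding dot using n by simp
  qed
  moreover have "(x1^2 + y1^2) * (x0^2 + y0^2) = (x0 * y1 - y0 * x1)^2 + (x0 * x1 + y0 * y1)^2"
    by (simp add: algebra_simps power2_eq_square)
  ultimately have "(x1^2 + y1^2) * (x0^2 + y0^2) \<le> 2 * p^2" unfolding det by simp
  thus ?thesis using that det by blast
qed

text \<open>Modulo \<open>p\<close> the four roots are z, -z, 1/z and -1/z, because z^3 = -1/z. A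
  sign change and the exchange of \<open>t\<close> and \<open>u\<close> permute them transitively,
  so any solution can be moved into the lattice of the given one.\<close>

lemma quartic_root_align:
  fixes p t u t0 u0 :: int
  assumes p: "prime p" and d0: "p dvd t0^4 + u0^4" and d: "p dvd t^4 + u^4" and n0: "\<not> (p dvd t0 \<and> p dvd u0)"
  obtains t' u' where "t'^4 + u'^4 = t^4 + u^4" "t'^2 + u'^2 = t^2 + u^2" "p dvd t0 * u' - u0 * t'"
proof -
  have pu: "\<not> p dvd u0"
  proof
    assume a: "p dvd u0"
    hence "p dvd u0^4" by (rule dvd_power_le[where n=1, simplified]) simp
    hence "p dvd t0^4" using d0 dvd_add_left_iff by blast
    hence "p dvd t0" using p prime_dvd_power by blast
    thus False using a n0 by simp
  qed
  have "p dvd u0^4 * (t^4 + u^4) - u^4 * (t0^4 + u0^4)" using d d0 by simp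
  also have "\<dots> = (t0*u - u0*t) * ((t0*(-u) - u0*t) * (t^2*u0^2 + u^2*t0^2))"
    by (simp add: algebra_simps power2_eq_square eval_nat_numeral)
  finally have "p dvd t0*u - u0*t \<or> p dvd t0*(-u) - u0*t \<or> p dvd t^2*u0^2 + u^2*t0^2"
    using p by (auto simp only: prime_dvd_mult_iff)
  moreover have "p dvd t0*t - u0*u \<or> p dvd t0*(-t) - u0*u" if "p dvd t^2*u0^2 + u^2*t0^2"
  proof -
    have "p dvd t0^2 * (t^2*u0^2 + u^2*t0^2) - u^2 * (t0^4 + u0^4)" using that d0 by simp
    also have "\<dots> = u0 * (u0 * ((t0*t - u0*u) * - (t0*(-t) - u0*u)))"
      by (simp add: algebra_simps power2_eq_square eval_nat_numeral)
    finally show ?thesis using p pu by (auto simp only: prime_dvd_mult_iff dvd_minus_iff)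
  qed
  ultimately consider "p dvd t0*u - u0*t" | "p dvd t0*(-u) - u0*t" | "p dvd t0*t - u0*u" | "p dvd t0*(-t) - u0*u"
    by blast
  thus ?thesis
    by cases (use that[of t u] that[of t "-u"] that[of u t] that[of u "-t"] in \<open>simp_all add: add.commute\<close>)
qed

text \<open>A determinant vanishing modulo \<open>p\<close> makes \<open>(x,y)\<close> proportional
  to \<open>(x0,y0)\<close>, and the form is homogeneous. Instead of dividing, the proof multiplies
  by the fourth power of a coordinate prime to \<open>p\<close>.\<close>

lemma prime_dvd_bform:
  fixes a b c d e p x0 y0 x y :: int
  assumes p: "prime p" and d0: "p dvd bform a b c d e x0 y0" and n0: "\<not> (p dvd x0 \<and> p dvd y0)"
    and det: "p dvd x0 * y - y0 * x"
  shows "p dvd bform a b c d e x y"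
proof -
  have *: "p dvd bform a b c d e x y"
    if d0: "p dvd bform a b c d e x0 y0" and n0: "\<not> p dvd y0" and det: "p dvd x0 * y - y0 * x"
    for a b c d e x y x0 y0 :: int
  proof -
    have cg: "[x0 * y = y0 * x] (mod p)" using det by (simp add: cong_iff_dvd_diff)
    have "[bform a b c d e (x0 * y) (y0 * y) = bform a b c d e (y0 * x) (y0 * y)] (mod p)"
      unfolding bform_def by (intro cong_add cong_mult cong_pow cg cong_refl)
    moreover have "bform a b c d e (x0 * y) (y0 * y) = y^4 * bform a b c d e x0 y0"
      using bform_scale[of a b c d e y x0 y0] by (simp add: mult.commute)
    ultimately have "p dvd y0^4 * bform a b c d e x y"
      using d0 bform_scale[of a b c d e y0 x y] by (metis cong_dvd_iff dvd_mult)
    thus ?thesis using p n0 prime_dvd_mult_iff prime_dvd_power by blast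
  qed
  show ?thesis
  proof (cases "p dvd y0")
    case False
    show ?thesis by (rule *[OF d0 False det])
  next
    case True
    hence "\<not> p dvd x0" using n0 by simp
    moreover have "p dvd y0 * x - x0 * y" using det by (metis dvd_minus_iff minus_diff_eq)
    ultimately have "p dvd bform e d c b a y x"
      using *[of e d c b a y0 x0 x y] d0 bform_swap[of a b c d e x0 y0] by metis
    thus ?thesis using bform_swap[of a b c d e x y] by metis
  qed
qed

text \<open>As \<open>(t0,u0)\<close> is primitive, it forms together with \<open>(t1,u1)\<close> a
  basis of the lattice; the second coordinate is the determinant over \<open>p\<close>.\<close>

lemma lattice_coordinates:
  fixes t0 u0 t1 u1 t u p :: int
  assumes co: "coprime t0 u0" and det: "t0 * u1 - u0 * t1 = p" and dv: "p dvd t0 * u - u0 * t"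
  obtains z b where "t = z * t0 + b * t1" "u = z * u0 + b * u1" "b * p = t0 * u - u0 * t"
proof -
  obtain b where b: "t0 * u - u0 * t = p * b" using dv by blast
  define t2 u2 where "t2 = t - b * t1" and "u2 = u - b * u1"
  have eq: "t0 * u2 = u0 * t2"
    using b det unfolding t2_def u2_def by (simp add: algebra_simps)
  obtain i j where ij: "i * t0 + j * u0 = 1"
    using bezout_int[of t0 u0] co by (auto simp: coprime_iff_gcd_eq_1)
  define z where "z = i * t2 + j * u2"
  have "z * t0 = t2 * (i * t0 + j * u0)" unfolding z_def using eq by (simp add: algebra_simps)
  moreover have "z * u0 = u2 * (i * t0 + j * u0)" unfolding z_def using eq by (simp add: algebra_simps)
  ultimately have "t2 = z * t0" "u2 = z * u0" using ij by simp_all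
  hence "t = z * t0 + b * t1" "u = z * u0 + b * u1" unfolding t2_def u2_def by simp_all
  moreover have "b * p = t0 * u - u0 * t" using b by (simp add: mult.commute)
  ultimately show ?thesis by (rule that)
qed

subsection \<open>The substitution attached to a prime\<close>

lemma pow4_tangent: "(u::real)^4 + 4 * u^3 * (v - u) \<le> v^4"
proof -
  have "v^4 - (u^4 + 4 * u^3 * (v - u)) = (v - u)^2 * ((u + v)^2 + 2 * u^2)"
    by (simp add: algebra_simps power2_eq_square power3_eq_cube power4_eq_xxxx)
  also have "\<dots> \<ge> 0" by simp
  finally show ?thesis by linarith
qed

text \<open>These coefficients describe \<gamma>: the value of t^4 + u^4 at z (t0,u0) + b (t1,u1),
  normalised to be monic in \<open>z\<close>. Convexity is inherited from fourth powers of affine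
  functions of \<open>z\<close>.\<close>

lemma quartic_sum_pow4:
  fixes t0 u0 t1 u1 b :: real
  defines "m \<equiv> t0^4 + u0^4"
  assumes m: "m > 0"
  defines "h1 \<equiv> 4 * (t0^3 * t1 + u0^3 * u1)" and "h2 \<equiv> 6 * (t0^2 * t1^2 + u0^2 * u1^2)"
    and "h3 \<equiv> 4 * (t0 * t1^3 + u0 * u1^3)" and "h4 \<equiv> t1^4 + u1^4"
  shows quartic_sum_pow4_eq: "quartic (h1 * b / m) (h2 * b^2 / m) (h3 * b^3 / m) (h4 * b^4 / m) z
      = ((z * t0 + b * t1)^4 + (z * u0 + b * u1)^4) / m"
    and quartic_sum_pow4_convex: "quartic (h1 * b / m) (h2 * b^2 / m) (h3 * b^3 / m) (h4 * b^4 / m) x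
        + quartic_deriv (h1 * b / m) (h2 * b^2 / m) (h3 * b^3 / m) x * (y - x)
      \<le> quartic (h1 * b / m) (h2 * b^2 / m) (h3 * b^3 / m) (h4 * b^4 / m) y"
proof -
  have q: "quartic (h1 * b / m) (h2 * b^2 / m) (h3 * b^3 / m) (h4 * b^4 / m) z
      = ((z * t0 + b * t1)^4 + (z * u0 + b * u1)^4) / m" for z
  proof -
    have "quartic (h1 * b / m) (h2 * b^2 / m) (h3 * b^3 / m) (h4 * b^4 / m) z
        = (m * z^4 + h1 * b * z^3 + h2 * b^2 * z^2 + h3 * b^3 * z + h4 * b^4) / m"
      unfolding quartic_def using m by (simp add: add_divide_distrib)
    also have "m * z^4 + h1 * b * z^3 + h2 * b^2 * z^2 + h3 * b^3 * z + h4 * b^4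
        = (z * t0 + b * t1)^4 + (z * u0 + b * u1)^4"
      unfolding m_def h1_def h2_def h3_def h4_def
      by (simp add: algebra_simps power2_eq_square power3_eq_cube power4_eq_xxxx)
    finally show ?thesis .
  qed
  thus "quartic (h1 * b / m) (h2 * b^2 / m) (h3 * b^3 / m) (h4 * b^4 / m) z
      = ((z * t0 + b * t1)^4 + (z * u0 + b * u1)^4) / m" .
  have d: "quartic_deriv (h1 * b / m) (h2 * b^2 / m) (h3 * b^3 / m) x
      = (4 * (x * t0 + b * t1)^3 * t0 + 4 * (x * u0 + b * u1)^3 * u0) / m"
  proof -
    have "quartic_deriv (h1 * b / m) (h2 * b^2 / m) (h3 * b^3 / m) x
        = (4 * m * x^3 + 3 * (h1 * b) * x^2 + 2 * (h2 * b^2) * x + h3 * b^3) / m"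
      unfolding quartic_deriv_def using m by (simp add: add_divide_distrib)
    also have "4 * m * x^3 + 3 * (h1 * b) * x^2 + 2 * (h2 * b^2) * x + h3 * b^3
        = 4 * (x * t0 + b * t1)^3 * t0 + 4 * (x * u0 + b * u1)^3 * u0"
      unfolding m_def h1_def h2_def h3_def
      by (simp add: algebra_simps power2_eq_square power3_eq_cube power4_eq_xxxx)
    finally show ?thesis .
  qed
  have "(x * t0 + b * t1)^4 + 4 * (x * t0 + b * t1)^3 * ((y * t0 + b * t1) - (x * t0 + b * t1)) \<le> (y * t0 + b * t1)^4"
    "(x * u0 + b * u1)^4 + 4 * (x * u0 + b * u1)^3 * ((y * u0 + b * u1) - (x * u0 + b * u1)) \<le> (y * u0 + b * u1)^4"
    by (rule pow4_tangent)+
  moreover have "(y * t0 + b * t1) - (x * t0 + b * t1) = t0 * (y - x)"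
    "(y * u0 + b * u1) - (x * u0 + b * u1) = u0 * (y - x)" by (simp_all add: algebra_simps)
  ultimately have "((x * t0 + b * t1)^4 + (x * u0 + b * u1)^4)
      + (4 * (x * t0 + b * t1)^3 * t0 + 4 * (x * u0 + b * u1)^3 * u0) * (y - x)
      \<le> (y * t0 + b * t1)^4 + (y * u0 + b * u1)^4"
    by (simp add: distrib_right mult.assoc)
  hence *: "(((x * t0 + b * t1)^4 + (x * u0 + b * u1)^4)
      + (4 * (x * t0 + b * t1)^3 * t0 + 4 * (x * u0 + b * u1)^3 * u0) * (y - x)) / m
      \<le> ((y * t0 + b * t1)^4 + (y * u0 + b * u1)^4) / m"
    using m by (intro divide_right_mono) auto
  show "quartic (h1 * b / m) (h2 * b^2 / m) (h3 * b^3 / m) (h4 * b^4 / m) x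
        + quartic_deriv (h1 * b / m) (h2 * b^2 / m) (h3 * b^3 / m) x * (y - x)
      \<le> quartic (h1 * b / m) (h2 * b^2 / m) (h3 * b^3 / m) (h4 * b^4 / m) y"
  proof -
    have "A / m + D / m * k \<le> B / m" if "(A + D * k) / m \<le> B / m" for A B D k
      using that by (simp add: add_divide_distrib)
    from this[OF *] show ?thesis unfolding q d .
  qed
qed

lemma quartic_sum_pow4_coeff_bounds:
  fixes t0 u0 t1 u1 X Y :: real
  assumes X: "\<bar>t0\<bar> \<le> X" "\<bar>u0\<bar> \<le> X" and Y: "\<bar>t1\<bar> \<le> Y" "\<bar>u1\<bar> \<le> Y"
  shows "\<bar>4 * (t0^3 * t1 + u0^3 * u1)\<bar> \<le> 8 * (X^3 * Y)"
    "\<bar>6 * (t0^2 * t1^2 + u0^2 * u1^2)\<bar> \<le> 12 * (X^2 * Y^2)"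
proof -
  have XY: "X \<ge> 0" "Y \<ge> 0" using X(1) Y(1) by linarith+
  have m: "\<bar>x^i * y^j\<bar> \<le> X^i * Y^j" if "\<bar>x\<bar> \<le> X" "\<bar>y\<bar> \<le> Y" for x y i j
    unfolding abs_mult power_abs using that XY by (intro mult_mono power_mono) auto
  have h4: "\<bar>4 * (u + v)\<bar> \<le> 8 * T" and h6: "\<bar>6 * (u + v)\<bar> \<le> 12 * T"
    if "\<bar>u\<bar> \<le> T" "\<bar>v\<bar> \<le> T" for u v T :: real
    using that by (auto simp: abs_le_iff)
  show "\<bar>4 * (t0^3 * t1 + u0^3 * u1)\<bar> \<le> 8 * (X^3 * Y)"
    using h4[OF m[OF X(1) Y(1), of 3 1] m[OF X(2) Y(2), of 3 1]] by simp
  show "\<bar>6 * (t0^2 * t1^2 + u0^2 * u1^2)\<bar> \<le> 12 * (X^2 * Y^2)"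
    by (rule h6[OF m[OF X(1) Y(1), of 2 2] m[OF X(2) Y(2), of 2 2]])
qed

lemma sum_pow4_ge: "(t^2 + u^2)^2 \<le> 2 * (t^4 + u^4)" for t u :: "'a::linordered_idom"
proof -
  have "2 * (t^4 + u^4) - (t^2 + u^2)^2 = (t^2 - u^2)^2"
    by (simp add: algebra_simps power2_eq_square power4_eq_xxxx)
  also have "\<dots> \<ge> 0" by simp
  finally show ?thesis by simp
qed

lemma sum_pow4_le: "t^4 + u^4 \<le> (t^2 + u^2)^2" for t u :: "'a::linordered_idom"
proof -
  have "(t^2 + u^2)^2 - (t^4 + u^4) = 2 * (t^2 * u^2)"
    by (simp add: algebra_simps power2_eq_square power4_eq_xxxx)
  also have "\<dots> \<ge> 0" by simp
  finally show ?thesis by simp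
qed

lemma of_int_bform: "of_int (bform a b c d e x y) = bform (of_int a) (of_int b) (of_int c) (of_int d) (of_int e) (of_int x) (of_int y)"
  unfolding bform_def by simp

lemma of_int_bdisc: "of_int (bdisc a b c d e) = bdisc (of_int a) (of_int b) (of_int c) (of_int d) (of_int e)"
  unfolding bdisc_def by simp

text \<open>For the prime already found, a solution with the least value of t^4 + u^4 is taken;
  comparing squared norms with fourth powers costs the factor 2. Minimality will force both
  \<open>(t0,u0)\<close> and its counterpart for the other form to be primitive.\<close>

lemma prime_dvd_sum_pow4_minimal:
  fixes C :: nat
  assumes C: "C > 4"
  shows "\<exists>p t0 u0. prime (p::nat) \<and> t0^4 + u0^4 > 0 \<and> int p dvd t0^4 + u0^4 \<and> int C * (t0^2 + u0^2) \<le> 2 * int p \<and>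
    (\<forall>t u. t^4 + u^4 > 0 \<longrightarrow> int p dvd t^4 + u^4 \<longrightarrow> t0^4 + u0^4 \<le> t^4 + u^4)"
proof -
  obtain p t u where p: "prime p" "(t,u) \<noteq> (0,0)" "int p dvd t^4 + u^4" "int C * (max \<bar>t\<bar> \<bar>u\<bar>)^2 \<le> int p"
    using big_prime_factor[of C] by blast
  have pos: "t^4 + u^4 > 0"
  proof -
    have "t ^ 4 > 0 \<or> u ^ 4 > 0" using p(2) by auto
    moreover have "t ^ 4 \<ge> 0" "u ^ 4 \<ge> 0" by simp_all
    ultimately show ?thesis by linarith
  qed
  define P where "P = (\<lambda>(t::int,u::int). t^4 + u^4 > 0 \<and> int p dvd t^4 + u^4)"
  define f where "f = (\<lambda>(t::int,u::int). nat (t^4 + u^4))"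
  have "P (t,u)" unfolding P_def using pos p(3) by simp
  then obtain v where v: "P v" "\<And>w. P w \<Longrightarrow> f v \<le> f w"
    using ex_has_least_nat[of P "(t,u)" f] by blast
  obtain t0 u0 where tu0: "v = (t0,u0)" by (metis surj_pair)
  have min: "t0^4 + u0^4 \<le> t^4 + u^4" if "t^4 + u^4 > 0" "int p dvd t^4 + u^4" for t u
  proof -
    have "f v \<le> f (t,u)" using v(2)[of "(t,u)"] that unfolding P_def by simp
    thus ?thesis using that(1) unfolding f_def tu0 prod.case by linarith
  qed
  have v0: "t0^4 + u0^4 > 0" "int p dvd t0^4 + u0^4" using v(1) unfolding P_def tu0 by auto
  define M where "M = max \<bar>t\<bar> \<bar>u\<bar>"
  have M: "\<bar>t\<bar> \<le> M" "\<bar>u\<bar> \<le> M" unfolding M_def by auto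
  have "(t0^2 + u0^2)^2 \<le> 2 * (t0^4 + u0^4)" by (rule sum_pow4_ge)
  also have "\<dots> \<le> 2 * (t^4 + u^4)" using min[OF pos p(3)] by simp
  also have "\<dots> = 2 * (\<bar>t\<bar>^4 + \<bar>u\<bar>^4)" by simp
  also have "\<dots> \<le> 2 * (M^4 + M^4)" using M by (intro mult_left_mono add_mono power_mono) auto
  also have "\<dots> = (2 * M^2)^2" by (simp add: power_mult_distrib flip: power_mult)
  finally have "t0^2 + u0^2 \<le> 2 * M^2" by (rule power2_le_imp_le) simp
  hence "int C * (t0^2 + u0^2) \<le> int C * (2 * M^2)" by (intro mult_left_mono) auto
  also have "\<dots> \<le> 2 * int p" using p(4) unfolding M_def by simp
  finally show ?thesis using p(1) v0 min by blast
qed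

text \<open>\<open>b\<close> is a determinant over \<open>p\<close>, bounded by Cauchy-Schwarz; z
  (t0,u0) is the solution minus b (t1,u1), which bounds \<open>z\<close>. What is decomposed is the
  image of \<open>(t,u)\<close> under signs and exchange, since \<open>(t,u)\<close> itself may lie
  in another lattice.\<close>

lemma lattice_solution:
  fixes t0 u0 t1 u1 t u :: int and p :: nat
  assumes p: "prime p" and co: "coprime t0 u0" and det: "t0 * u1 - u0 * t1 = int p"
    and d0: "int p dvd t0^4 + u0^4" and d: "int p dvd t^4 + u^4"
  obtains z b where "(z * t0 + b * t1)^4 + (z * u0 + b * u1)^4 = t^4 + u^4"
    "(b * int p)^2 \<le> (t0^2 + u0^2) * (t^2 + u^2)"
    "z^2 * (t0^2 + u0^2) \<le> 2 * (t^2 + u^2) + 2 * b^2 * (t1^2 + u1^2)"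
proof -
  have ip: "prime (int p)" using p by simp
  have n0: "\<not> (int p dvd t0 \<and> int p dvd u0)"
  proof
    assume "int p dvd t0 \<and> int p dvd u0"
    hence "int p dvd 1" using co coprime_common_divisor by blast
    thus False using ip not_prime_unit by blast
  qed
  obtain t' u' where tu: "t'^4 + u'^4 = t^4 + u^4" "t'^2 + u'^2 = t^2 + u^2" "int p dvd t0 * u' - u0 * t'"
    by (rule quartic_root_align[OF ip d0 d n0])
  obtain z b where zb: "t' = z * t0 + b * t1" "u' = z * u0 + b * u1" "b * int p = t0 * u' - u0 * t'"
    by (rule lattice_coordinates[OF co det tu(3)])
  show ?thesis
  proof (rule that[of z b])
    show "(z * t0 + b * t1)^4 + (z * u0 + b * u1)^4 = t^4 + u^4" using tu(1) unfolding zb(1,2) .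
    have "(t0^2 + u0^2) * (t'^2 + u'^2) - (t0 * u' - u0 * t')^2 = (t0 * t' + u0 * u')^2"
      by (simp add: algebra_simps power2_eq_square)
    moreover have "(t0 * t' + u0 * u')^2 \<ge> 0" by simp
    ultimately show "(b * int p)^2 \<le> (t0^2 + u0^2) * (t^2 + u^2)" unfolding zb(3) tu(2) by linarith
    have sq: "(x - y)^2 \<le> 2 * x^2 + 2 * y^2" for x y :: int
    proof -
      have "2 * x^2 + 2 * y^2 - (x - y)^2 = (x + y)^2" by (simp add: algebra_simps power2_eq_square)
      moreover have "(x + y)^2 \<ge> 0" by simp
      ultimately show ?thesis by linarith
    qed
    have "z^2 * (t0^2 + u0^2) = (t' - b * t1)^2 + (u' - b * u1)^2"
      unfolding zb(1,2) by (simp add: algebra_simps power2_eq_square)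
    also have "\<dots> \<le> (2 * t'^2 + 2 * (b * t1)^2) + (2 * u'^2 + 2 * (b * u1)^2)" by (intro add_mono sq)
    also have "\<dots> = 2 * (t'^2 + u'^2) + 2 * b^2 * (t1^2 + u1^2)" by (simp add: algebra_simps power2_eq_square)
    finally show "z^2 * (t0^2 + u0^2) \<le> 2 * (t^2 + u^2) + 2 * b^2 * (t1^2 + u1^2)" unfolding tu(2) .
  qed
qed

text \<open>The form has been scaled by a common denominator \<open>D\<close>, so its values are D
  (t^4 + u^4). The identity is that of the curve step, homogenised; the substitution on its
  left-hand side has determinant \<open>p\<close>, the later denominator.\<close>

lemma form_matches_at_prime:
  fixes a b c d e D :: int and P :: nat
  assumes D: "D > 0"
    and rep: "\<And>x y. \<exists>t u. bform a b c d e x y = D * (t^4 + u^4)"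
    and rep': "\<And>t u. \<exists>x y. bform a b c d e x y = D * (t^4 + u^4)"
    and disc: "bdisc a b c d e \<noteq> 0"
  obtains p x0 y0 x1 y1 t0 u0 t1 u1 where "prime (p::nat)" "p > P" "x0 * y1 - y0 * x1 = int p"
    "\<And>x y::real. bform (of_int a) (of_int b) (of_int c) (of_int d) (of_int e)
        (x * of_int x0 + y * of_int x1) (x * of_int y0 + y * of_int y1)
      = of_int D * ((x * of_int t0 + y * of_int t1)^4 + (x * of_int u0 + y * of_int u1)^4)"
proof -
  define F where "F = bform (real_of_int a) (real_of_int b) (real_of_int c) (real_of_int d) (real_of_int e)"
  have F_int: "F (of_int x) (of_int y) = real_of_int (bform a b c d e x y)" for x y
    unfolding F_def of_int_bform ..
  have F_scale: "F (s * x) (s * y) = s^4 * F x y" for s x y unfolding F_def by (rule bform_scale)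
  define Dr where "Dr = real_of_int D"
  have Dr: "Dr \<ge> 1" unfolding Dr_def using D by simp
  have nn: "F (of_int x) (of_int y) \<ge> 0" for x y
  proof -
    obtain t u where "bform a b c d e x y = D * (t^4 + u^4)" using rep by blast
    moreover have "D * (t^4 + u^4) \<ge> 0" using D by simp
    ultimately have "bform a b c d e x y \<ge> 0" by simp
    thus ?thesis unfolding F_int by (simp only: of_int_0_le_iff)
  qed
  have discr: "bdisc (real_of_int a) (real_of_int b) (real_of_int c) (real_of_int d) (real_of_int e) \<noteq> 0"
    unfolding of_int_bdisc[symmetric] using disc by simp
  obtain L where L: "L > 0" "\<And>x y. F x y \<ge> L * (x^2 + y^2)^2"
    using bform_lower_bound[OF nn[unfolded F_def] discr] unfolding F_def by blast
  define H where "H = \<bar>real_of_int a\<bar> + \<bar>real_of_int b\<bar> + \<bar>real_of_int c\<bar> + \<bar>real_of_int d\<bar> + \<bar>real_of_int e\<bar>"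
  have Hup: "F x y \<le> H * (x^2 + y^2)^2" for x y unfolding F_def H_def by (rule bform_upper_bound)
  have H0: "H \<ge> 0" unfolding H_def by simp
  have Hc: "\<bar>real_of_int a\<bar> \<le> H" "\<bar>real_of_int b\<bar> \<le> H" "\<bar>real_of_int c\<bar> \<le> H" "\<bar>real_of_int d\<bar> \<le> H" "\<bar>real_of_int e\<bar> \<le> H"
    unfolding H_def by simp_all
  \<comment> \<open>\<open>E1\<close> and \<open>E2\<close> compare the squared norms n and n' of
    the two short vectors, \<open>M\<close> bounds the coefficients of \<phi>, \<open>E3\<close> the
    squared norm of a solution in units of k^2 n, \<open>B\<close> the coordinate b, and
    \<open>E4\<close> the coordinate z in units of k. \<open>N\<close> majorises the bounds on the
    side of \<gamma>.\<close>
  define E1 where "E1 = Dr / L + 1"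
  define E2 where "E2 = 2 * H + 1"
  define M where "M = 160 * H / L + 1"
  define E3 where "E3 = (2 * H + 1) * (1152 * M^2 + 4)"
  define B where "B = nat \<lceil>E2 * E3\<rceil>"
  define E4 where "E4 = 2 * (E3 * E1 + 2 * real B^2 * E1^2) + 1"
  define N where "N = 1 + 32 * real B * E1 + 96 * real B^2 * E1^2 + E4"
  have E1: "E1 \<ge> 1" unfolding E1_def using Dr L by simp
  have E2: "E2 \<ge> 1" unfolding E2_def using H0 by simp
  have M: "M \<ge> 1" unfolding M_def using H0 L by simp
  have E3: "E3 \<ge> 0" unfolding E3_def using H0 by simp
  have E4: "E4 \<ge> 1" unfolding E4_def using E3 E1 by simp
  have N: "N \<ge> 1" "E4 \<le> N" "32 * real B * E1 \<le> N" "96 * real B^2 * E1^2 \<le> N"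
    unfolding N_def using E1 E4 by simp_all
  obtain k0 where k0: "k0 \<ge> 1" and curve: "\<And>k c1 c2 c3 c4 g1 g2 g3 g4. k > k0 \<Longrightarrow>
    \<bar>c1\<bar> \<le> M * k \<Longrightarrow> \<bar>c2\<bar> \<le> M * k^2 \<Longrightarrow> \<bar>c3\<bar> \<le> M * k^3 \<Longrightarrow>
    (\<forall>b. \<bar>b\<bar> \<le> int B \<longrightarrow> \<bar>g1 b\<bar> \<le> N * k \<and> \<bar>g2 b\<bar> \<le> N * k^2) \<Longrightarrow>
    (\<forall>b x y. quartic (g1 b) (g2 b) (g3 b) (g4 b) x + quartic_deriv (g1 b) (g2 b) (g3 b) x * (y - x)
        \<le> quartic (g1 b) (g2 b) (g3 b) (g4 b) y) \<Longrightarrow>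
    (\<forall>a::int. 12 * M * k \<le> real_of_int a \<longrightarrow> real_of_int a \<le> 24 * M * k \<longrightarrow>
       (\<exists>b z::int. \<bar>b\<bar> \<le> int B \<and> \<bar>real_of_int z\<bar> \<le> N * k \<and>
         quartic c1 c2 c3 c4 (real_of_int a) = quartic (g1 b) (g2 b) (g3 b) (g4 b) (real_of_int z))) \<Longrightarrow>
    (\<exists>b r s::int. (r = 1 \<or> r = -1) \<and>
      (\<forall>x. quartic c1 c2 c3 c4 x = quartic (g1 b) (g2 b) (g3 b) (g4 b) (real_of_int r * x + real_of_int s)))"
    using quartic_curve_points_large[OF M N(1), of B] by metis
  \<comment> \<open>Large enough for k = p / n to exceed \<open>k0\<close> and for \<open>p\<close>
    to exceed both \<open>P\<close> and \<open>D\<close>; the latter makes \<open>p\<close> prime to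
    \<open>D\<close>.\<close>
  define C where "C = nat \<lceil>2 * E1 * k0\<rceil> + 2 * (P + nat D) + 5"
  have C: "real C > 2 * E1 * k0" "C > 4" "C > 2 * (P + nat D)"
  proof -
    have "2 * E1 * k0 \<le> real (nat \<lceil>2 * E1 * k0\<rceil>)" by (rule real_nat_ceiling_ge)
    thus "real C > 2 * E1 * k0" unfolding C_def by simp
  qed (simp_all add: C_def)
  obtain p t0 u0 where p: "prime (p::nat)" and m0: "t0^4 + u0^4 > 0" and pm: "int p dvd t0^4 + u0^4"
    and Cp: "int C * (t0^2 + u0^2) \<le> 2 * int p"
    and min: "\<And>t u. t^4 + u^4 > 0 \<Longrightarrow> int p dvd t^4 + u^4 \<Longrightarrow> t0^4 + u0^4 \<le> t^4 + u^4"
    using prime_dvd_sum_pow4_minimal[OF C(2)] by blast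
  define m where "m = t0^4 + u0^4"
  define n' where "n' = t0^2 + u0^2"
  have ip: "prime (int p)" using p by simp
  have n'1: "n' \<ge> 1"
  proof -
    have "t0 \<noteq> 0 \<or> u0 \<noteq> 0" using m0 by auto
    hence "n' > 0" unfolding n'_def by (simp add: sum_power2_gt_zero_iff)
    thus ?thesis by simp
  qed
  have Cp2: "int C \<le> 2 * int p"
  proof -
    have "int C * 1 \<le> int C * n'" using n'1 by (intro mult_left_mono) auto
    thus ?thesis using Cp unfolding n'_def by linarith
  qed
  hence "int C \<le> int (2 * p)" by simp
  hence "C \<le> 2 * p" by (simp only: of_nat_le_iff)
  hence P2: "p > P + nat D" using C(3) by presburger
  hence pP: "p > P" "int p > D" by linarith+
  have n'p: "2 * n' < int p"
  proof -
    have "5 * n' \<le> int C * n'" using C(2) n'1 by (intro mult_right_mono) auto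
    thus ?thesis using Cp n'1 unfolding n'_def[symmetric] by linarith
  qed
  obtain x0 y0 where xy0: "bform a b c d e x0 y0 = D * m" using rep' unfolding m_def by blast
  define n where "n = x0^2 + y0^2"
  have Fv: "F (of_int x0) (of_int y0) = Dr * real_of_int m" unfolding F_int xy0 Dr_def by simp
  have mr: "real_of_int m \<le> real_of_int n' ^ 2" "real_of_int n' ^ 2 \<le> 2 * real_of_int m"
  proof -
    have "m \<le> n'^2" "n'^2 \<le> 2 * m" unfolding m_def n'_def by (rule sum_pow4_le, rule sum_pow4_ge)
    thus "real_of_int m \<le> real_of_int n' ^ 2" "real_of_int n' ^ 2 \<le> 2 * real_of_int m"
      by (metis of_int_le_iff of_int_power, metis of_int_le_iff of_int_mult of_int_numeral of_int_power)
  qed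
  have nr: "real_of_int n = (real_of_int x0)^2 + (real_of_int y0)^2" unfolding n_def by simp
  have Ln: "L * real_of_int n ^ 2 \<le> Dr * real_of_int m" using L(2)[of "of_int x0" "of_int y0"] unfolding Fv nr .
  have n1: "n \<ge> 1"
  proof -
    have "n \<noteq> 0"
    proof
      assume "n = 0"
      hence "x0 = 0" "y0 = 0" unfolding n_def by (simp_all add: sum_power2_eq_zero_iff)
      hence "D * m = 0" using xy0 by (simp add: bform_def)
      thus False using D m0 unfolding m_def by simp
    qed
    moreover have "n \<ge> 0" unfolding n_def by simp
    ultimately show ?thesis by simp
  qed
  have nE: "real_of_int n \<le> E1 * real_of_int n'"
  proof (rule power2_le_imp_le)
    have "L * real_of_int n ^ 2 \<le> Dr * real_of_int n' ^ 2"
      using Ln mult_left_mono[OF mr(1), of Dr] Dr by linarith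
    hence "real_of_int n ^ 2 \<le> (Dr / L) * real_of_int n' ^ 2" using L(1) by (simp add: field_simps)
    also have "\<dots> \<le> E1^2 * real_of_int n' ^ 2"
    proof (rule mult_right_mono)
      have "Dr / L \<le> E1" unfolding E1_def by simp
      also have "E1 \<le> E1^2" using E1 by (simp add: power2_eq_square)
      finally show "Dr / L \<le> E1^2" .
    qed simp
    finally show "real_of_int n ^ 2 \<le> (E1 * real_of_int n')^2" by (simp add: power_mult_distrib)
    show "0 \<le> E1 * real_of_int n'" using E1 n'1 by simp
  qed
  have nE': "real_of_int n' \<le> E2 * real_of_int n"
  proof (rule power2_le_imp_le)
    have "Dr * real_of_int m \<le> H * real_of_int n ^ 2"
      using Hup[of "of_int x0" "of_int y0"] unfolding Fv nr .
    moreover have "1 * real_of_int m \<le> Dr * real_of_int m" using Dr m0 unfolding m_def by (intro mult_right_mono) auto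
    ultimately have "real_of_int n' ^ 2 \<le> 2 * H * real_of_int n ^ 2" using mr(2) by linarith
    also have "\<dots> \<le> E2^2 * real_of_int n ^ 2"
    proof (rule mult_right_mono)
      have "2 * H \<le> E2" unfolding E2_def by simp
      also have "E2 \<le> E2^2" using E2 by (simp add: power2_eq_square)
      finally show "2 * H \<le> E2^2" .
    qed simp
    finally show "real_of_int n' ^ 2 \<le> (E2 * real_of_int n)^2" by (simp add: power_mult_distrib)
    show "0 \<le> E2 * real_of_int n" using E2 n1 by simp
  qed
  \<comment> \<open>The skewness of the lattice of the form: its second basis vector is about
    \<open>k\<close> times as long as the first.\<close>
  define k where "k = real p / real_of_int n"
  have nr0: "real_of_int n \<ge> 1" "real_of_int n' \<ge> 1" using n1 n'1 by simp_all
  have pk: "real p = k * real_of_int n" unfolding k_def using nr0 by simp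
  have kk: "k > k0"
  proof -
    have "real_of_int (int C * n') \<le> real_of_int (2 * int p)" using Cp unfolding n'_def by (simp only: of_int_le_iff)
    hence Cr: "real C * real_of_int n' \<le> 2 * real p" by simp
    have "2 * E1 * k0 * real_of_int n' < real C * real_of_int n'" using C(1) nr0 by (intro mult_strict_right_mono) auto
    hence "E1 * k0 * real_of_int n' < real p" using Cr by simp
    moreover have "k0 * real_of_int n \<le> k0 * (E1 * real_of_int n')" using nE k0 by (intro mult_left_mono) auto
    ultimately have "k0 * real_of_int n < k * real_of_int n" unfolding pk by (simp add: mult_ac)
    thus ?thesis using nr0 by simp
  qed
  have k1: "k > 1" using kk k0 by simp
  have np: "n \<le> int p"
  proof -
    have "1 * real_of_int n \<le> k * real_of_int n" using k1 nr0 by (intro mult_right_mono) auto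
    thus ?thesis unfolding pk[symmetric] by simp
  qed
  \<comment> \<open>The quotient of \<open>m\<close> by g^4 is again a sum of two fourth powers and,
    \<open>g\<close> being below \<open>p\<close>, still divisible by \<open>p\<close>; minimality
    of \<open>m\<close> forces g = 1.\<close>
  have small: "g = 1" if gg: "g > 0" "g^4 dvd m" "\<And>g'. m = g^4 * g' \<Longrightarrow> \<exists>t u. g' = t^4 + u^4" "g < int p" for g
  proof -
    obtain g' where g': "m = g^4 * g'" using gg(2) by blast
    obtain t u where tu: "g' = t^4 + u^4" using gg(3)[OF g'] by blast
    have "g' > 0" using g' m0 gg(1) unfolding m_def by (metis zero_less_mult_pos zero_less_power)
    have "\<not> int p dvd g" using gg(1,4) zdvd_imp_le by fastforce
    hence "\<not> int p dvd g^4" using ip prime_dvd_power by blast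
    hence "int p dvd g'" using pm g' ip prime_dvd_mult_iff unfolding m_def by metis
    hence "m \<le> g'" using min[of t u] \<open>g' > 0\<close> unfolding tu m_def by blast
    hence "g^4 * g' \<le> 1 * g'" using g' by simp
    hence "g^4 \<le> 1" using \<open>g' > 0\<close> by (simp only: mult_le_cancel_right_pos)
    show "g = 1"
    proof (rule ccontr)
      assume "g \<noteq> 1"
      hence "2 \<le> g" using gg(1) by simp
      hence "2^4 \<le> g^4" by (intro power_mono) auto
      thus False using \<open>g^4 \<le> 1\<close> by simp
    qed
  qed
  have sq_le: "g < int p" if "g > 0" "g dvd x" "g dvd y" "x^2 + y^2 \<le> int p" "x^2 + y^2 > 0" for g x y :: int
  proof -
    have "g^2 dvd x^2 + y^2" using that by (intro dvd_add) (auto intro: dvd_power_same)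
    hence "g^2 \<le> x^2 + y^2" using that by (intro zdvd_imp_le)
    hence "g^2 \<le> int p" using that by simp
    moreover have "g < g^2 \<or> g = 1" using that(1) by (cases "g = 1") (auto simp: power2_eq_square)
    moreover have "int p > 1" using p prime_gt_1_nat by simp
    ultimately show ?thesis by linarith
  qed
  have co': "coprime t0 u0"
  proof -
    define g where "g = gcd t0 u0"
    have g0: "g > 0" unfolding g_def using n'1 unfolding n'_def by auto
    obtain i j where ij: "t0 = g * i" "u0 = g * j" unfolding g_def by (metis dvdE gcd_dvd1 gcd_dvd2)
    have mg: "m = g^4 * (i^4 + j^4)" unfolding m_def ij by (simp add: algebra_simps)
    have "g = 1"
    proof (rule small[OF g0])
      show "g^4 dvd m" unfolding mg by simp
      show "\<exists>t u. g' = t^4 + u^4" if "m = g^4 * g'" for g'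
      proof -
        have "g' = i^4 + j^4" using that mg g0 by simp
        thus ?thesis by blast
      qed
      show "g < int p" by (rule sq_le[OF g0, of t0 u0]) (use n'1 n'p in \<open>auto simp: g_def n'_def\<close>)
    qed
    thus ?thesis unfolding g_def by (simp add: coprime_iff_gcd_eq_1)
  qed
  have co: "coprime x0 y0"
  proof -
    define g where "g = gcd x0 y0"
    have g0: "g > 0" unfolding g_def using n1 unfolding n_def by auto
    obtain i j where ij: "x0 = g * i" "y0 = g * j" unfolding g_def by (metis dvdE gcd_dvd1 gcd_dvd2)
    \<comment> \<open>The value at the point divided by its gcd is again D times a sum of two fourth
      powers, so minimality on the side of t^4 + u^4 applies here too.\<close>
    obtain t u where tu: "bform a b c d e i j = D * (t^4 + u^4)" using rep by blast
    have "bform a b c d e x0 y0 = g^4 * (D * (t^4 + u^4))" unfolding ij bform_scale tu ..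
    hence "D * m = g^4 * (D * (t^4 + u^4))" unfolding xy0 .
    hence "D * m = D * (g^4 * (t^4 + u^4))" by (simp only: mult.left_commute)
    hence mg: "m = g^4 * (t^4 + u^4)" using D by simp
    have "g = 1"
    proof (rule small[OF g0])
      show "g^4 dvd m" unfolding mg by simp
      show "\<exists>t u. g' = t^4 + u^4" if "m = g^4 * g'" for g'
      proof -
        have "g' = t^4 + u^4" using that mg g0 by simp
        thus ?thesis by blast
      qed
      show "g < int p" by (rule sq_le[OF g0, of x0 y0]) (use n1 np in \<open>auto simp: g_def n_def\<close>)
    qed
    thus ?thesis unfolding g_def by (simp add: coprime_iff_gcd_eq_1)
  qed
  obtain x1 y1 where det: "x0 * y1 - y0 * x1 = int p" and v1: "(x1^2 + y1^2) * n \<le> 2 * (int p)^2"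
    using reduced_complement[OF co, of "int p"] np unfolding n_def by blast
  obtain t1 u1 where det': "t0 * u1 - u0 * t1 = int p" and w1: "(t1^2 + u1^2) * n' \<le> 2 * (int p)^2"
    using reduced_complement[OF co', of "int p"] n'p n'1 unfolding n'_def by (smt (verit))
  define n1r where "n1r = (real_of_int x1)^2 + (real_of_int y1)^2"
  define n1r' where "n1r' = (real_of_int t1)^2 + (real_of_int u1)^2"
  have n1r: "n1r \<le> 2 * k^2 * real_of_int n"
  proof -
    have "real_of_int ((x1^2 + y1^2) * n) \<le> real_of_int (2 * (int p)^2)" using v1 by (simp only: of_int_le_iff)
    hence "n1r * real_of_int n \<le> 2 * (k * real_of_int n)^2" unfolding n1r_def pk[symmetric] by simp
    also have "\<dots> = (2 * k^2 * real_of_int n) * real_of_int n" by (simp add: power2_eq_square)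
    finally show ?thesis using nr0 by (simp add: mult_le_cancel_right)
  qed
  define k' where "k' = real p / real_of_int n'"
  have pk': "real p = k' * real_of_int n'" unfolding k'_def using nr0 by simp
  have k'0: "k' \<ge> 0" unfolding k'_def using nr0 by simp
  have k'E: "k' \<le> E1 * k"
  proof -
    have "k * real_of_int n \<le> k * (E1 * real_of_int n')" using nE k1 by (intro mult_left_mono) auto
    hence "k' * real_of_int n' \<le> (E1 * k) * real_of_int n'" unfolding pk'[symmetric] pk by (simp add: mult_ac)
    thus ?thesis using nr0 by (simp add: mult_le_cancel_right)
  qed
  have n1r': "n1r' \<le> 2 * k'^2 * real_of_int n'"
  proof -
    have "real_of_int ((t1^2 + u1^2) * n') \<le> real_of_int (2 * (int p)^2)" using w1 by (simp only: of_int_le_iff)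
    hence "n1r' * real_of_int n' \<le> 2 * (k' * real_of_int n')^2" unfolding n1r'_def pk'[symmetric] by simp
    also have "\<dots> = (2 * k'^2 * real_of_int n') * real_of_int n'" by (simp add: power2_eq_square)
    finally show ?thesis using nr0 by (simp add: mult_le_cancel_right)
  qed
  define X where "X = sqrt (real_of_int n)"
  define X' where "X' = sqrt (real_of_int n')"
  have X2: "X^2 = real_of_int n" "X'^2 = real_of_int n'" "X > 0" "X' > 0"
    unfolding X_def X'_def using nr0 by auto
  have bX: "\<bar>real_of_int x0\<bar> \<le> X" "\<bar>real_of_int y0\<bar> \<le> X"
    unfolding X_def nr by (rule real_le_rsqrt; simp)+
  have bX': "\<bar>real_of_int t0\<bar> \<le> X'" "\<bar>real_of_int u0\<bar> \<le> X'"
    unfolding X'_def n'_def by (rule real_le_rsqrt; simp)+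
  have bY: "\<bar>real_of_int x1\<bar> \<le> 2 * k * X" "\<bar>real_of_int y1\<bar> \<le> 2 * k * X"
  proof -
    have e: "(2 * k * X)^2 = 4 * (k^2 * real_of_int n)" by (simp add: power_mult_distrib X2)
    have "k^2 * real_of_int n \<ge> 0" using nr0 by simp
    hence "n1r \<le> (2 * k * X)^2" using n1r unfolding e by simp
    moreover have "(real_of_int x1)^2 \<le> n1r" "(real_of_int y1)^2 \<le> n1r" unfolding n1r_def by simp_all
    ultimately have "\<bar>real_of_int x1\<bar>^2 \<le> (2 * k * X)^2" "\<bar>real_of_int y1\<bar>^2 \<le> (2 * k * X)^2" by simp_all
    moreover have "2 * k * X \<ge> 0" using k1 X2 by simp
    ultimately show "\<bar>real_of_int x1\<bar> \<le> 2 * k * X" "\<bar>real_of_int y1\<bar> \<le> 2 * k * X" by - (rule power2_le_imp_le; assumption)+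
  qed
  have bY': "\<bar>real_of_int t1\<bar> \<le> 2 * k' * X'" "\<bar>real_of_int u1\<bar> \<le> 2 * k' * X'"
  proof -
    have e: "(2 * k' * X')^2 = 4 * (k'^2 * real_of_int n')" by (simp add: power_mult_distrib X2)
    have "k'^2 * real_of_int n' \<ge> 0" using nr0 by simp
    hence "n1r' \<le> (2 * k' * X')^2" using n1r' unfolding e by simp
    moreover have "(real_of_int t1)^2 \<le> n1r'" "(real_of_int u1)^2 \<le> n1r'" unfolding n1r'_def by simp_all
    ultimately have "\<bar>real_of_int t1\<bar>^2 \<le> (2 * k' * X')^2" "\<bar>real_of_int u1\<bar>^2 \<le> (2 * k' * X')^2" by simp_all
    moreover have "2 * k' * X' \<ge> 0" using k'0 X2 by simp
    ultimately show "\<bar>real_of_int t1\<bar> \<le> 2 * k' * X'" "\<bar>real_of_int u1\<bar> \<le> 2 * k' * X'" by - (rule power2_le_imp_le; assumption)+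
  qed
  obtain c1 c2 c3 c4 where cexp: "\<And>x y. F (x * of_int x0 + y * of_int x1) (x * of_int y0 + y * of_int y1)
      = F (of_int x0) (of_int y0) * x^4 + c1 * x^3 * y + c2 * x^2 * y^2 + c3 * x * y^3 + c4 * y^4"
    and c1: "\<bar>c1\<bar> \<le> 20 * H * (X^3 * (2 * k * X))" and c2: "\<bar>c2\<bar> \<le> 30 * H * (X^2 * (2 * k * X)^2)"
    and c3: "\<bar>c3\<bar> \<le> 20 * H * (X * (2 * k * X)^3)"
    unfolding F_def using bform_expand[OF Hc bX bY] by blast
  define Q where "Q = Dr * real_of_int m"
  have mpos: "real_of_int m > 0" using m0 unfolding m_def[symmetric] by (simp only: of_int_0_less_iff)
  have Q0: "Q > 0" unfolding Q_def using Dr mpos by simp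
  have X4: "X^4 = real_of_int n ^ 2"
  proof -
    have "X^4 = (X^2)^2" by (simp flip: power_mult)
    thus ?thesis unfolding X2 .
  qed
  have LQ: "L * X^4 \<le> Q" unfolding X4 Q_def by (rule Ln)
  \<comment> \<open>Division by Q = D m is controlled by L X^4 \<le> Q: this is where definiteness
    bounds the coefficients of \<phi>.\<close>
  have coef: "\<bar>c / Q\<bar> \<le> M * s" if "\<bar>c\<bar> \<le> 160 * H * s * X^4" "s \<ge> 0" for c s
  proof -
    have "\<bar>c\<bar> \<le> (160 * H / L * s) * (L * X^4)" using that(1) L(1) by simp
    also have "\<dots> \<le> (160 * H / L * s) * Q" using LQ H0 L(1) that(2) by (intro mult_left_mono) auto
    also have "\<dots> \<le> M * s * Q" unfolding M_def using that(2) Q0 by (intro mult_right_mono) auto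
    finally show ?thesis using Q0 by (simp add: abs_divide pos_divide_le_eq)
  qed
  have ph1: "\<bar>c1 / Q\<bar> \<le> M * k"
  proof (rule coef)
    have "20 * H * (X^3 * (2 * k * X)) = 40 * H * k * X^4" by (simp add: power3_eq_cube power4_eq_xxxx)
    also have "\<dots> \<le> 160 * H * k * X^4" using H0 k1 by (intro mult_right_mono) auto
    finally show "\<bar>c1\<bar> \<le> 160 * H * k * X^4" using c1 by linarith
  qed (use k1 in simp)
  have ph2: "\<bar>c2 / Q\<bar> \<le> M * k^2"
  proof (rule coef)
    have "30 * H * (X^2 * (2 * k * X)^2) = 120 * H * k^2 * X^4" by (simp add: power2_eq_square power4_eq_xxxx)
    also have "\<dots> \<le> 160 * H * k^2 * X^4" using H0 k1 by (intro mult_right_mono) auto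
    finally show "\<bar>c2\<bar> \<le> 160 * H * k^2 * X^4" using c2 by linarith
  qed simp
  have ph3: "\<bar>c3 / Q\<bar> \<le> M * k^3"
  proof (rule coef)
    have "20 * H * (X * (2 * k * X)^3) = 160 * H * k^3 * X^4" by (simp add: power3_eq_cube power4_eq_xxxx)
    thus "\<bar>c3\<bar> \<le> 160 * H * k^3 * X^4" using c3 by linarith
  qed (use k1 in simp)
  define h1 h2 h3 h4 :: real where
    "h1 = 4 * ((of_int t0)^3 * of_int t1 + (of_int u0)^3 * of_int u1)"
    and "h2 = 6 * ((of_int t0)^2 * (of_int t1)^2 + (of_int u0)^2 * (of_int u1)^2)"
    and "h3 = 4 * (of_int t0 * (of_int t1)^3 + of_int u0 * (of_int u1)^3)"
    and "h4 = (of_int t1)^4 + (of_int u1)^4"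
  define mr where "mr = (real_of_int t0)^4 + (real_of_int u0)^4"
  have mrm: "mr = real_of_int m" unfolding mr_def m_def by simp
  have mr0: "mr > 0" unfolding mrm by (rule mpos)
  define g1 g2 g3 g4 where "g1 b = h1 * real_of_int b / mr" and "g2 b = h2 * (real_of_int b)^2 / mr"
    and "g3 b = h3 * (real_of_int b)^3 / mr" and "g4 b = h4 * (real_of_int b)^4 / mr" for b :: int
  have geq: "quartic (g1 b) (g2 b) (g3 b) (g4 b) z
      = ((z * of_int t0 + of_int b * of_int t1)^4 + (z * of_int u0 + of_int b * of_int u1)^4) / mr" for b z
    unfolding g1_def g2_def g3_def g4_def h1_def h2_def h3_def h4_def mr_def
    by (rule quartic_sum_pow4_eq) (use mr0 mr_def in simp)
  have conv: "quartic (g1 b) (g2 b) (g3 b) (g4 b) x + quartic_deriv (g1 b) (g2 b) (g3 b) x * (y - x)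
        \<le> quartic (g1 b) (g2 b) (g3 b) (g4 b) y" for b x y
    unfolding g1_def g2_def g3_def g4_def h1_def h2_def h3_def h4_def mr_def
    by (rule quartic_sum_pow4_convex) (use mr0 mr_def in simp)
  have X'4: "X'^4 \<le> 2 * mr"
  proof -
    have "X'^4 = (X'^2)^2" by (simp flip: power_mult)
    thus ?thesis unfolding X2 mrm using mr(2) by simp
  qed
  have gb: "\<bar>g1 b\<bar> \<le> N * k" "\<bar>g2 b\<bar> \<le> N * k^2" if "\<bar>b\<bar> \<le> int B" for b
  proof -
    have br: "\<bar>real_of_int b\<bar> \<le> real B" using that by linarith
    have "\<bar>h1\<bar> \<le> 8 * (X'^3 * (2 * k' * X'))" unfolding h1_def by (rule quartic_sum_pow4_coeff_bounds[OF bX' bY'])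
    also have "\<dots> = 16 * k' * X'^4" by (simp add: power3_eq_cube power4_eq_xxxx)
    also have "\<dots> \<le> 16 * k' * (2 * mr)" using X'4 k'0 by (intro mult_left_mono) auto
    finally have "\<bar>h1\<bar> \<le> 32 * k' * mr" by simp
    hence "\<bar>h1\<bar> * \<bar>real_of_int b\<bar> \<le> 32 * k' * mr * real B" using br k'0 mr0 by (intro mult_mono) auto
    hence "\<bar>g1 b\<bar> \<le> 32 * k' * real B" unfolding g1_def using mr0 by (simp add: abs_mult pos_divide_le_eq mult_ac)
    also have "\<dots> \<le> 32 * (E1 * k) * real B" using k'E by (intro mult_right_mono mult_left_mono) auto
    also have "\<dots> = (32 * real B * E1) * k" by simp
    also have "\<dots> \<le> N * k" using N(3) k1 by (intro mult_right_mono) auto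
    finally show "\<bar>g1 b\<bar> \<le> N * k" .
    have "\<bar>h2\<bar> \<le> 12 * (X'^2 * (2 * k' * X')^2)" unfolding h2_def by (rule quartic_sum_pow4_coeff_bounds[OF bX' bY'])
    also have "\<dots> = 48 * k'^2 * X'^4" by (simp add: power2_eq_square power4_eq_xxxx)
    also have "\<dots> \<le> 48 * k'^2 * (2 * mr)" using X'4 by (intro mult_left_mono) auto
    finally have "\<bar>h2\<bar> \<le> 96 * k'^2 * mr" by simp
    moreover have "(real_of_int b)^2 \<le> real B ^ 2" using br by (simp add: abs_le_square_iff[symmetric])
    ultimately have "\<bar>h2\<bar> * (real_of_int b)^2 \<le> 96 * k'^2 * mr * real B^2" using mr0 by (intro mult_mono) auto
    hence "\<bar>g2 b\<bar> \<le> 96 * real B^2 * k'^2" unfolding g2_def using mr0 by (simp add: abs_mult pos_divide_le_eq mult_ac)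
    also have "\<dots> \<le> 96 * real B^2 * (E1 * k)^2" using k'E k'0 by (intro mult_left_mono power_mono) auto
    also have "\<dots> = (96 * real B^2 * E1^2) * k^2" by (simp add: power_mult_distrib)
    also have "\<dots> \<le> N * k^2" using N(4) by (intro mult_right_mono) auto
    finally show "\<bar>g2 b\<bar> \<le> N * k^2" .
  qed
  have phi: "quartic (c1/Q) (c2/Q) (c3/Q) (c4/Q) x = F (x * of_int x0 + of_int x1) (x * of_int y0 + of_int y1) / Q" for x
  proof -
    have "F (x * of_int x0 + of_int x1) (x * of_int y0 + of_int y1) = Q * x^4 + c1 * x^3 + c2 * x^2 + c3 * x + c4"
      using cexp[of x 1] unfolding Fv Q_def by simp
    thus ?thesis unfolding quartic_def using Q0 by (simp add: add_divide_distrib)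
  qed
  have sol: "\<exists>b z::int. \<bar>b\<bar> \<le> int B \<and> \<bar>real_of_int z\<bar> \<le> N * k \<and>
         quartic (c1/Q) (c2/Q) (c3/Q) (c4/Q) (real_of_int i) = quartic (g1 b) (g2 b) (g3 b) (g4 b) (real_of_int z)"
    if i: "12 * M * k \<le> real_of_int i" "real_of_int i \<le> 24 * M * k" for i :: int
  proof -
    \<comment> \<open>A vector having determinant \<open>p\<close> with \<open>(x0,y0)\<close>, so
      \<open>p\<close> divides the value there; that value is D (t^4 + u^4), and the solution is
      expressed in the basis on the other side.\<close>
    define x y where "x = i * x0 + x1" and "y = i * y0 + y1"
    have "x0 * y - y0 * x = int p" unfolding x_def y_def using det by (simp add: algebra_simps)
    hence pd: "int p dvd x0 * y - y0 * x" by simp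
    have "\<not> (int p dvd x0 \<and> int p dvd y0)"
      using co coprime_common_divisor[of x0 y0 "int p"] ip not_prime_unit by blast
    moreover have "int p dvd bform a b c d e x0 y0" unfolding xy0 m_def using pm by simp
    ultimately have pF: "int p dvd bform a b c d e x y" using prime_dvd_bform[OF ip _ _ pd] by blast
    obtain t u where tu: "bform a b c d e x y = D * (t^4 + u^4)" using rep by blast
    have "\<not> int p dvd D" using pP(2) D zdvd_imp_le by fastforce
    hence ptu: "int p dvd t^4 + u^4" using pF tu ip prime_dvd_mult_iff by metis
    obtain z b' where zb: "(z * t0 + b' * t1)^4 + (z * u0 + b' * u1)^4 = t^4 + u^4"
      "(b' * int p)^2 \<le> n' * (t^2 + u^2)" "z^2 * n' \<le> 2 * (t^2 + u^2) + 2 * b'^2 * (t1^2 + u1^2)"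
      unfolding n'_def by (rule lattice_solution[OF p co' det' pm ptu])
    define nv where "nv = (real_of_int x)^2 + (real_of_int y)^2"
    define nt where "nt = (real_of_int t)^2 + (real_of_int u)^2"
    have nv0: "nv \<ge> 0" unfolding nv_def by simp
    have nt0: "nt \<ge> 0" unfolding nt_def by simp
    have i2: "(real_of_int i)^2 \<le> 576 * M^2 * k^2"
    proof -
      have "0 \<le> 12 * M * k" using M k1 by simp
      hence "(real_of_int i)^2 \<le> (24 * M * k)^2" using i by (intro power_mono) auto
      thus ?thesis by (simp add: power_mult_distrib)
    qed
    have nv: "nv \<le> (1152 * M^2 + 4) * k^2 * real_of_int n"
    proof -
      have sq: "(u + v)^2 \<le> 2 * u^2 + 2 * v^2" for u v :: real
      proof -
        have "2 * u^2 + 2 * v^2 - (u + v)^2 = (u - v)^2" by (simp add: algebra_simps power2_eq_square)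
        moreover have "(u - v)^2 \<ge> 0" by simp
        ultimately show ?thesis by linarith
      qed
      have "nv = (of_int i * of_int x0 + of_int x1)^2 + (of_int i * of_int y0 + of_int y1)^2"
        unfolding nv_def x_def y_def by simp
      also have "\<dots> \<le> (2 * (of_int i * of_int x0)^2 + 2 * (of_int x1)^2) + (2 * (of_int i * of_int y0)^2 + 2 * (of_int y1)^2)"
        by (intro add_mono sq)
      also have "\<dots> = 2 * ((real_of_int i)^2 * real_of_int n) + 2 * n1r"
        unfolding nr n1r_def by (simp add: algebra_simps)
      also have "\<dots> \<le> 2 * (576 * M^2 * k^2 * real_of_int n) + 2 * (2 * k^2 * real_of_int n)"
        using i2 n1r nr0 by (intro add_mono mult_left_mono mult_right_mono) auto
      also have "\<dots> = (1152 * M^2 + 4) * k^2 * real_of_int n" by (simp add: algebra_simps)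
      finally show ?thesis .
    qed
    have Ftu: "F (of_int x) (of_int y) = Dr * ((real_of_int t)^4 + (real_of_int u)^4)"
      unfolding F_int tu Dr_def by simp
    have nt: "nt \<le> E3 * k^2 * real_of_int n"
    proof -
      have "1 * ((real_of_int t)^4 + (real_of_int u)^4) \<le> Dr * ((real_of_int t)^4 + (real_of_int u)^4)"
        using Dr by (intro mult_right_mono) auto
      also have "\<dots> \<le> H * nv^2" unfolding Ftu[symmetric] nv_def by (rule Hup)
      finally have "2 * ((real_of_int t)^4 + (real_of_int u)^4) \<le> 2 * (H * nv^2)" by simp
      with sum_pow4_ge[of "real_of_int t" "real_of_int u"] have "nt^2 \<le> 2 * (H * nv^2)"
        unfolding nt_def by (rule order.trans)
      hence "nt^2 \<le> 2 * H * nv^2" by simp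
      also have "\<dots> \<le> E2^2 * nv^2"
      proof (rule mult_right_mono)
        have "2 * H \<le> E2" unfolding E2_def by simp
        also have "E2 \<le> E2^2" using E2 by (simp add: power2_eq_square)
        finally show "2 * H \<le> E2^2" .
      qed simp
      finally have "nt^2 \<le> (E2 * nv)^2" by (simp add: power_mult_distrib)
      hence "nt \<le> E2 * nv" by (rule power2_le_imp_le) (use E2 nv0 in simp)
      also have "\<dots> \<le> E2 * ((1152 * M^2 + 4) * k^2 * real_of_int n)" using nv E2 by (intro mult_left_mono) auto
      also have "\<dots> = E3 * k^2 * real_of_int n" unfolding E3_def E2_def by simp
      finally show ?thesis .
    qed
    have b2: "(real_of_int b')^2 \<le> E2 * E3"
    proof -
      have "real_of_int ((b' * int p)^2) \<le> real_of_int (n' * (t^2 + u^2))" using zb(2) by (simp only: of_int_le_iff)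
      hence "(real_of_int b')^2 * (real p)^2 \<le> real_of_int n' * nt" unfolding nt_def by (simp add: power_mult_distrib)
      also have "\<dots> \<le> (E2 * real_of_int n) * (E3 * k^2 * real_of_int n)"
        using nE' nt nt0 nr0 E2 by (intro mult_mono) auto
      also have "\<dots> = E2 * E3 * (real p)^2" unfolding pk by (simp add: power2_eq_square)
      finally show ?thesis using p by (simp add: mult_le_cancel_right prime_gt_0_nat)
    qed
    have bB: "\<bar>b'\<bar> \<le> int B"
    proof -
      have "\<bar>b'\<bar> \<le> b'^2"
      proof (cases "b' = 0")
        case False
        hence "\<bar>b'\<bar> * 1 \<le> \<bar>b'\<bar> * \<bar>b'\<bar>" by (intro mult_left_mono) auto
        thus ?thesis by (simp add: power2_eq_square)
      qed simp
      hence "real_of_int \<bar>b'\<bar> \<le> real_of_int (b'^2)" by (simp only: of_int_le_iff)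
      also have "\<dots> \<le> E2 * E3" using b2 by simp
      also have "\<dots> \<le> real B" unfolding B_def by (rule real_nat_ceiling_ge)
      finally show ?thesis by linarith
    qed
    have zN: "\<bar>real_of_int z\<bar> \<le> N * k"
    proof -
      have b2B: "(real_of_int b')^2 \<le> real B^2"
      proof -
        have "\<bar>real_of_int b'\<bar> \<le> real B" using bB by linarith
        thus ?thesis by (simp add: abs_le_square_iff[symmetric])
      qed
      have "real_of_int (z^2 * n') \<le> real_of_int (2 * (t^2 + u^2) + 2 * b'^2 * (t1^2 + u1^2))"
        using zb(3) by (simp only: of_int_le_iff)
      hence "(real_of_int z)^2 * real_of_int n' \<le> 2 * nt + 2 * (real_of_int b')^2 * n1r'" unfolding nt_def n1r'_def by simp
      also have "\<dots> \<le> 2 * (E3 * k^2 * (E1 * real_of_int n')) + 2 * real B^2 * (2 * (E1 * k)^2 * real_of_int n')"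
      proof (intro add_mono)
        have "E3 * k^2 * real_of_int n \<le> E3 * k^2 * (E1 * real_of_int n')" using nE E3 by (intro mult_left_mono) auto
        thus "2 * nt \<le> 2 * (E3 * k^2 * (E1 * real_of_int n'))" using nt by simp
        have "2 * k'^2 * real_of_int n' \<le> 2 * (E1 * k)^2 * real_of_int n'"
          using k'E k'0 nr0 by (intro mult_right_mono mult_left_mono power_mono) auto
        hence w: "n1r' \<le> 2 * (E1 * k)^2 * real_of_int n'" using n1r' by linarith
        have "n1r' \<ge> 0" unfolding n1r'_def by simp
        thus "2 * (real_of_int b')^2 * n1r' \<le> 2 * real B^2 * (2 * (E1 * k)^2 * real_of_int n')"
          using b2B w by (intro mult_mono) auto
      qed
      also have "\<dots> = 2 * (E3 * E1 + 2 * real B^2 * E1^2) * k^2 * real_of_int n'" by (simp add: algebra_simps power2_eq_square)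
      finally have "(real_of_int z)^2 \<le> 2 * (E3 * E1 + 2 * real B^2 * E1^2) * k^2"
        using nr0 by (simp add: mult_le_cancel_right)
      also have "\<dots> \<le> E4^2 * k^2"
      proof (rule mult_right_mono)
        have "2 * (E3 * E1 + 2 * real B^2 * E1^2) \<le> E4" unfolding E4_def by simp
        also have "E4 \<le> E4^2" using E4 by (simp add: power2_eq_square)
        finally show "2 * (E3 * E1 + 2 * real B^2 * E1^2) \<le> E4^2" .
      qed simp
      finally have "\<bar>real_of_int z\<bar>^2 \<le> (E4 * k)^2" by (simp add: power_mult_distrib)
      hence "\<bar>real_of_int z\<bar> \<le> E4 * k" by (rule power2_le_imp_le) (use E4 k1 in simp)
      also have "\<dots> \<le> N * k" using N(2) k1 by (intro mult_right_mono) auto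
      finally show ?thesis .
    qed
    have "quartic (c1/Q) (c2/Q) (c3/Q) (c4/Q) (real_of_int i) = F (of_int x) (of_int y) / Q"
      unfolding phi x_def y_def by simp
    also have "\<dots> = ((real_of_int t)^4 + (real_of_int u)^4) / mr"
      unfolding Ftu Q_def mrm using Dr by simp
    also have "(real_of_int t)^4 + (real_of_int u)^4 = real_of_int ((z * t0 + b' * t1)^4 + (z * u0 + b' * u1)^4)"
      unfolding zb(1) by simp
    also have "\<dots> = (of_int z * of_int t0 + of_int b' * of_int t1)^4 + (of_int z * of_int u0 + of_int b' * of_int u1)^4" by simp
    finally have "quartic (c1/Q) (c2/Q) (c3/Q) (c4/Q) (real_of_int i) = quartic (g1 b') (g2 b') (g3 b') (g4 b') (real_of_int z)"
      unfolding geq .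
    thus ?thesis using bB zN by blast
  qed
  obtain b' r s :: int where r: "r = 1 \<or> r = -1" and eq: "\<And>x. quartic (c1/Q) (c2/Q) (c3/Q) (c4/Q) x
      = quartic (g1 b') (g2 b') (g3 b') (g4 b') (real_of_int r * x + real_of_int s)"
    using curve[OF kk ph1 ph2 ph3, of g1 g2 g3 g4 "c4/Q"] gb conv sol by blast
  \<comment> \<open>The shift \<open>s\<close> is absorbed into the second vector; the sign
    \<open>r\<close> stays with the first.\<close>
  define t2 where "t2 = s * t0 + b' * t1"
  define u2 where "u2 = s * u0 + b' * u1"
  have aff: "F (x * of_int x0 + of_int x1) (x * of_int y0 + of_int y1)
      = Dr * ((x * of_int (r * t0) + of_int t2)^4 + (x * of_int (r * u0) + of_int u2)^4)" for x
  proof -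
    have "F (x * of_int x0 + of_int x1) (x * of_int y0 + of_int y1) / Q
      = (((of_int r * x + of_int s) * of_int t0 + of_int b' * of_int t1)^4
        + ((of_int r * x + of_int s) * of_int u0 + of_int b' * of_int u1)^4) / mr"
      using eq[of x] unfolding phi geq .
    also have "(of_int r * x + of_int s) * of_int t0 + of_int b' * of_int t1 = x * of_int (r * t0) + of_int t2"
      unfolding t2_def by (simp add: algebra_simps)
    also have "(of_int r * x + of_int s) * of_int u0 + of_int b' * of_int u1 = x * of_int (r * u0) + of_int u2"
      unfolding u2_def by (simp add: algebra_simps)
    finally show ?thesis unfolding Q_def mrm[symmetric] using Dr mr0 by (simp add: divide_eq_eq eq_divide_eq)
  qed
  \<comment> \<open>For y = 0 the identity is the equality of the values at the two short vectors,
    as r^4 = 1; otherwise it follows from \<open>aff\<close> by homogeneity.\<close>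
  have hom: "F (x * of_int x0 + y * of_int x1) (x * of_int y0 + y * of_int y1)
      = Dr * ((x * of_int (r * t0) + y * of_int t2)^4 + (x * of_int (r * u0) + y * of_int u2)^4)" for x y
  proof (cases "y = 0")
    case True
    have "F (x * of_int x0) (x * of_int y0) = x^4 * (Dr * real_of_int m)" unfolding F_scale Fv ..
    moreover have "(real_of_int r)^4 = 1" using r by auto
    ultimately show ?thesis unfolding True m_def by (simp add: power_mult_distrib algebra_simps)
  next
    case False
    have "F (x * of_int x0 + y * of_int x1) (x * of_int y0 + y * of_int y1)
        = F (y * ((x/y) * of_int x0 + of_int x1)) (y * ((x/y) * of_int y0 + of_int y1))"
      using False by (simp add: distrib_left)
    also have "\<dots> = y^4 * (Dr * (((x/y) * of_int (r * t0) + of_int t2)^4 + ((x/y) * of_int (r * u0) + of_int u2)^4))"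
      unfolding F_scale aff ..
    also have "\<dots> = Dr * ((y * ((x/y) * of_int (r * t0) + of_int t2))^4 + (y * ((x/y) * of_int (r * u0) + of_int u2))^4)"
    proof -
      have "y^4 * (Dr * (P^4 + Q^4)) = Dr * ((y * P)^4 + (y * Q)^4)" for P Q
        by (simp add: power_mult_distrib algebra_simps)
      thus ?thesis .
    qed
    also have "y * ((x/y) * of_int (r * t0) + of_int t2) = x * of_int (r * t0) + y * of_int t2"
      using False by (simp add: distrib_left)
    also have "y * ((x/y) * of_int (r * u0) + of_int u2) = x * of_int (r * u0) + y * of_int u2"
      using False by (simp add: distrib_left)
    finally show ?thesis .
  qed
  show ?thesis
    by (rule that[OF p pP(1) det hom[unfolded F_def Dr_def]])
qed

subsection \<open>From one prime to an integral substitution\<close>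

text \<open>Cramer's rule inverts the substitution of determinant \<open>p\<close> on the side of
  the form.\<close>

lemma form_matches_rationally:
  fixes a b c d e D :: int and P :: nat
  assumes D: "D > 0"
    and rep: "\<And>x y. \<exists>t u. bform a b c d e x y = D * (t^4 + u^4)"
    and rep': "\<And>t u. \<exists>x y. bform a b c d e x y = D * (t^4 + u^4)"
    and disc: "bdisc a b c d e \<noteq> 0"
  obtains p and A B A' B' :: int where "prime (p::nat)" "p > P"
    "\<And>x y::real. bform (of_int a) (of_int b) (of_int c) (of_int d) (of_int e) x y
      = of_int D * ((of_int A / of_nat p * x + of_int B / of_nat p * y)^4 + (of_int A' / of_nat p * x + of_int B' / of_nat p * y)^4)"
proof -
  obtain p x0 y0 x1 y1 t0 u0 t1 u1 where p: "prime (p::nat)" "p > P" and det: "x0 * y1 - y0 * x1 = int p"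
    and eq: "\<And>x y::real. bform (of_int a) (of_int b) (of_int c) (of_int d) (of_int e)
        (x * of_int x0 + y * of_int x1) (x * of_int y0 + y * of_int y1)
      = of_int D * ((x * of_int t0 + y * of_int t1)^4 + (x * of_int u0 + y * of_int u1)^4)"
    by (rule form_matches_at_prime[OF D rep rep' disc, of P]) blast
  have p0: "real p \<noteq> 0" using p prime_gt_0_nat by simp
  have detr: "real_of_int x0 * real_of_int y1 - real_of_int y0 * real_of_int x1 = real p"
    using arg_cong[OF det, of real_of_int] by simp
  show ?thesis
  proof (rule that[OF p, of "y1 * t0 - y0 * t1" "x0 * t1 - x1 * t0" "y1 * u0 - y0 * u1" "x0 * u1 - x1 * u0"])
    fix X Y :: real
    define x y where "x = (X * of_int y1 - Y * of_int x1) / real p" and "y = (Y * of_int x0 - X * of_int y0) / real p"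
    have "x * of_int x0 + y * of_int x1 = X * ((real_of_int x0 * real_of_int y1 - real_of_int y0 * real_of_int x1) / real p)"
      unfolding x_def y_def using p0 by (simp add: field_simps)
    hence 1: "x * of_int x0 + y * of_int x1 = X" unfolding detr using p0 by simp
    have "x * of_int y0 + y * of_int y1 = Y * ((real_of_int x0 * real_of_int y1 - real_of_int y0 * real_of_int x1) / real p)"
      unfolding x_def y_def using p0 by (simp add: field_simps)
    hence 2: "x * of_int y0 + y * of_int y1 = Y" unfolding detr using p0 by simp
    have 3: "x * of_int s0 + y * of_int s1
        = of_int (y1 * s0 - y0 * s1) / real p * X + of_int (x0 * s1 - x1 * s0) / real p * Y" for s0 s1
      unfolding x_def y_def using p0 by (simp add: field_simps)
    show "bform (of_int a) (of_int b) (of_int c) (of_int d) (of_int e) X Y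
      = of_int D * ((of_int (y1 * t0 - y0 * t1) / of_nat p * X + of_int (x0 * t1 - x1 * t0) / of_nat p * Y)^4
        + (of_int (y1 * u0 - y0 * u1) / of_nat p * X + of_int (x0 * u1 - x1 * u0) / of_nat p * Y)^4)"
      using eq[of x y, unfolded 1 2] unfolding 3 .
  qed
qed

text \<open>Evaluation at (1,0), (0,1), (1,1) and (1,-1) isolates the coefficient of s^2 t^2, six
  times a sum of two squares; so a b = c d = 0.\<close>

lemma sum_pow4_automorphism:
  fixes a b c d :: real
  assumes "\<And>s t. (a * s + b * t)^4 + (c * s + d * t)^4 = s^4 + t^4"
  shows "(\<bar>a\<bar> = 1 \<and> b = 0 \<and> c = 0 \<and> \<bar>d\<bar> = 1) \<or> (a = 0 \<and> \<bar>b\<bar> = 1 \<and> \<bar>c\<bar> = 1 \<and> d = 0)"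
proof -
  have 1: "a^4 + c^4 = 1" using assms[of 1 0] by simp
  have 2: "b^4 + d^4 = 1" using assms[of 0 1] by simp
  have "(a + b)^4 + (a - b)^4 + ((c + d)^4 + (c - d)^4) = 4" using assms[of 1 1] assms[of 1 "-1"] by simp
  moreover have e: "(u + v)^4 + (u - v)^4 = 2 * u^4 + 2 * v^4 + 12 * (u * v)^2" for u v :: real
    by (simp add: algebra_simps power2_eq_square power4_eq_xxxx)
  ultimately have "2 * a^4 + 2 * b^4 + 12 * (a * b)^2 + (2 * c^4 + 2 * d^4 + 12 * (c * d)^2) = 4" by (simp only: e)
  hence "(a * b)^2 + (c * d)^2 = 0" using 1 2 by linarith
  hence ab: "a * b = 0" "c * d = 0" by (simp_all add: sum_power2_eq_zero_iff)
  have one: "\<bar>u\<bar> = 1" if "u^4 = 1" for u :: real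
  proof -
    have "\<bar>u\<bar>^4 = 1^4" using that by simp
    thus ?thesis by (subst (asm) power_eq_iff_eq_base) auto
  qed
  show ?thesis
  proof (cases "a = 0")
    case True
    hence "\<bar>c\<bar> = 1" using 1 one by simp
    hence "d = 0" using ab by auto
    thus ?thesis using True \<open>\<bar>c\<bar> = 1\<close> 2 one by simp
  next
    case False
    hence b: "b = 0" using ab by simp
    hence "\<bar>d\<bar> = 1" using 2 one by simp
    hence "c = 0" using ab by auto
    thus ?thesis using b \<open>\<bar>d\<bar> = 1\<close> 1 one by simp
  qed
qed

text \<open>Clearing denominators gives |A| q = |B| p with \<open>p\<close> and \<open>q\<close>
  coprime, so \<open>p\<close> divides \<open>A\<close>.\<close>

lemma prime_quotient_integral:
  fixes p q :: nat and A B :: int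
  assumes p: "prime p" and q: "prime q" "q > p" and eq: "\<bar>real_of_int A / real p\<bar> = \<bar>real_of_int B / real q\<bar>"
  shows "\<exists>A'. real_of_int A / real p = real_of_int A'"
proof -
  have pq: "real p > 0" "real q > 0" using p q prime_gt_0_nat by auto
  hence "\<bar>real_of_int A\<bar> * real q = \<bar>real_of_int B\<bar> * real p" using eq by (simp add: abs_divide field_simps)
  hence "real_of_int (\<bar>A\<bar> * int q) = real_of_int (\<bar>B\<bar> * int p)" by simp
  hence "\<bar>A\<bar> * int q = \<bar>B\<bar> * int p" by (simp only: of_int_eq_iff)
  hence "int p dvd \<bar>A\<bar> * int q" by simp
  moreover have "coprime (int p) (int q)" using primes_coprime[OF p q(1)] q(2) by simp
  ultimately have "int p dvd \<bar>A\<bar>" by (simp add: coprime_dvd_mult_left_iff)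
  then obtain A' where "A = int p * A'" by auto
  hence "real_of_int A / real p = real_of_int A'" using pq by simp
  thus ?thesis by blast
qed

lemma
  fixes i j :: int
  shows sum_pow4_eq_1: "i^4 + j^4 = 1 \<Longrightarrow> (\<bar>i\<bar> = 1 \<and> j = 0) \<or> (i = 0 \<and> \<bar>j\<bar> = 1)"
    and sum_pow4_eq_2: "i^4 + j^4 = 2 \<Longrightarrow> \<bar>i\<bar> = 1 \<and> \<bar>j\<bar> = 1"
proof -
  have small: "k = 0 \<or> k = 1 \<or> k = -1" if "k^4 \<le> 2" for k :: int
  proof (rule ccontr)
    assume "\<not> (k = 0 \<or> k = 1 \<or> k = -1)"
    hence "2 \<le> \<bar>k\<bar>" by arith
    hence "2^4 \<le> \<bar>k\<bar>^4" by (intro power_mono) auto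
    thus False using that by simp
  qed
  have nn: "i^4 \<ge> 0" "j^4 \<ge> 0" by simp_all
  show "(\<bar>i\<bar> = 1 \<and> j = 0) \<or> (i = 0 \<and> \<bar>j\<bar> = 1)" if h: "i^4 + j^4 = 1"
  proof -
    have "i^4 \<le> 2" "j^4 \<le> 2" using h nn by linarith+
    thus ?thesis using small[of i] small[of j] h by auto
  qed
  show "\<bar>i\<bar> = 1 \<and> \<bar>j\<bar> = 1" if h: "i^4 + j^4 = 2"
  proof -
    have "i^4 \<le> 2" "j^4 \<le> 2" using h nn by linarith+
    thus ?thesis using small[of i] small[of j] h by auto
  qed
qed

lemma form_eq_sum_pow4:
  fixes a b c d e D :: int
  assumes D: "D > 0"
    and rep: "\<And>x y. \<exists>t u. bform a b c d e x y = D * (t^4 + u^4)"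
    and rep': "\<And>t u. \<exists>x y. bform a b c d e x y = D * (t^4 + u^4)"
    and disc: "bdisc a b c d e \<noteq> 0"
  obtains A B A' B' :: int where "A * B' - B * A' = 1 \<or> A * B' - B * A' = -1"
    "\<And>x y::real. bform (of_int a) (of_int b) (of_int c) (of_int d) (of_int e) x y
      = of_int D * ((of_int A * x + of_int B * y)^4 + (of_int A' * x + of_int B' * y)^4)"
proof -
  define F where "F = bform (real_of_int a) (real_of_int b) (real_of_int c) (real_of_int d) (real_of_int e)"
  have F_int: "F (of_int x) (of_int y) = real_of_int (bform a b c d e x y)" for x y
    unfolding F_def of_int_bform ..
  have D0: "real_of_int D > 0" using D by simp
  have nn: "F (of_int x) (of_int y) \<ge> 0" for x y
  proof -
    obtain t u where "bform a b c d e x y = D * (t^4 + u^4)" using rep by blast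
    moreover have "D * (t^4 + u^4) \<ge> 0" using D by simp
    ultimately have "bform a b c d e x y \<ge> 0" by simp
    thus ?thesis unfolding F_int by (simp only: of_int_0_le_iff)
  qed
  have discr: "bdisc (real_of_int a) (real_of_int b) (real_of_int c) (real_of_int d) (real_of_int e) \<noteq> 0"
    unfolding of_int_bdisc[symmetric] using disc by simp
  obtain L where L: "L > 0" "\<And>x y. F x y \<ge> L * (x^2 + y^2)^2"
    using bform_lower_bound[OF nn[unfolded F_def] discr] unfolding F_def by blast
  have pd: "x = 0 \<and> y = 0" if "F x y = 0" for x y
  proof -
    have "L * (x^2 + y^2)^2 \<le> 0" using L(2)[of x y] that by simp
    hence "(x^2 + y^2)^2 \<le> 0" using L(1) by (simp add: mult_le_0_iff)
    hence "x^2 + y^2 = 0" by simp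
    thus ?thesis by (simp add: sum_power2_eq_zero_iff)
  qed
  obtain p and A1 B1 A1' B1' :: int where p: "prime (p::nat)" "p > 0"
    and F1: "\<And>x y. F x y = of_int D * ((of_int A1 / of_nat p * x + of_int B1 / of_nat p * y)^4
       + (of_int A1' / of_nat p * x + of_int B1' / of_nat p * y)^4)"
    unfolding F_def by (rule form_matches_rationally[OF D rep rep' disc, of 0]) blast
  obtain q and A2 B2 A2' B2' :: int where q: "prime (q::nat)" "q > p"
    and F2: "\<And>x y. F x y = of_int D * ((of_int A2 / of_nat q * x + of_int B2 / of_nat q * y)^4
       + (of_int A2' / of_nat q * x + of_int B2' / of_nat q * y)^4)"
    unfolding F_def by (rule form_matches_rationally[OF D rep rep' disc, of p]) blast
  define al be ga de where "al = real_of_int A1 / real p" and "be = real_of_int B1 / real p"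
    and "ga = real_of_int A1' / real p" and "de = real_of_int B1' / real p"
  define al2 be2 ga2 de2 where "al2 = real_of_int A2 / real q" and "be2 = real_of_int B2 / real q"
    and "ga2 = real_of_int A2' / real q" and "de2 = real_of_int B2' / real q"
  have F1: "F x y = of_int D * ((al * x + be * y)^4 + (ga * x + de * y)^4)" for x y
    unfolding al_def be_def ga_def de_def by (rule F1)
  have F2: "F x y = of_int D * ((al2 * x + be2 * y)^4 + (ga2 * x + de2 * y)^4)" for x y
    unfolding al2_def be2_def ga2_def de2_def by (rule F2)
  define dt where "dt = al * de - be * ga"
  \<comment> \<open>A kernel vector of the matrix would be a non-trivial zero of a definite
    form.\<close>
  have dt: "dt \<noteq> 0"
  proof
    assume z: "dt = 0"
    have "F de (- ga) = of_int D * (dt^4 + (ga * de - de * ga)^4)"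
      unfolding F1 dt_def by (simp add: algebra_simps)
    hence g': "F de (- ga) = 0" using z by simp
    have g: "de = 0" "ga = 0" using pd[OF g'] by simp_all
    have a': "F be (- al) = 0" unfolding F1 g by (simp add: algebra_simps)
    have "be = 0" "al = 0" using pd[OF a'] by simp_all
    hence "F 1 0 = 0" unfolding F1 using g by simp
    thus False using pd[of 1 0] by simp
  qed
  \<comment> \<open>The second matrix times the inverse of the first; it preserves s^4 +
    t^4.\<close>
  define a0 b0 c0 d0 where "a0 = (al2 * de - be2 * ga) / dt" and "b0 = (be2 * al - al2 * be) / dt"
    and "c0 = (ga2 * de - de2 * ga) / dt" and "d0 = (de2 * al - ga2 * be) / dt"
  have aut: "(a0 * s + b0 * t)^4 + (c0 * s + d0 * t)^4 = s^4 + t^4" for s t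
  proof -
    define x y where "x = (de * s - be * t) / dt" and "y = (al * t - ga * s) / dt"
    have 1: "al * x + be * y = s"
    proof -
      have "al * x + be * y = s * ((al * de - be * ga) / dt)" unfolding x_def y_def using dt by (simp add: field_simps)
      thus ?thesis using dt unfolding dt_def[symmetric] by simp
    qed
    have 2: "ga * x + de * y = t"
    proof -
      have "ga * x + de * y = t * ((al * de - be * ga) / dt)" unfolding x_def y_def using dt by (simp add: field_simps)
      thus ?thesis using dt unfolding dt_def[symmetric] by simp
    qed
    have 3: "al2 * x + be2 * y = a0 * s + b0 * t" unfolding x_def y_def a0_def b0_def using dt by (simp add: field_simps)
    have 4: "ga2 * x + de2 * y = c0 * s + d0 * t" unfolding x_def y_def c0_def d0_def using dt by (simp add: field_simps)
    have "real_of_int D * ((al * x + be * y)^4 + (ga * x + de * y)^4) = real_of_int D * ((al2 * x + be2 * y)^4 + (ga2 * x + de2 * y)^4)"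
      by (rule trans[OF F1[of x y, symmetric] F2[of x y]])
    thus ?thesis unfolding 1 2 3 4 using D0 by simp
  qed
  have rows: "al2 = a0 * al + b0 * ga" "be2 = a0 * be + b0 * de" "ga2 = c0 * al + d0 * ga" "de2 = c0 * be + d0 * de"
  proof -
    have "a0 * al + b0 * ga = al2 * ((al * de - be * ga) / dt)" unfolding a0_def b0_def using dt by (simp add: field_simps)
    thus "al2 = a0 * al + b0 * ga" using dt unfolding dt_def[symmetric] by simp
    have "a0 * be + b0 * de = be2 * ((al * de - be * ga) / dt)" unfolding a0_def b0_def using dt by (simp add: field_simps)
    thus "be2 = a0 * be + b0 * de" using dt unfolding dt_def[symmetric] by simp
    have "c0 * al + d0 * ga = ga2 * ((al * de - be * ga) / dt)" unfolding c0_def d0_def using dt by (simp add: field_simps)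
    thus "ga2 = c0 * al + d0 * ga" using dt unfolding dt_def[symmetric] by simp
    have "c0 * be + d0 * de = de2 * ((al * de - be * ga) / dt)" unfolding c0_def d0_def using dt by (simp add: field_simps)
    thus "de2 = c0 * be + d0 * de" using dt unfolding dt_def[symmetric] by simp
  qed
  have abs: "(\<bar>al\<bar> = \<bar>al2\<bar> \<and> \<bar>be\<bar> = \<bar>be2\<bar> \<and> \<bar>ga\<bar> = \<bar>ga2\<bar> \<and> \<bar>de\<bar> = \<bar>de2\<bar>)
      \<or> (\<bar>al\<bar> = \<bar>ga2\<bar> \<and> \<bar>be\<bar> = \<bar>de2\<bar> \<and> \<bar>ga\<bar> = \<bar>al2\<bar> \<and> \<bar>de\<bar> = \<bar>be2\<bar>)"
    using sum_pow4_automorphism[OF aut] unfolding rows by (elim disjE conjE) (simp_all add: abs_mult)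
  note int = prime_quotient_integral[OF p(1) q]
  obtain A where A: "al = real_of_int A"
    using abs int[of A1 A2] int[of A1 A2'] unfolding al_def al2_def ga2_def by blast
  obtain B where B: "be = real_of_int B"
    using abs int[of B1 B2] int[of B1 B2'] unfolding be_def be2_def de2_def by blast
  obtain A' where A': "ga = real_of_int A'"
    using abs int[of A1' A2'] int[of A1' A2] unfolding ga_def al2_def ga2_def by blast
  obtain B' where B': "de = real_of_int B'"
    using abs int[of B1' B2'] int[of B1' B2] unfolding de_def be2_def de2_def by blast
  have val: "\<exists>x y. (A * x + B * y)^4 + (A' * x + B' * y)^4 = t^4 + u^4" for t u
  proof -
    obtain x y where xy: "bform a b c d e x y = D * (t^4 + u^4)" using rep' by blast
    have "real_of_int D * real_of_int ((A * x + B * y)^4 + (A' * x + B' * y)^4) = F (of_int x) (of_int y)"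
      unfolding F1 A B A' B' by simp
    also have "\<dots> = real_of_int D * real_of_int (t^4 + u^4)" unfolding F_int xy by simp
    finally have "real_of_int ((A * x + B * y)^4 + (A' * x + B' * y)^4) = real_of_int (t^4 + u^4)" using D0 by simp
    thus ?thesis by (simp only: of_int_eq_iff) blast
  qed
  \<comment> \<open>Points over the values 1 and 2: their images are, up to signs and order, (1,0)
    and (1,1), of determinant 1 or -1. By multiplicativity the determinant of the integral matrix
    divides 1.\<close>
  obtain x y where xy: "(A * x + B * y)^4 + (A' * x + B' * y)^4 = 1" using val[of 1 0] by auto
  obtain x' y' where xy': "(A * x' + B * y')^4 + (A' * x' + B' * y')^4 = 2" using val[of 1 1] by auto
  define i j i' j' where "i = A * x + B * y" and "j = A' * x + B' * y"
    and "i' = A * x' + B * y'" and "j' = A' * x' + B' * y'"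
  have "(\<bar>i\<bar> = 1 \<and> j = 0) \<or> (i = 0 \<and> \<bar>j\<bar> = 1)" using sum_pow4_eq_1[OF xy] unfolding i_def j_def .
  moreover have "\<bar>i'\<bar> = 1" "\<bar>j'\<bar> = 1" using sum_pow4_eq_2[OF xy'] unfolding i'_def j'_def by blast+
  ultimately have "\<bar>i * j' - j * i'\<bar> = 1" by (elim disjE conjE) (simp_all add: abs_mult)
  moreover have "i * j' - j * i' = (A * B' - B * A') * (x * y' - y * x')"
    unfolding i_def j_def i'_def j'_def by (simp add: algebra_simps)
  ultimately have "\<bar>A * B' - B * A'\<bar> * \<bar>x * y' - y * x'\<bar> = 1" by (simp add: abs_mult)
  hence "\<bar>A * B' - B * A'\<bar> = 1" using abs_ge_zero zmult_eq_1_iff by (metis abs_minus_le_zero le_minus_one_simps(3) not_one_le_zero)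
  hence "A * B' - B * A' = 1 \<or> A * B' - B * A' = -1" by arith
  thus ?thesis using that F1 unfolding A B A' B' F_def by blast
qed

section \<open>From rational polynomials to forms with integral coefficients\<close>

lemma binary_form_4_eval2:
  fixes F :: "'a::comm_ring_1 poly poly"
  assumes "binary_form 4 F"
  shows "eval2 F x y = bform (coeff (coeff F 0) 4) (coeff (coeff F 1) 3) (coeff (coeff F 2) 2)
    (coeff (coeff F 3) 1) (coeff (coeff F 4) 0) x y"
proof -
  have z: "coeff (coeff F j) i = 0" if "i + j \<noteq> 4" for i j
    using assms that unfolding binary_form_def by blast
  have row: "coeff F j = monom (coeff (coeff F j) (4 - j)) (4 - j)" if "j \<le> 4" for j
    by (rule poly_eqI) (use z that in \<open>auto simp: coeff_monom\<close>)
  have rowz: "coeff F j = 0" if "j > 4" for j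
    by (rule poly_eqI) (use z that in auto)
  have deg: "degree F \<le> 4" by (rule degree_le) (use rowz in auto)
  have "eval2 F x y = poly (\<Sum>j\<le>4. coeff F j * [:y:] ^ j) x"
  proof -
    have "(\<Sum>j\<le>degree F. coeff F j * [:y:] ^ j) = (\<Sum>j\<le>4. coeff F j * [:y:] ^ j)"
      by (rule sum.mono_neutral_left) (use deg in \<open>auto simp: coeff_eq_0\<close>)
    thus ?thesis unfolding eval2_def poly_altdef[of F] by simp
  qed
  also have "\<dots> = (\<Sum>j\<le>4. poly (coeff F j) x * y ^ j)"
    by (simp add: poly_sum poly_power)
  also have "\<dots> = (\<Sum>j\<le>4. coeff (coeff F j) (4 - j) * x ^ (4 - j) * y ^ j)"
    by (rule sum.cong[OF refl], subst row) (auto simp: poly_monom)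
  also have "\<dots> = bform (coeff (coeff F 0) 4) (coeff (coeff F 1) 3) (coeff (coeff F 2) 2)
    (coeff (coeff F 3) 1) (coeff (coeff F 4) 0) x y"
    unfolding bform_def by (simp add: eval_nat_numeral)
  finally show ?thesis .
qed

text \<open>Finiteness of roots over an infinite domain is used twice: in X for each fixed constant
  y, then in Y with the infinitely many constant polynomials as roots.\<close>

lemma eval2_ext:
  fixes F G :: "'a::{idom,ring_char_0} poly poly"
  assumes "\<And>x y. eval2 F x y = eval2 G x y"
  shows "F = G"
proof (rule ccontr)
  assume "F \<noteq> G"
  hence fin: "finite {p. poly (F - G) p = 0}" by (intro poly_roots_finite) simp
  have "poly (F - G) [:y:] = 0" for y
  proof (rule ccontr)
    assume "poly (F - G) [:y:] \<noteq> 0"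
    hence "finite {x. poly (poly (F - G) [:y:]) x = 0}" by (rule poly_roots_finite)
    moreover have "{x. poly (poly (F - G) [:y:]) x = 0} = UNIV" using assms unfolding eval2_def by auto
    ultimately show False using infinite_UNIV_char_0 by metis
  qed
  hence "range (\<lambda>y. [:y:]) \<subseteq> {p. poly (F - G) p = 0}" by auto
  hence "finite (range (\<lambda>y::'a. [:y:]))" using fin by (rule finite_subset)
  moreover have "inj (\<lambda>y::'a. [:y:])" by (rule injI) simp
  ultimately show False using finite_imageD infinite_UNIV_char_0 by blast
qed

lemma common_denominator:
  fixes S :: "rat set"
  assumes "finite S"
  shows "\<exists>D>0. \<forall>q\<in>S. \<exists>k. of_int D * q = of_int k"
  using assms
proof (induction S rule: finite_induct)
  case (insert q S)
  then obtain D where D: "D > 0" "\<And>q. q \<in> S \<Longrightarrow> \<exists>k. of_int D * q = of_int k" by blast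
  obtain m n where "quotient_of q = (m, n)" by (cases "quotient_of q")
  hence mn: "q = of_int m / of_int n" "n > 0" by (rule quotient_of_div, rule quotient_of_denom_pos)
  have "of_int (D * n) * q = of_int (D * m)" using mn by simp
  moreover have "\<exists>k. of_int (D * n) * r = of_int k" if "r \<in> S" for r
  proof -
    obtain k where "of_int D * r = of_int k" using D(2)[OF \<open>r \<in> S\<close>] by blast
    hence "of_int (D * n) * r = of_int (k * n)" by (simp add: mult.commute mult.left_commute)
    thus ?thesis by blast
  qed
  moreover have "D * n > 0" using D(1) mn(2) by simp
  ultimately show ?case by (intro exI[of _ "D * n"]) blast
qed (auto intro: exI[of _ 1])

theorem corollary1p3:
  fixes F :: "rat poly poly"
  assumes "F \<in> Bin4"
    and "{eval2 F (of_int x) (of_int y) | x y :: int. True}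
           = {m. \<exists>t u :: int. m = of_int t ^ 4 + of_int u ^ 4}"
  shows "\<exists>a b c d :: int. (a * d - b * c = 1 \<or> a * d - b * c = - 1) \<and>
           F = (of_int a * varX + of_int c * varY) ^ 4 + (of_int b * varX + of_int d * varY) ^ 4"
proof -
  define a b c d e where "a = coeff (coeff F 0) 4" and "b = coeff (coeff F 1) 3"
    and "c = coeff (coeff F 2) 2" and "d = coeff (coeff F 3) 1" and "e = coeff (coeff F 4) 0"
  have ev: "eval2 F x y = bform a b c d e x y" for x y
    unfolding a_def b_def c_def d_def e_def
    by (rule binary_form_4_eval2) (use assms(1) in \<open>simp add: Bin4_def\<close>)
  have disc: "bdisc a b c d e \<noteq> 0"
    using assms(1) unfolding Bin4_def disc4_def bdisc_def Let_def a_def b_def c_def d_def e_def by simp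
  \<comment> \<open>The coefficients are only known to be rational; multiplication by
    \<open>D\<close> makes them integral and turns the values into D (t^4 + u^4).\<close>
  obtain D where D: "D > 0" and Dk: "\<forall>q\<in>{a,b,c,d,e}. \<exists>k. of_int D * q = of_int k"
    using common_denominator[of "{a,b,c,d,e}"] by auto
  obtain ia ib ic id ie where i: "of_int D * a = of_int ia" "of_int D * b = of_int ib" "of_int D * c = of_int ic"
    "of_int D * d = of_int id" "of_int D * e = of_int ie" using Dk by auto
  have scale: "of_int D * bform a b c d e x y = bform (of_int ia) (of_int ib) (of_int ic) (of_int id) (of_int ie) x y" for x y
    unfolding bform_def i[symmetric] by (simp add: algebra_simps)
  have iev: "of_int (bform ia ib ic id ie x y) = of_int D * eval2 F (of_int x) (of_int y)" for x y
    unfolding ev scale of_int_bform ..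
  have rep: "\<exists>t u. bform ia ib ic id ie x y = D * (t^4 + u^4)" for x y
  proof -
    have "eval2 F (of_int x) (of_int y) \<in> {m. \<exists>t u :: int. m = of_int t ^ 4 + of_int u ^ 4}"
      unfolding assms(2)[symmetric] by blast
    then obtain t u :: int where "eval2 F (of_int x) (of_int y) = of_int t ^ 4 + of_int u ^ 4" by blast
    hence "(of_int (bform ia ib ic id ie x y) :: rat) = of_int (D * (t^4 + u^4))" unfolding iev by simp
    thus ?thesis unfolding of_int_eq_iff by blast
  qed
  have rep': "\<exists>x y. bform ia ib ic id ie x y = D * (t^4 + u^4)" for t u
  proof -
    have "(of_int t ^ 4 + of_int u ^ 4 :: rat) \<in> {eval2 F (of_int x) (of_int y) | x y :: int. True}"
      unfolding assms(2) by blast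
    then obtain x y :: int where "eval2 F (of_int x) (of_int y) = of_int t ^ 4 + of_int u ^ 4" by force
    hence "(of_int (bform ia ib ic id ie x y) :: rat) = of_int (D * (t^4 + u^4))" unfolding iev by simp
    thus ?thesis unfolding of_int_eq_iff by blast
  qed
  have disc': "bdisc ia ib ic id ie \<noteq> 0"
  proof
    assume "bdisc ia ib ic id ie = 0"
    hence "(of_int (bdisc ia ib ic id ie) :: rat) = 0" by simp
    hence "bdisc (of_int D * a) (of_int D * b) (of_int D * c) (of_int D * d) (of_int D * e) = 0"
      unfolding of_int_bdisc i .
    \<comment> \<open>The discriminant is homogeneous of degree 6 in the coefficients.\<close>
    moreover have "bdisc (of_int D * a) (of_int D * b) (of_int D * c) (of_int D * d) (of_int D * e)
        = of_int D ^ 6 * bdisc a b c d e"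
      unfolding bdisc_def by (simp add: algebra_simps eval_nat_numeral)
    ultimately show False using disc D by simp
  qed
  obtain A B A' B' :: int where det: "A * B' - B * A' = 1 \<or> A * B' - B * A' = -1"
    and eq: "\<And>x y::real. bform (of_int ia) (of_int ib) (of_int ic) (of_int id) (of_int ie) x y
      = of_int D * ((of_int A * x + of_int B * y)^4 + (of_int A' * x + of_int B' * y)^4)"
    by (rule form_eq_sum_pow4[OF D rep rep' disc']) blast
  have "F = (of_int A * varX + of_int B * varY) ^ 4 + (of_int A' * varX + of_int B' * varY) ^ 4"
  proof (rule eval2_ext)
    fix x y :: rat
    \<comment> \<open>The identity was found over the reals; the embedding of the rationals carries
      it back to rational arguments.\<close>
    have "real_of_rat (of_int D * eval2 F x y)
        = bform (of_int ia) (of_int ib) (of_int ic) (of_int id) (of_int ie) (real_of_rat x) (real_of_rat y)"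
      unfolding ev scale unfolding bform_def by (simp add: of_rat_add of_rat_mult of_rat_power)
    also have "\<dots> = real_of_rat (of_int D * ((of_int A * x + of_int B * y)^4 + (of_int A' * x + of_int B' * y)^4))"
      unfolding eq by (simp add: of_rat_add of_rat_mult of_rat_power)
    finally have "of_int D * eval2 F x y = of_int D * ((of_int A * x + of_int B * y)^4 + (of_int A' * x + of_int B' * y)^4)"
      by (simp only: of_rat_eq_iff)
    hence "eval2 F x y = (of_int A * x + of_int B * y)^4 + (of_int A' * x + of_int B' * y)^4" using D by simp
    thus "eval2 F x y = eval2 ((of_int A * varX + of_int B * varY) ^ 4 + (of_int A' * varX + of_int B' * varY) ^ 4) x y"
      by (simp only: eval2_simps)
  qed
  \<comment> \<open>The statement pairs \<open>a\<close> and \<open>c\<close> in one linear form, so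
    a = A, c = B, b = A', d = B'.\<close>
  moreover have "A * B' - A' * B = 1 \<or> A * B' - A' * B = -1" using det by (simp add: mult.commute)
  ultimately show ?thesis by blast
qed

end
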